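(* Let $k$ be a field, $R=k[x_1,\dots,x_n]$, $d\ge1$, and let $\alpha^1,\dots,\alpha^r$ be exponent vectors with $|\alpha^s|=d$ for all $1\le s\le r$ and $\deg\operatorname{lcm}(x^{\alpha^s},x^{\alpha^t})\ge d+2$ for all $s\neq t$. Define $\mathrm{rk}_\ell:=\sum_{s=1}^r\operatorname{rank}(\phi_\ell^{I_s,\alpha^s}\otimes k)$. Let $K'$ be the equigenerated monomial ideal with complementary ideal $\overline{K'}=(x^{\alpha^1},\dots,x^{\alpha^r})$, i.e. $K'$ is generated by all monomials of degree $d$ other than $x^{\alpha^1},\dots,x^{\alpha^r}$. Then $R/K'$ has Betti table $$\begin{array}{c|cccccc} & 0 & 1 & \cdots & \ell & \cdots & n\\ \hline 0 & 1 & \cdot & \cdots & \cdot & \cdots & \cdot\\ \vdots & \cdot & \cdot & \cdots & \cdot & \cdots & \cdot\\ d-1 & \cdot & \binom{n+d-1}{d}-r & \cdots & \binom{n+d-1}{\ell+d-1}\binom{d+\ell-2}{\ell-1}-\mathrm{rk}_{\ell-1} & \cdots & \binom{n+d-2}{n-1}-\sum_{s=1}^r n_{\alpha^s}\\ d & \cdot & \cdot & \cdots & \sum_{s=1}^r\operatorname{rank}\bigwedge^\ell U_s-\mathrm{rk}_\ell & \cdots & r \end{array}$$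
   Context: Betti table convention: the entry in row $j$ and column $i$ is $\dim_k\operatorname{Tor}_i^R(R/K',k)_{i+j}$; dots and rows not shown are zero. $F=\bigoplus_{i=1}^nRe_i$. For $\beta\in\mathbb{Z}_{\ge0}^n$: $|\beta|=\sum\beta_i$, $x^\beta=\prod x_i^{\beta_i}$, $e^\beta=\prod e_i^{\beta_i}\in S_{|\beta|}(F)$, $n_\beta=|\{i:\beta_i>0\}|$; $\epsilon_i$ is the $i$th unit vector. For $A=\{a_0<\dots<a_m\}$, $e_A=e_{a_0}\wedge\cdots\wedge e_{a_m}$. $L_d^\ell(F)=\ker\big(\kappa_{\ell,d}:\bigwedge^\ell F\otimes S_d(F)\to\bigwedge^{\ell-1}F\otimes S_{d+1}(F)\big)$, where $\kappa_{\ell,d}(e_A\otimes e^\beta)=\sum_j(-1)^je_{A\setminus a_j}\otimes e_{a_j}e^\beta$; it is a free $R$-module. For each $s$: if $\alpha^s=d\epsilon_i$ for some $i$, then $U_s=\bigoplus_{j\ne i}Re_j$ and $I_s=[n]\setminus\{i\}$; otherwise $U_s=F$ and $I_s=[n]$. The map $\phi_\ell^{I_s,\alpha^s}:L_d^\ell(F)\to\bigwedge^\ell U_s$ ($1\le\ell\le n$) is the restriction to $L_d^\ell(F)$ of the $R$-linear map on $\bigwedge^\ell F\otimes S_d(F)$ with $e_A\otimes e^\beta\mapsto e_A$ if $A\subseteq I_s$ and $\beta=\alpha^s$, and $\mapsto0$ otherwise.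
   Formalization: The entry in row d, column n is r minus the number of s with x^{α^s} a pure power x_i^d, instead of r; the printed r fails when pure powers occur, e.g. n=d=2, r=1, α^1=(2,0), K'=(x_1x_2, x_2^2), where the entry is 0. *)

theory Defs
  imports Complex_Main "HOL-Library.Cardinality" "HOL-Library.FuncSet" "HOL-Library.Poly_Mapping" "HOL-Library.Function_Algebras"
begin

text \<open>
  The variables are indexed by a finite linearly ordered type \<open>'n\<close>, so that \<open>n = CARD('n) \<ge> 1\<close>.
  Exponent vectors are \<open>'n \<Rightarrow>\<^sub>0 nat\<close> and the polynomial ring \<open>R = k[x_1,\<dots>,x_n]\<close> is the
  convolution ring \<open>('n \<Rightarrow>\<^sub>0 nat) \<Rightarrow>\<^sub>0 'k\<close>. The order on \<open>'n\<close> only serves to fix the signs of the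
  wedge products \<open>e_A\<close>.
\<close>

type_synonym 'n expvec = "'n \<Rightarrow>\<^sub>0 nat"
type_synonym ('n, 'k) polyring = "'n expvec \<Rightarrow>\<^sub>0 'k"

abbreviation unit_vec :: "'n \<Rightarrow> 'n expvec" where
  "unit_vec i \<equiv> Poly_Mapping.single i 1"

definition mdeg :: "'n::finite expvec \<Rightarrow> nat" where
  "mdeg \<beta> = (\<Sum>i\<in>UNIV. Poly_Mapping.lookup \<beta> i)"

definition lcm_deg :: "'n::finite expvec \<Rightarrow> 'n expvec \<Rightarrow> nat" where
  "lcm_deg \<beta> \<gamma> = (\<Sum>i\<in>UNIV. max (Poly_Mapping.lookup \<beta> i) (Poly_Mapping.lookup \<gamma> i))"

definition supp_card :: "'n::finite expvec \<Rightarrow> nat" where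
  "supp_card \<beta> = card {i. Poly_Mapping.lookup \<beta> i > 0}"

definition const_coeff :: "('n, 'k::zero) polyring \<Rightarrow> 'k" where
  "const_coeff f = Poly_Mapping.lookup f 0"

definition homogeneous :: "int \<Rightarrow> ('n::finite, 'k::zero) polyring \<Rightarrow> bool" where
  "homogeneous e f \<longleftrightarrow> (\<forall>\<beta>\<in>Poly_Mapping.keys f. int (mdeg \<beta>) = e)"

definition ideal_of :: "('n, 'k::field) polyring set \<Rightarrow> ('n, 'k) polyring set" where
  "ideal_of S = module.span (*) S"

definition complement_ideal :: "nat \<Rightarrow> 'n::finite expvec set \<Rightarrow> ('n, 'k::field) polyring set" where
  "complement_ideal d E = ideal_of {Poly_Mapping.single \<beta> 1 | \<beta>. mdeg \<beta> = d \<and> \<beta> \<notin> E}"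

definition kdim :: "('b \<Rightarrow> 'k::field) set \<Rightarrow> nat" where
  "kdim V = vector_space.dim (\<lambda>c f x. c * f x) V"

lemma vector_space_fun: "vector_space (\<lambda>(c::'k::field) (f::'b \<Rightarrow> 'k) x. c * f x)"
  by unfold_locales (auto simp: fun_eq_iff algebra_simps)

lemma module_polyring: "module ((*) :: ('n, 'k::field) polyring \<Rightarrow> ('n, 'k) polyring \<Rightarrow> ('n, 'k) polyring)"
  by unfold_locales (auto simp: algebra_simps)


section \<open>Graded free resolutions and Tor\<close>

text \<open>
  Data for a complex \<open>\<dots> \<rightarrow> F_1 \<rightarrow> F_0 \<rightarrow> R/I\<close> of graded free modules of finite rank:
  \<open>F_i\<close> has a basis \<open>(e_p)\<close>, \<open>p < frank i\<close>, with \<open>e_p\<close> in degree \<open>shift i p\<close>, and its elements are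
  the coordinate vectors vanishing from \<open>frank i\<close> on. The matrix of \<open>F_(i+1) \<rightarrow> F_i\<close> is \<open>dmat i\<close>
  (row index first), and \<open>aug p\<close> is a representative in \<open>R\<close> of the image of \<open>e_p\<close> in \<open>R/I\<close>.
\<close>

record (overloaded) ('n, 'k) free_complex =
  frank :: "nat \<Rightarrow> nat"
  shift :: "nat \<Rightarrow> nat \<Rightarrow> int"
  aug :: "nat \<Rightarrow> ('n, 'k) polyring"
  dmat :: "nat \<Rightarrow> nat \<Rightarrow> nat \<Rightarrow> ('n, 'k) polyring"

definition free_mod :: "('n, 'k::field) free_complex \<Rightarrow> nat \<Rightarrow> (nat \<Rightarrow> ('n, 'k) polyring) set" where
  "free_mod C i = {v. \<forall>p\<ge>frank C i. v p = 0}"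

definition aug_map :: "('n, 'k::field) free_complex \<Rightarrow> (nat \<Rightarrow> ('n, 'k) polyring) \<Rightarrow> ('n, 'k) polyring" where
  "aug_map C v = (\<Sum>p<frank C 0. aug C p * v p)"

definition diff_map ::
  "('n, 'k::field) free_complex \<Rightarrow> nat \<Rightarrow> (nat \<Rightarrow> ('n, 'k) polyring) \<Rightarrow> nat \<Rightarrow> ('n, 'k) polyring" where
  "diff_map C i v = (\<lambda>q. if q < frank C i then \<Sum>p<frank C (Suc i). dmat C i q p * v p else 0)"

definition graded_free_resolution ::
  "('n::finite, 'k::field) free_complex \<Rightarrow> ('n, 'k) polyring set \<Rightarrow> bool" where
  "graded_free_resolution C I \<longleftrightarrow>
     (\<forall>p<frank C 0. homogeneous (shift C 0 p) (aug C p)) \<and>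
     (\<forall>i. \<forall>q<frank C i. \<forall>p<frank C (Suc i).
        homogeneous (shift C (Suc i) p - shift C i q) (dmat C i q p)) \<and>
     (\<forall>f. \<exists>v\<in>free_mod C 0. f - aug_map C v \<in> I) \<and>
     {v \<in> free_mod C 0. aug_map C v \<in> I} = diff_map C 0 ` free_mod C 1 \<and>
     (\<forall>i. {v \<in> free_mod C (Suc i). diff_map C i v = (\<lambda>_. 0)} =
           diff_map C (Suc i) ` free_mod C (Suc (Suc i)))"

text \<open>
  The degree-\<open>j\<close> strand of \<open>F \<otimes>\<^sub>R k\<close>: tensoring with \<open>k = R/(x_1,\<dots>,x_n)\<close> keeps the basis
  and replaces the matrix entries by their constant coefficients.
\<close>

definition tens_mod :: "('n, 'k::field) free_complex \<Rightarrow> nat \<Rightarrow> int \<Rightarrow> (nat \<Rightarrow> 'k) set" where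
  "tens_mod C i j = {v. \<forall>p. v p \<noteq> 0 \<longrightarrow> p < frank C i \<and> shift C i p = j}"

definition tens_diff :: "('n, 'k::field) free_complex \<Rightarrow> nat \<Rightarrow> (nat \<Rightarrow> 'k) \<Rightarrow> nat \<Rightarrow> 'k" where
  "tens_diff C i v =
     (\<lambda>q. if q < frank C i then \<Sum>p<frank C (Suc i). const_coeff (dmat C i q p) * v p else 0)"

definition tens_cycles :: "('n, 'k::field) free_complex \<Rightarrow> nat \<Rightarrow> int \<Rightarrow> (nat \<Rightarrow> 'k) set" where
  "tens_cycles C i j =
     {v \<in> tens_mod C i j. case i of 0 \<Rightarrow> True | Suc i' \<Rightarrow> tens_diff C i' v = (\<lambda>_. 0)}"

definition tens_boundaries :: "('n, 'k::field) free_complex \<Rightarrow> nat \<Rightarrow> int \<Rightarrow> (nat \<Rightarrow> 'k) set" where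
  "tens_boundaries C i j = tens_diff C i ` tens_mod C (Suc i) j"

definition homology_dim :: "('n, 'k::field) free_complex \<Rightarrow> nat \<Rightarrow> int \<Rightarrow> nat" where
  "homology_dim C i j = kdim (tens_cycles C i j) - kdim (tens_boundaries C i j)"

text \<open>\<open>dim_k Tor_i(R/I, k)_j\<close>, computed from some graded free resolution of \<open>R/I\<close>.\<close>

definition tor_dim :: "('n::finite, 'k::field) polyring set \<Rightarrow> nat \<Rightarrow> int \<Rightarrow> nat" where
  "tor_dim I i j = homology_dim (SOME C. graded_free_resolution C I) i j"

text \<open>Betti table entry of \<open>R/I\<close> in column \<open>i\<close> and row \<open>j\<close>.\<close>

definition betti :: "('n::finite, 'k::field) polyring set \<Rightarrow> nat \<Rightarrow> int \<Rightarrow> nat" where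
  "betti I i j = tor_dim I i (int i + j)"


section \<open>The modules \<open>L\<close> and the maps \<open>\<phi>\<close>\<close>

text \<open>
  A free module is represented by the coordinate functions supported on its basis:
  \<open>ext_basis I l\<close> indexes the basis \<open>e_A\<close> of the \<open>l\<close>-th exterior power of \<open>\<Oplus>\<^sub>i\<^sub>\<in>\<^sub>I R e_i\<close>,
  and \<open>ext_sym_basis l d\<close> the basis \<open>e_A \<otimes> e\<^sup>\<beta>\<close> of \<open>\<And>\<^sup>l F \<otimes> S\<^sub>d F\<close>.
\<close>

definition ext_basis :: "'n set \<Rightarrow> nat \<Rightarrow> 'n set set" where
  "ext_basis I l = {A. A \<subseteq> I \<and> card A = l}"

definition ext_sym_basis :: "nat \<Rightarrow> nat \<Rightarrow> ('n::finite set \<times> 'n expvec) set" where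
  "ext_sym_basis l d = ext_basis UNIV l \<times> {\<beta>. mdeg \<beta> = d}"

lemma finite_mdeg: "finite {\<beta> :: 'n::finite expvec. mdeg \<beta> = d}"
proof -
  let ?S = "{\<beta> :: 'n expvec. mdeg \<beta> = d}"
  have "Poly_Mapping.lookup \<beta> i \<le> mdeg \<beta>" for \<beta> :: "'n expvec" and i
    unfolding mdeg_def by (intro member_le_sum) auto
  then have "Poly_Mapping.lookup ` ?S \<subseteq> PiE UNIV (\<lambda>_. {..d})"
    by auto
  moreover have "finite (PiE (UNIV :: 'n set) (\<lambda>_. {..d}))"
    by (intro finite_PiE) auto
  ultimately have "finite (Poly_Mapping.lookup ` ?S)"
    by (rule finite_subset)
  then show ?thesis
    by (rule finite_imageD) (simp add: inj_on_def Poly_Mapping.lookup_inject)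
qed

lemma finite_ext_sym_basis: "finite (ext_sym_basis l d)"
  unfolding ext_sym_basis_def ext_basis_def using finite_mdeg by (intro finite_cartesian_product) auto

definition ext_sym ::
  "nat \<Rightarrow> nat \<Rightarrow> ('n::finite set \<times> 'n expvec \<Rightarrow> ('n, 'k::field) polyring) set" where
  "ext_sym l d = {v. \<forall>b. b \<notin> ext_sym_basis l d \<longrightarrow> v b = 0}"

text \<open>
  \<open>kappa_basis A \<beta>\<close> is the image of \<open>e_A \<otimes> e\<^sup>\<beta>\<close>; the position \<open>j\<close> of \<open>a = a\<^sub>j\<close> in \<open>A\<close> is
  \<open>card {b \<in> A. b < a}\<close>.
\<close>

definition kappa_basis ::
  "'n::{finite,linorder} set \<Rightarrow> 'n expvec \<Rightarrow> 'n set \<times> 'n expvec \<Rightarrow> ('n, 'k::field) polyring" where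
  "kappa_basis A \<beta> = (\<lambda>b. \<Sum>a\<in>A.
     if b = (A - {a}, unit_vec a + \<beta>) then (-1) ^ card {b \<in> A. b < a} else 0)"

definition kappa ::
  "nat \<Rightarrow> nat \<Rightarrow> ('n::{finite,linorder} set \<times> 'n expvec \<Rightarrow> ('n, 'k::field) polyring)
    \<Rightarrow> 'n set \<times> 'n expvec \<Rightarrow> ('n, 'k) polyring" where
  "kappa l d v = (\<lambda>b. \<Sum>(A, \<beta>)\<in>ext_sym_basis l d. v (A, \<beta>) * kappa_basis A \<beta> b)"

definition L_mod ::
  "nat \<Rightarrow> nat \<Rightarrow> ('n::{finite,linorder} set \<times> 'n expvec \<Rightarrow> ('n, 'k::field) polyring) set" where
  "L_mod l d = {v \<in> ext_sym l d. kappa l d v = (\<lambda>_. 0)}"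

text \<open>For \<open>\<alpha> = d \<epsilon>\<^sub>i\<close> this is the complement of \<open>{i}\<close>, otherwise everything.\<close>

definition I_set :: "nat \<Rightarrow> 'n expvec \<Rightarrow> 'n set" where
  "I_set d \<alpha> = UNIV - {i. \<alpha> = Poly_Mapping.single i d}"

definition phi ::
  "'n set \<Rightarrow> 'n expvec \<Rightarrow> ('n set \<times> 'n expvec \<Rightarrow> ('n, 'k::field) polyring)
    \<Rightarrow> 'n set \<Rightarrow> ('n, 'k) polyring" where
  "phi I \<alpha> v = (\<lambda>A. if A \<subseteq> I then v (A, \<alpha>) else 0)"

text \<open>
  The rank of \<open>\<phi> \<otimes> k\<close>, i.e. the dimension of its image. As \<open>L \<otimes> k\<close> is spanned by the
  \<open>v \<otimes> 1\<close> with \<open>v \<in> L\<close>, this image consists of the classes of the \<open>\<phi> v\<close> modulo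
  \<open>(x_1,\<dots>,x_n)\<close>, i.e. of their constant coefficients.
\<close>

definition phi_rank :: "'k::field itself \<Rightarrow> nat \<Rightarrow> nat \<Rightarrow> 'n::{finite,linorder} expvec \<Rightarrow> nat" where
  "phi_rank _ l d \<alpha> = kdim ((\<lambda>v A. const_coeff (phi (I_set d \<alpha>) \<alpha> v A)) `
     (L_mod l d :: ('n set \<times> 'n expvec \<Rightarrow> ('n, 'k) polyring) set))"

definition rk_sum ::
  "'k::field itself \<Rightarrow> nat \<Rightarrow> nat \<Rightarrow> (nat \<Rightarrow> 'n::{finite,linorder} expvec) \<Rightarrow> nat \<Rightarrow> nat" where
  "rk_sum K d r \<alpha> l = (\<Sum>s=1..r. phi_rank K l d (\<alpha> s))"

definition ext_rank :: "'n set \<Rightarrow> nat \<Rightarrow> nat" where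
  "ext_rank I l = card (ext_basis I l)"

end

theory Submission
  imports Defs
begin

text \<open>
  For a graded free resolution \<open>C\<close> of \<open>R/I\<close> and the Koszul complex \<open>\<And>\<close> of the variables, every
  fixed-degree part of the double complex \<open>C \<otimes> \<And>\<close> has exact rows and columns, so counting dimensions
  around its squares shows that \<open>C \<otimes> k\<close> and \<open>R/I \<otimes> \<And>\<close> have homology of the same dimension.

  A monomial outside \<open>K'\<close> has degree below \<open>d\<close>, or is some \<open>x\<^sup>\<alpha>\<close> with \<open>\<alpha> = \<alpha>\<^sup>s\<close>, or is a pure power
  \<open>x_i\<^sup>e\<close> with \<open>e > d\<close> and \<open>d \<epsilon>\<^sub>i\<close> among the \<open>\<alpha>\<^sup>s\<close>: two different divisors of degree \<open>d\<close> of a monomial of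
  degree \<open>d + 1\<close> have least common multiple of degree \<open>d + 1\<close>. Hence the Koszul homology of \<open>R/K'\<close>
  agrees with that of \<open>R\<close> outside rows \<open>d - 1\<close> and \<open>d\<close>. The chains of row \<open>d\<close> are spanned by the
  \<open>e_A \<otimes> x\<^sup>\<alpha>\<close>, the cycles among them are \<open>\<Oplus>\<^sub>s \<And>\<^sup>l U\<^sub>s\<close>, and the boundaries are the projection of
  \<open>im \<kappa> = ker \<kappa> = L \<otimes> k\<close>. The projection splits over \<open>s\<close>, since no monomial of degree \<open>d - 1\<close> divides
  two of the \<open>x\<^sup>\<alpha>\<close>, and its rank is therefore the sum of the ranks of the \<open>\<phi> \<otimes> k\<close>.
\<close>

section \<open>Dimensions of spaces of functions\<close>

text \<open>\<open>tor_dim\<close> takes its resolution from an unspecified choice, so one must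
  exist, which the Taylor complex of the monomial generators supplies, and the comparison must hold
  for every graded free resolution. It works with dimensions alone and forms no quotient spaces; its
  one diagram chase is rank-nullity applied twice to the same space. The Koszul complex is the
  Taylor complex of the variables, so one contraction, made in each multidegree, yields both
  exactness statements. The bound d + 2 enters in two equivalent shapes: distinct members of S have
  no common multiple of degree d + 1, and no common divisor of degree d - 1. The product of
  binomials in row d - 1 is the rank of the Koszul differential over R in polynomial degree d - 1.
  What remains in both rows is the dimension of the boundaries in row d. In exterior degree l >= 1
  it is rk_l; in exterior degree 0 it is r, which gives column 1, and in exterior degree n - 1 it is
  the sum of the n_\<alpha>, which gives column n. For a pure power the n-th exterior power of U_s
  is 0, so the last entry of row d counts only the other monomials.\<close>

lemma (in vector_space) span_Int_complement:
  assumes "independent B" "C \<subseteq> B" "x \<in> span C" "x \<in> span (B - C)"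
  shows "x = 0"
proof -
  have C: "representation C x = representation B x"
    using assms by (simp add: representation_extend)
  have D: "representation (B - C) x = representation B x"
    using assms representation_extend[of B x "B - C"] by auto
  have "representation B x b = 0" for b
    using representation_ne_zero[of C x b] representation_ne_zero[of "B - C" x b] C D by auto
  then show ?thesis
    using sum_nonzero_representation_eq[OF assms(1), of x] span_mono[OF assms(2)] assms(3) by auto
qed

text \<open>A basis of the kernel is extended to a basis of \<open>V\<close>; \<open>f\<close> is
  injective on the span of the added vectors, which therefore map to a basis of the image. Only a
  subspace of a finite span is considered, because the ambient function spaces are
  infinite-dimensional.\<close>

lemma (in vector_space_pair) rank_nullity:
  assumes f: "Vector_Spaces.linear s1 s2 f" and V: "vs1.subspace V" and fin: "finite S" "V \<subseteq> vs1.span S"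
  shows "vs1.dim V = vs1.dim {x \<in> V. f x = 0} + vs2.dim (f ` V)"
proof -
  let ?K = "{x \<in> V. f x = 0}"
  obtain C where C: "C \<subseteq> ?K" "vs1.independent C" "?K \<subseteq> vs1.span C" "card C = vs1.dim ?K"
    by (rule vs1.basis_exists)
  obtain B where B: "C \<subseteq> B" "B \<subseteq> V" "vs1.independent B" "V \<subseteq> vs1.span B"
    using vs1.maximal_independent_subset_extend[of C V] C by blast
  have finB: "finite B"
    using vs1.independent_span_bound[OF fin(1) B(3)] B(2) fin(2) by blast
  have inj: "inj_on f (vs1.span (B - C))"
    unfolding linear_inj_on_iff_eq_0[OF f vs1.subspace_span]
  proof safe
    fix x assume x: "x \<in> vs1.span (B - C)" "f x = 0"
    have "x \<in> V"
      using x(1) vs1.span_minimal[OF _ V, of "B - C"] B(2) by auto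
    with x C(3) have "x \<in> vs1.span C"
      by auto
    then show "x = 0"
      using vs1.span_Int_complement[OF B(3,1)] x(1) by blast
  qed
  have ind: "vs2.independent (f ` (B - C))"
    using linear_independent_injective_image[OF f _ inj] vs1.independent_mono[OF B(3)] by blast
  have "f ` B \<subseteq> insert 0 (f ` (B - C))"
    using C(1) by auto
  then have "vs2.span (f ` B) \<subseteq> vs2.span (f ` (B - C))"
    using vs2.span_mono[of "f ` B" "insert 0 (f ` (B - C))"] vs2.span_insert_0[of "f ` (B - C)"] by simp
  then have "f ` V \<subseteq> vs2.span (f ` (B - C))"
    using B(4) linear_span_image[OF f, of B] by blast
  then have "card (f ` (B - C)) = vs2.dim (f ` V)"
    using B(2) by (intro vs2.basis_card_eq_dim[OF _ _ ind]) auto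
  moreover have "card (f ` (B - C)) = card (B - C)"
    by (rule card_image, rule inj_on_subset[OF inj vs1.span_superset])
  moreover have "card B = card C + card (B - C)"
    using card_Un_disjoint[of C "B - C"] finB B(1) finite_subset[OF B(1)]
    by (metis Diff_disjoint Diff_partition finite_Diff)
  moreover have "card B = vs1.dim V"
    using B by (intro vs1.basis_card_eq_dim[OF _ _ B(3)])
  ultimately show ?thesis
    using C(4) by linarith
qed

text \<open>Rank-nullity on \<open>X\<close> and on the two kernels evaluates both sides to the
  dimension of \<open>X\<close> minus that of the common kernel of \<open>f\<close> and
  \<open>g\<close> in \<open>X\<close>.\<close>

lemma kernel_image_square:
  fixes f :: "'a::ab_group_add \<Rightarrow> 'b::ab_group_add" and g :: "'a \<Rightarrow> 'c::ab_group_add"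
  assumes f: "Vector_Spaces.linear s s1 f" and g: "Vector_Spaces.linear s s2 g"
    and X: "module.subspace s X" "finite S" "X \<subseteq> module.span s S"
  shows "vector_space.dim s1 (f ` X) + vector_space.dim s2 (g ` {x \<in> X. f x = 0}) =
    vector_space.dim s2 (g ` X) + vector_space.dim s1 (f ` {x \<in> X. g x = 0})"
proof -
  interpret F: Vector_Spaces.linear s s1 f by (fact f)
  interpret G: Vector_Spaces.linear s s2 g by (fact g)
  interpret A: vector_space_pair s s1 ..
  interpret B: vector_space_pair s s2 ..
  have sf: "module.subspace s {x \<in> X. f x = 0}"
    using X(1) by (auto simp: F.vs1.subspace_def F.add F.scale)
  have sg: "module.subspace s {x \<in> X. g x = 0}"
    using X(1) by (auto simp: F.vs1.subspace_def G.add G.scale)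
  have eq: "{x \<in> {x \<in> X. g x = 0}. f x = 0} = {x \<in> {x \<in> X. f x = 0}. g x = 0}"
    by auto
  have sub: "{x \<in> X. f x = 0} \<subseteq> module.span s S" "{x \<in> X. g x = 0} \<subseteq> module.span s S"
    using X(3) by auto
  show ?thesis
    using A.rank_nullity[OF f X] B.rank_nullity[OF g X] A.rank_nullity[OF f sg X(2) sub(2)]
      B.rank_nullity[OF g sf X(2) sub(1)] unfolding eq by linarith
qed

abbreviation (input) fscale :: "'k::field \<Rightarrow> ('b \<Rightarrow> 'k) \<Rightarrow> 'b \<Rightarrow> 'k" where
  "fscale \<equiv> \<lambda>c f x. c * f x"

interpretation fun_space: vector_space "fscale :: 'k::field \<Rightarrow> ('b \<Rightarrow> 'k) \<Rightarrow> 'b \<Rightarrow> 'k"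
  by (rule vector_space_fun)

definition supported :: "'b set \<Rightarrow> ('b \<Rightarrow> 'k::zero) set" where
  "supported B = {v. \<forall>b. v b \<noteq> 0 \<longrightarrow> b \<in> B}"

definition unit_fun :: "'b \<Rightarrow> 'b \<Rightarrow> 'k::zero_neq_one" where
  "unit_fun b = (\<lambda>x. if x = b then 1 else 0)"

lemma subspace_supported: "fun_space.subspace (supported B)"
  unfolding fun_space.subspace_def supported_def by (auto; metis add.right_neutral)

lemma supported_empty: "supported {} = {0}"
  by (auto simp: supported_def fun_eq_iff)

lemma sum_fun_apply: "(\<Sum>a\<in>A. F a) x = (\<Sum>a\<in>A. F a x)"
  by (induction A rule: infinite_finite_induct) auto

lemma supported_eq_sum:
  fixes v :: "'b \<Rightarrow> 'k::field"
  assumes "finite B" "v \<in> supported B"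
  shows "v = (\<Sum>b\<in>B. (\<lambda>x. v b * unit_fun b x))"
proof
  fix x
  have "(\<Sum>b\<in>B. (\<lambda>x. v b * unit_fun b x)) x = (\<Sum>b\<in>B. if x = b then v b else 0)"
    by (simp add: unit_fun_def sum_fun_apply if_distrib cong: if_cong)
  then show "v x = (\<Sum>b\<in>B. (\<lambda>x. v b * unit_fun b x)) x"
    using assms by (auto simp: supported_def)
qed

lemma supported_subset_span:
  assumes "finite B"
  shows "(supported B :: ('b \<Rightarrow> 'k::field) set) \<subseteq> fun_space.span (unit_fun ` B)"
proof
  fix v :: "'b \<Rightarrow> 'k" assume "v \<in> supported B"
  then have "v = (\<Sum>b\<in>B. (\<lambda>x. v b * unit_fun b x))"
    by (rule supported_eq_sum[OF assms])
  also have "\<dots> \<in> fun_space.span (unit_fun ` B)"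
    by (intro fun_space.span_sum fun_space.span_scale fun_space.span_base) auto
  finally show "v \<in> fun_space.span (unit_fun ` B)" .
qed

lemma kdim_supported:
  assumes "finite B"
  shows "kdim (supported B :: ('b \<Rightarrow> 'k::field) set) = card B"
proof -
  have inj: "inj_on (unit_fun :: 'b \<Rightarrow> 'b \<Rightarrow> 'k) B"
    by (auto simp: inj_on_def unit_fun_def fun_eq_iff split: if_splits)
  have ind: "fun_space.independent (unit_fun ` B :: ('b \<Rightarrow> 'k) set)"
  proof (rule fun_space.independent_if_scalars_zero)
    show "finite (unit_fun ` B)"
      using assms by simp
    fix c :: "('b \<Rightarrow> 'k) \<Rightarrow> 'k" and v :: "'b \<Rightarrow> 'k"
    assume s: "(\<Sum>x\<in>unit_fun ` B. (\<lambda>y. c x * x y)) = 0" and v: "v \<in> unit_fun ` B"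
    then obtain b where b: "b \<in> B" "v = unit_fun b"
      by auto
    have "0 = (\<Sum>x\<in>unit_fun ` B. (\<lambda>y. c x * x y)) b"
      using s by simp
    also have "\<dots> = (\<Sum>a\<in>B. c (unit_fun a) * unit_fun a b)"
      unfolding sum_fun_apply by (subst sum.reindex[OF inj]) simp
    also have "\<dots> = (\<Sum>a\<in>B. if b = a then c (unit_fun a) else 0)"
      by (intro sum.cong) (auto simp: unit_fun_def)
    finally show "c v = 0"
      using assms b by simp
  qed
  have "unit_fun ` B \<subseteq> (supported B :: ('b \<Rightarrow> 'k) set)"
    by (auto simp: supported_def unit_fun_def split: if_splits)
  then show ?thesis
    unfolding kdim_def
    using fun_space.dim_unique[OF _ supported_subset_span[OF assms] ind] card_image[OF inj] by metis
qed

lemma linear_funI: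
  fixes f :: "('b \<Rightarrow> 'k::field) \<Rightarrow> 'c \<Rightarrow> 'k"
  assumes "\<And>u v. f (u + v) = f u + f v" "\<And>c u. f (\<lambda>x. c * u x) = (\<lambda>x. c * f u x)"
  shows "Vector_Spaces.linear fscale fscale f"
  unfolding Vector_Spaces.linear_iff by (intro conjI allI vector_space_fun) (rule assms)+

lemma kdim_rank_nullity:
  fixes f :: "('b \<Rightarrow> 'k::field) \<Rightarrow> 'c \<Rightarrow> 'k"
  assumes "Vector_Spaces.linear fscale fscale f" "fun_space.subspace V" "finite B" "V \<subseteq> supported B"
  shows "kdim V = kdim {v \<in> V. f v = 0} + kdim (f ` V)"
proof -
  interpret vector_space_pair "fscale :: 'k \<Rightarrow> ('b \<Rightarrow> 'k) \<Rightarrow> _" "fscale :: 'k \<Rightarrow> ('c \<Rightarrow> 'k) \<Rightarrow> _" ..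
  show ?thesis
    unfolding kdim_def using supported_subset_span[OF assms(3)] assms(3,4)
    by (intro rank_nullity[OF assms(1,2), of "unit_fun ` B"]) auto
qed

lemma kdim_zero: "kdim {0 :: 'b \<Rightarrow> 'k::field} = 0"
  using kdim_supported[of "{} :: 'b set", where 'k='k] by (simp add: supported_empty)

lemma kdim_inj_image:
  fixes f :: "('b \<Rightarrow> 'k::field) \<Rightarrow> 'c \<Rightarrow> 'k"
  assumes "Vector_Spaces.linear fscale fscale f" "fun_space.subspace V" "finite B" "V \<subseteq> supported B"
    and "\<And>v. v \<in> V \<Longrightarrow> f v = 0 \<Longrightarrow> v = 0"
  shows "kdim (f ` V) = kdim V"
proof -
  have "f 0 = 0"
    using module_hom.zero[of fscale fscale f] assms(1) by (simp add: module_hom_iff_linear)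
  then have "{v \<in> V. f v = 0} = {0}"
    using assms(2,5) by (auto simp: fun_space.subspace_0)
  then show ?thesis
    using kdim_rank_nullity[OF assms(1-4)] by (simp add: kdim_zero)
qed

text \<open>Rank-nullity for the projection onto one fibre splits off that summand, and the kernel
  satisfies the hypotheses with one index fewer. Closure under the projections, the last hypothesis,
  rules out diagonal subspaces.\<close>

lemma kdim_fibre_sum:
  fixes V :: "('b \<Rightarrow> 'k::field) set" and h :: "'b \<Rightarrow> 't"
  assumes "finite T" "fun_space.subspace V" "finite B" "V \<subseteq> supported B"
    "\<And>v b. v \<in> V \<Longrightarrow> v b \<noteq> 0 \<Longrightarrow> h b \<in> T"
    "\<And>v t. v \<in> V \<Longrightarrow> t \<in> T \<Longrightarrow> (\<lambda>b. if h b = t then v b else 0) \<in> V"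
  shows "kdim V = (\<Sum>t\<in>T. kdim ((\<lambda>v b. if h b = t then v b else 0) ` V))"
  using assms
proof (induction T arbitrary: V rule: finite_induct)
  case empty
  have "V = {0}"
  proof
    show "{0} \<subseteq> V"
      using empty.prems(1) by (simp add: fun_space.subspace_0)
    show "V \<subseteq> {0}"
      using empty.prems(4) by (simp add: fun_eq_iff subset_iff) blast
  qed
  then show ?case by (simp add: kdim_zero)
next
  case (insert t T)
  define p where "p t = (\<lambda>(v :: 'b \<Rightarrow> 'k) b. if h b = t then v b else 0)" for t
  have lin: "Vector_Spaces.linear fscale fscale (p t)" for t
    by (rule linear_funI) (auto simp: p_def fun_eq_iff)
  have pz: "p t v = 0 \<longleftrightarrow> (\<forall>b. h b = t \<longrightarrow> v b = 0)" for t v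
    by (auto simp: p_def fun_eq_iff)
  let ?V = "{v \<in> V. p t v = 0}"
  \<comment> \<open>Replacing \<open>v\<close> by its own \<open>s\<close>-part, which stays in
    \<open>V\<close> and is killed by \<open>p t\<close>, shows that passing to the kernel does not
    shrink the other fibres.\<close>
  have img: "p s ` ?V = p s ` V" if "s \<in> T" for s
  proof
    show "p s ` ?V \<subseteq> p s ` V" by auto
    show "p s ` V \<subseteq> p s ` ?V"
    proof
      fix w assume "w \<in> p s ` V"
      then obtain v where v: "v \<in> V" "w = p s v" by auto
      have "p s v \<in> V"
        using insert.prems(5)[of v s] v that by (simp add: p_def)
      moreover have "p t (p s v) = 0" "p s (p s v) = p s v"
        using that insert.hyps by (auto simp: p_def fun_eq_iff)
      ultimately show "w \<in> p s ` ?V"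
        using v by (metis (mono_tags, lifting) imageI mem_Collect_eq)
    qed
  qed
  have "kdim ?V = (\<Sum>s\<in>T. kdim (p s ` ?V))"
    unfolding p_def
  proof (rule insert.IH)
    show "fun_space.subspace {v \<in> V. (\<lambda>b. if h b = t then v b else 0) = 0}"
      using insert.prems(1) by (auto simp: fun_space.subspace_def fun_eq_iff)
    show "finite B" by fact
    show "{v \<in> V. (\<lambda>b. if h b = t then v b else 0) = 0} \<subseteq> supported B"
      using insert.prems(3) by auto
    show "h b \<in> T" if "v \<in> {v \<in> V. (\<lambda>b. if h b = t then v b else 0) = 0}" "v b \<noteq> 0" for v b
      using that insert.prems(4)[of v b] by (auto dest: fun_cong[of _ _ b])
    show "(\<lambda>b. if h b = s then v b else 0) \<in> {v \<in> V. (\<lambda>b. if h b = t then v b else 0) = 0}"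
      if "v \<in> {v \<in> V. (\<lambda>b. if h b = t then v b else 0) = 0}" "s \<in> T" for v s
      using that insert.prems(5)[of v s] by (auto simp: fun_eq_iff split: if_splits)
  qed
  also have "\<dots> = (\<Sum>s\<in>T. kdim (p s ` V))"
    using img by simp
  finally have "kdim V = (\<Sum>s\<in>T. kdim (p s ` V)) + kdim (p t ` V)"
    by (rule trans[OF kdim_rank_nullity[OF lin[of t] insert.prems(1-3)] arg_cong2[where f="(+)"]]) (rule refl)
  then show ?case
    using insert.hyps by (simp add: p_def)
qed

section \<open>Taylor and Koszul complexes\<close>

text \<open>Only elements below \<open>a\<close> are counted, so \<open>B\<close> and
  \<open>insert a B\<close> give the same sign; this matches the sign in
  \<open>kappa_basis\<close>.\<close>

definition sg :: "'g::linorder \<Rightarrow> 'g set \<Rightarrow> 'k::comm_ring_1" where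
  "sg a B = (-1) ^ card {b \<in> B. b < a}"

lemma sg_square: "sg a B * sg a B = 1"
  by (simp add: sg_def flip: power_add)

lemma sg_insert:
  assumes "finite B" "a \<notin> B"
  shows "sg b (insert a B) = (if a < b then - sg b B else sg b B)"
proof -
  have "{c \<in> insert a B. c < b} = (if a < b then insert a {c \<in> B. c < b} else {c \<in> B. c < b})"
    by auto
  then show ?thesis
    using assms by (simp add: sg_def)
qed

text \<open>The inner sum is the coefficient at a face of the simplicial boundary of the chain
  \<open>c\<close>. Adding two vertices in either order yields the same face, with opposite signs
  because the smaller vertex shifts the position of the larger one.\<close>

lemma simplex_boundary_boundary:
  fixes c :: "'g::linorder set \<Rightarrow> 'k::comm_ring_1"
  assumes "finite G" "finite B"
  shows "(\<Sum>a\<in>G - B. sg a B * (\<Sum>b\<in>G - insert a B. sg b (insert a B) * c (insert b (insert a B)))) = 0"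
proof -
  define P where "P = {(a, b). a \<in> G - B \<and> b \<in> G - B \<and> a < b}"
  define t where "t a b = sg a B * sg b (insert a B) * c (insert b (insert a B))" for a b
  have fin: "finite P"
    by (rule finite_subset[of _ "G \<times> G"]) (use assms in \<open>auto simp: P_def\<close>)
  have "(\<Sum>a\<in>G - B. sg a B * (\<Sum>b\<in>G - insert a B. sg b (insert a B) * c (insert b (insert a B)))) =
      (\<Sum>(a, b)\<in>(SIGMA a:G - B. G - insert a B). t a b)"
    using assms by (simp add: sum_distrib_left mult.assoc t_def flip: sum.Sigma)
  also have "(SIGMA a:G - B. G - insert a B) = P \<union> prod.swap ` P"
    by (auto simp: P_def image_iff)
  also have "(\<Sum>(a, b)\<in>P \<union> prod.swap ` P. t a b) = (\<Sum>(a, b)\<in>P. t a b) + (\<Sum>(a, b)\<in>prod.swap ` P. t a b)"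
    using fin by (intro sum.union_disjoint) (auto simp: P_def)
  also have "(\<Sum>(a, b)\<in>prod.swap ` P. t a b) = (\<Sum>(a, b)\<in>P. t b a)"
    by (subst sum.reindex) (auto simp: case_prod_beta)
  also have "\<dots> = (\<Sum>(a, b)\<in>P. - t a b)"
    using assms by (intro sum.cong) (auto simp: P_def t_def sg_insert insert_commute)
  finally show ?thesis
    by (simp add: case_prod_beta sum_negf)
qed

text \<open>Coning off the simplex on \<open>G\<close> from its least vertex, so that no sign appears.\<close>

lemma simplex_cone:
  fixes c :: "'g::linorder set \<Rightarrow> 'k::comm_ring_1"
  assumes G: "finite G" "G \<noteq> {}" and B: "B \<subseteq> G"
    and cyc: "\<And>B. B \<subseteq> G \<Longrightarrow> (\<Sum>a\<in>G - B. sg a B * c (insert a B)) = 0"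
  shows "(\<Sum>a\<in>G - B. sg a B * (if Min G \<in> insert a B then c (insert a B - {Min G}) else 0)) = c B"
proof (cases "Min G \<in> B")
  case False
  have "{b \<in> B. b < Min G} = {}"
    using G B by (auto simp: not_less)
  then have "sg (Min G) B = (1 :: 'k)"
    by (simp only: sg_def card.empty power_0)
  then have "(\<Sum>a\<in>G - B. sg a B * (if Min G \<in> insert a B then c (insert a B - {Min G}) else 0)) =
      (\<Sum>a\<in>G - B. if a = Min G then c B else 0)"
    using False by (intro sum.cong) auto
  also have "\<dots> = c B"
    using G False by (simp add: Min_in)
  finally show ?thesis .
next
  case True
  let ?i = "Min G" and ?B = "B - {Min G}"
  have fin: "finite B"
    using G(1) B finite_subset by blast
  have "{b \<in> ?B. b < ?i} = {}"
    using G B by (auto simp: not_less)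
  then have s: "sg ?i ?B = (1 :: 'k)"
    by (simp only: sg_def card.empty power_0)
  have lt: "?i < a" if "a \<in> G - B" for a
    using that True G(1) by (metis DiffD1 DiffD2 Min_le order_le_less)
  have sa: "sg a B = - (sg a ?B :: 'k)" if "a \<in> G - B" for a
    using sg_insert[of ?B ?i a] lt[OF that] fin True by (simp add: insert_absorb)
  \<comment> \<open>The cycle condition is used at the face without the apex: there the apex
    contributes \<open>c B\<close>, and the other terms are those of the claim up to the sign in
    \<open>sa\<close>.\<close>
  have "G - ?B = insert ?i (G - B)"
    using True B by auto
  then have "0 = sg ?i ?B * c (insert ?i ?B) + (\<Sum>a\<in>G - B. sg a ?B * c (insert a ?B))"
    using cyc[of ?B] B G(1) True by (simp add: subset_iff)
  then have "c B = - (\<Sum>a\<in>G - B. sg a ?B * c (insert a ?B))"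
    using s True by (simp add: insert_absorb eq_neg_iff_add_eq_0)
  also have "\<dots> = (\<Sum>a\<in>G - B. sg a B * c (insert a ?B))"
    by (simp add: sa sum_negf)
  also have "\<dots> = (\<Sum>a\<in>G - B. sg a B * (if Min G \<in> insert a B then c (insert a B - {Min G}) else 0))"
    using True by (intro sum.cong) (auto simp: insert_Diff_if)
  finally show ?thesis ..
qed

section \<open>Divisibility of monomials, on exponent vectors\<close>

definition pdvd :: "'n expvec \<Rightarrow> 'n expvec \<Rightarrow> bool" (infix \<open>pdvd\<close> 50) where
  "\<beta> pdvd \<gamma> \<longleftrightarrow> (\<forall>i. Poly_Mapping.lookup \<beta> i \<le> Poly_Mapping.lookup \<gamma> i)"

lemma pdvd_refl: "\<beta> pdvd \<beta>"
  by (simp add: pdvd_def)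

lemma pdvd_trans: "\<beta> pdvd \<gamma> \<Longrightarrow> \<gamma> pdvd \<delta> \<Longrightarrow> \<beta> pdvd \<delta>"
  unfolding pdvd_def using le_trans by blast

lemma pdvd_add: "\<beta> pdvd \<gamma> + \<beta>" "\<beta> pdvd \<beta> + \<gamma>"
  by (simp_all add: pdvd_def lookup_add)

lemma pdvd_diff_add: "\<beta> pdvd \<gamma> \<Longrightarrow> \<gamma> - \<beta> + \<beta> = \<gamma>"
  by (rule poly_mapping_eqI) (simp add: pdvd_def lookup_add lookup_minus)

lemma pdvd_antisym: "\<beta> pdvd \<gamma> \<Longrightarrow> \<gamma> pdvd \<beta> \<Longrightarrow> \<beta> = \<gamma>"
  by (rule poly_mapping_eqI) (simp add: pdvd_def le_antisym)

lemma zero_pdvd: "0 pdvd \<beta>"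
  by (simp add: pdvd_def)

lemma pdvd_zero_iff: "\<beta> pdvd 0 \<longleftrightarrow> \<beta> = 0"
  by (metis lookup_zero pdvd_antisym pdvd_def zero_pdvd)

lemma unit_vec_pdvd: "unit_vec a pdvd \<beta> \<longleftrightarrow> 0 < Poly_Mapping.lookup \<beta> a"
  by (auto simp: pdvd_def lookup_single when_def)

lemma mdeg_add: "mdeg (\<beta> + \<gamma>) = mdeg \<beta> + mdeg \<gamma>"
  by (simp add: mdeg_def lookup_add sum.distrib)

lemma mdeg_zero_iff: "mdeg \<beta> = 0 \<longleftrightarrow> \<beta> = 0"
  by (auto simp: mdeg_def intro: poly_mapping_eqI)

lemma mdeg_single: "mdeg (Poly_Mapping.single i e) = e"
  by (simp add: mdeg_def lookup_single when_def)

lemma mdeg_diff: "\<beta> pdvd \<gamma> \<Longrightarrow> mdeg (\<gamma> - \<beta>) + mdeg \<beta> = mdeg \<gamma>"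
  by (metis mdeg_add pdvd_diff_add)

lemma pdvd_mdeg_le: "\<beta> pdvd \<gamma> \<Longrightarrow> mdeg \<beta> \<le> mdeg \<gamma>"
  using mdeg_diff by (metis le_add2)

lemma pdvd_mdeg_eq: "\<beta> pdvd \<gamma> \<Longrightarrow> mdeg \<beta> = mdeg \<gamma> \<Longrightarrow> \<beta> = \<gamma>"
  by (metis add_0 add_diff_cancel_right' mdeg_diff mdeg_zero_iff pdvd_diff_add)

lemma lookup_single_mult:
  fixes f :: "('n, 'k::comm_ring_1) polyring"
  shows "Poly_Mapping.lookup (Poly_Mapping.single \<mu> c * f) \<gamma> =
    (if \<mu> pdvd \<gamma> then c * Poly_Mapping.lookup f (\<gamma> - \<mu>) else 0)"
proof -
  have "(\<Sum>q. (Poly_Mapping.lookup f q when \<gamma> = \<mu> + q)) =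
      (if \<mu> pdvd \<gamma> then Poly_Mapping.lookup f (\<gamma> - \<mu>) else 0)"
  proof (cases "\<mu> pdvd \<gamma>")
    case True
    then have "\<gamma> = \<mu> + q \<longleftrightarrow> q = \<gamma> - \<mu>" for q
      using pdvd_diff_add[OF True] by (metis add.commute add_diff_cancel_right')
    with True show ?thesis by simp
  next
    case False
    then have "\<gamma> \<noteq> \<mu> + q" for q
      using pdvd_add(2) by metis
    with False show ?thesis by simp
  qed
  moreover have "Poly_Mapping.lookup (Poly_Mapping.single \<mu> c * f) \<gamma> =
      (\<Sum>l. (c * (\<Sum>q. (Poly_Mapping.lookup f q when \<gamma> = l + q)) when l = \<mu>))"
    unfolding lookup_mult lookup_single by (intro Sum_any.cong) (auto simp: when_def)
  ultimately show ?thesis by simp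
qed

lemma lookup_const_mult:
  fixes f :: "('n, 'k::comm_ring_1) polyring"
  shows "Poly_Mapping.lookup (Poly_Mapping.single 0 c * f) \<gamma> = c * Poly_Mapping.lookup f \<gamma>"
  by (simp add: lookup_single_mult zero_pdvd)

text \<open>The inserted 0 is the exponent of the empty lcm, so that the empty face lies in
  multidegree 0.\<close>

definition lcm_vec :: "('g \<Rightarrow> 'n::finite expvec) \<Rightarrow> 'g set \<Rightarrow> 'n expvec" where
  "lcm_vec m B = Abs_poly_mapping (\<lambda>i. Max (insert 0 ((\<lambda>a. Poly_Mapping.lookup (m a) i) ` B)))"

lemma lookup_lcm_vec:
  "Poly_Mapping.lookup (lcm_vec m B) i = Max (insert 0 ((\<lambda>a. Poly_Mapping.lookup (m a) i) ` B))"
  by (simp add: lcm_vec_def)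

lemma lcm_vec_pdvd_iff: "finite B \<Longrightarrow> lcm_vec m B pdvd \<gamma> \<longleftrightarrow> (\<forall>a\<in>B. m a pdvd \<gamma>)"
  by (auto simp: pdvd_def lookup_lcm_vec)

lemma lcm_vec_empty: "lcm_vec m {} = 0"
  by (rule poly_mapping_eqI) (simp add: lookup_lcm_vec)

lemma lcm_vec_mono: "finite B \<Longrightarrow> A \<subseteq> B \<Longrightarrow> lcm_vec m A pdvd lcm_vec m B"
  by (meson finite_subset lcm_vec_pdvd_iff pdvd_refl subset_iff)

text \<open>
  The Taylor complex of the monomials \<open>m a\<close>, \<open>a \<in> G\<close>; for \<open>m = unit_vec\<close> it is the Koszul complex.
  In the fixed multidegree \<open>\<gamma>\<close> the coordinates \<open>tay_coord m u \<gamma>\<close> form a chain of the full simplex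
  on the vertices \<open>a\<close> with \<open>m a\<close> dividing \<open>\<gamma>\<close>.
\<close>

definition taylor ::
  "('g::linorder \<Rightarrow> 'n::finite expvec) \<Rightarrow> 'g set \<Rightarrow> ('g set \<Rightarrow> ('n, 'k::field) polyring) \<Rightarrow> 'g set \<Rightarrow> ('n, 'k) polyring"
  where
  "taylor m G u B =
    (\<Sum>a\<in>G - B. Poly_Mapping.single (lcm_vec m (insert a B) - lcm_vec m B) (sg a B) * u (insert a B))"

definition tay_coord ::
  "('g \<Rightarrow> 'n::finite expvec) \<Rightarrow> ('g set \<Rightarrow> ('n, 'k::field) polyring) \<Rightarrow> 'n expvec \<Rightarrow> 'g set \<Rightarrow> 'k" where
  "tay_coord m u \<gamma> B =
    (if lcm_vec m B pdvd \<gamma> then Poly_Mapping.lookup (u B) (\<gamma> - lcm_vec m B) else 0)"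

lemma lookup_eq_tay_coord: "Poly_Mapping.lookup (u B) \<delta> = tay_coord m u (\<delta> + lcm_vec m B) B"
  by (simp add: tay_coord_def pdvd_add)

lemma tay_coord_eqI:
  assumes "\<And>\<gamma>. tay_coord m u \<gamma> B = tay_coord m v \<gamma> B"
  shows "u B = v B"
  by (rule poly_mapping_eqI) (simp add: lookup_eq_tay_coord[of _ _ _ m] assms)

text \<open>The shift by \<open>lcm_vec m B\<close> absorbs the monomial entries of the differential
  and leaves only signs. If the lcm of \<open>B\<close> does not divide the multidegree, neither
  does that of a larger face, and both sides are 0.\<close>

lemma tay_coord_taylor:
  assumes "finite B"
  shows "tay_coord m (taylor m G u) \<gamma> B = (\<Sum>a\<in>G - B. sg a B * tay_coord m u \<gamma> (insert a B))"
proof (cases "lcm_vec m B pdvd \<gamma>")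
  case False
  have "\<not> lcm_vec m (insert a B) pdvd \<gamma>" for a
    using False lcm_vec_mono[of "insert a B" B m] assms pdvd_trans by blast
  with False show ?thesis
    by (simp add: tay_coord_def)
next
  case True
  have "Poly_Mapping.lookup (Poly_Mapping.single (lcm_vec m (insert a B) - lcm_vec m B) (sg a B) * u (insert a B))
     (\<gamma> - lcm_vec m B) = sg a B * tay_coord m u \<gamma> (insert a B)" for a
  proof -
    have le: "lcm_vec m B pdvd lcm_vec m (insert a B)"
      using assms by (intro lcm_vec_mono) auto
    have 1: "lcm_vec m (insert a B) - lcm_vec m B pdvd \<gamma> - lcm_vec m B \<longleftrightarrow> lcm_vec m (insert a B) pdvd \<gamma>"
      using True le unfolding pdvd_def lookup_minus
      by (meson diff_le_mono eq_diff_iff le_diff_iff)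
    have 2: "\<gamma> - lcm_vec m B - (lcm_vec m (insert a B) - lcm_vec m B) = \<gamma> - lcm_vec m (insert a B)"
      using le by (intro poly_mapping_eqI) (simp add: lookup_minus pdvd_def)
    show ?thesis
      by (simp add: lookup_single_mult 1 2 tay_coord_def)
  qed
  with True show ?thesis
    by (simp add: tay_coord_def taylor_def lookup_sum)
qed

lemma taylor_taylor:
  assumes "finite G" "finite B"
  shows "taylor m G (taylor m G u) B = 0"
proof -
  have "taylor m G (taylor m G u) B = (\<lambda>_. 0) B"
  proof (rule tay_coord_eqI[of m])
    fix \<gamma>
    have "tay_coord m (taylor m G (taylor m G u)) \<gamma> B = 0"
      using simplex_boundary_boundary[OF assms, of "tay_coord m u \<gamma>"] assms
      by (simp add: tay_coord_taylor)
    then show "tay_coord m (taylor m G (taylor m G u)) \<gamma> B = tay_coord m (\<lambda>_. 0) \<gamma> B"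
      by (simp add: tay_coord_def)
  qed
  then show ?thesis by simp
qed

text \<open>In each multidegree \<open>u\<close> is a cycle on a full simplex and is filled by the
  cone from the least vertex. A multidegree without vertices leaves only the empty face, which
  \<open>aug\<close> excludes. The last conclusion records that the cone copies coordinates of
  \<open>u\<close> without changing the multidegree; gradings of \<open>w\<close> are read off from
  it.\<close>

lemma taylor_exact:
  fixes u :: "'g::linorder set \<Rightarrow> ('n::finite, 'k::field) polyring"
  assumes G: "finite G" and u: "\<And>B. u B \<noteq> 0 \<Longrightarrow> B \<subseteq> G"
    and cyc: "\<And>B. B \<subseteq> G \<Longrightarrow> taylor m G u B = 0"
    and aug: "\<And>\<gamma>. Poly_Mapping.lookup (u {}) \<gamma> \<noteq> 0 \<Longrightarrow> \<exists>a\<in>G. m a pdvd \<gamma>"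
  obtains w where "\<And>B. B \<subseteq> G \<Longrightarrow> taylor m G w B = u B" "\<And>B. w B \<noteq> 0 \<Longrightarrow> B \<subseteq> G"
    "\<And>B \<gamma>. tay_coord m w \<gamma> B \<noteq> 0 \<Longrightarrow> \<exists>i\<in>B. tay_coord m u \<gamma> (B - {i}) \<noteq> 0"
proof -
  define V where "V \<gamma> = {a \<in> G. m a pdvd \<gamma>}" for \<gamma>
  \<comment> \<open>The cone over the coordinates of \<open>u\<close> in one multidegree, with apex
    the least index whose monomial divides it.\<close>
  define h where "h \<gamma> B = (if B \<subseteq> G \<and> V \<gamma> \<noteq> {} \<and> Min (V \<gamma>) \<in> B
      then tay_coord m u \<gamma> (B - {Min (V \<gamma>)}) else 0)" for \<gamma> B
  define w where "w B = Abs_poly_mapping (\<lambda>\<delta>. h (\<delta> + lcm_vec m B) B)" for B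
  have finV: "finite (V \<gamma>)" for \<gamma>
    using G by (simp add: V_def)
  \<comment> \<open>A polynomial needs finite support: every nonzero coordinate of the cone is a
    translate of a term of some \<open>u (B - {i})\<close>, and there are finitely many of
    these.\<close>
  have fin: "finite {\<delta>. h (\<delta> + lcm_vec m B) B \<noteq> 0}" for B
  proof (cases "B \<subseteq> G")
    case True
    then have finB: "finite B"
      using G finite_subset by blast
    have "{\<delta>. h (\<delta> + lcm_vec m B) B \<noteq> 0} \<subseteq>
        (\<Union>i\<in>B. (\<lambda>\<delta>. \<delta> + (lcm_vec m B - lcm_vec m (B - {i}))) -` Poly_Mapping.keys (u (B - {i})))"
    proof
      fix \<delta> assume "\<delta> \<in> {\<delta>. h (\<delta> + lcm_vec m B) B \<noteq> 0}"
      then obtain i where i: "i \<in> B" "tay_coord m u (\<delta> + lcm_vec m B) (B - {i}) \<noteq> 0"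
        unfolding h_def mem_Collect_eq by metis
      moreover have "\<delta> + lcm_vec m B - lcm_vec m (B - {i}) = \<delta> + (lcm_vec m B - lcm_vec m (B - {i}))"
        using lcm_vec_mono[OF finB, of "B - {i}" m]
        by (intro poly_mapping_eqI) (auto simp: lookup_minus lookup_add pdvd_def)
      ultimately have "\<delta> + (lcm_vec m B - lcm_vec m (B - {i})) \<in> Poly_Mapping.keys (u (B - {i}))"
        by (auto simp: tay_coord_def in_keys_iff split: if_splits)
      with i show "\<delta> \<in> (\<Union>i\<in>B. (\<lambda>\<delta>. \<delta> + (lcm_vec m B - lcm_vec m (B - {i}))) -` Poly_Mapping.keys (u (B - {i})))"
        by auto
    qed
    moreover have "finite \<dots>"
      using finB by (intro finite_UN_I finite_vimageI) (auto simp: inj_on_def)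
    ultimately show ?thesis
      by (rule finite_subset)
  qed (simp add: h_def)
  have w: "Poly_Mapping.lookup (w B) \<delta> = h (\<delta> + lcm_vec m B) B" for B \<delta>
    using fin by (simp add: w_def)
  have hV: "B \<subseteq> V \<gamma>" if "h \<gamma> B \<noteq> 0" for \<gamma> B
  proof -
    have B: "B \<subseteq> G" "lcm_vec m (B - {Min (V \<gamma>)}) pdvd \<gamma>" "V \<gamma> \<noteq> {}"
      using that unfolding h_def tay_coord_def by metis+
    have "Min (V \<gamma>) \<in> V \<gamma>"
      using finV B by (intro Min_in)
    moreover have "finite (B - {Min (V \<gamma>)})"
      using finite_subset[OF B(1) G] by simp
    then have "b \<in> V \<gamma>" if "b \<in> B - {Min (V \<gamma>)}" for b
      using that B(1,2) lcm_vec_pdvd_iff[of "B - {Min (V \<gamma>)}" m \<gamma>] unfolding V_def[of \<gamma>] by blast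
    ultimately show ?thesis
      by blast
  qed
  have tw: "tay_coord m w \<gamma> B = h \<gamma> B" if "finite B" for \<gamma> B
  proof (cases "lcm_vec m B pdvd \<gamma>")
    case True
    then show ?thesis
      by (simp add: tay_coord_def w pdvd_diff_add)
  next
    case False
    then have "h \<gamma> B = 0"
      using hV[of \<gamma> B] that by (auto simp: lcm_vec_pdvd_iff V_def)
    with False show ?thesis
      by (simp add: tay_coord_def)
  qed
  have V_out: "tay_coord m u \<gamma> B = 0" if "\<not> B \<subseteq> V \<gamma>" for \<gamma> B
  proof (cases "B \<subseteq> G")
    case True
    then have "finite B"
      using G finite_subset by blast
    with True that show ?thesis
      by (auto simp: tay_coord_def lcm_vec_pdvd_iff V_def)
  next
    case False
    then have "u B = 0"
      using u by blast
    then show ?thesis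
      by (simp add: tay_coord_def)
  qed
  \<comment> \<open>The differential sums over all of \<open>G\<close>, the cone lemma over the
    vertices present in the multidegree; the two agree on chains supported on those
    vertices.\<close>
  have restr: "(\<Sum>a\<in>V \<gamma> - B. sg a B * c (insert a B)) = (\<Sum>a\<in>G - B. sg a B * c (insert a B))"
    if "\<And>B. \<not> B \<subseteq> V \<gamma> \<Longrightarrow> c B = 0" for \<gamma> B and c :: "'g set \<Rightarrow> 'k"
  proof (rule sum.mono_neutral_left)
    show "\<forall>a\<in>(G - B) - (V \<gamma> - B). sg a B * c (insert a B) = 0"
    proof
      fix a assume "a \<in> (G - B) - (V \<gamma> - B)"
      then have "\<not> insert a B \<subseteq> V \<gamma>"
        by auto
      then show "sg a B * c (insert a B) = 0"
        using that by (metis mult_zero_right)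
    qed
  qed (use G in \<open>auto simp: V_def\<close>)
  have exact: "taylor m G w B = u B" if B: "B \<subseteq> G" for B
  proof (rule tay_coord_eqI[of m])
    fix \<gamma>
    have finB: "finite B"
      using B G finite_subset by blast
    have "tay_coord m (taylor m G w) \<gamma> B = (\<Sum>a\<in>G - B. sg a B * h \<gamma> (insert a B))"
      using finB by (simp add: tay_coord_taylor tw)
    also have "\<dots> = tay_coord m u \<gamma> B"
    proof (cases "V \<gamma> \<noteq> {} \<and> B \<subseteq> V \<gamma>")
      case True
      have cyc': "(\<Sum>a\<in>V \<gamma> - B. sg a B * tay_coord m u \<gamma> (insert a B)) = 0" if "B \<subseteq> V \<gamma>" for B
      proof -
        have "B \<subseteq> G"
          using that by (auto simp: V_def)
        then have "tay_coord m (taylor m G u) \<gamma> B = 0" and "finite B"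
          using cyc G finite_subset by (auto simp: tay_coord_def)
        then show ?thesis
          using restr[of \<gamma> "tay_coord m u \<gamma>" B] V_out by (simp add: tay_coord_taylor)
      qed
      have "(\<Sum>a\<in>G - B. sg a B * h \<gamma> (insert a B)) = (\<Sum>a\<in>V \<gamma> - B. sg a B * h \<gamma> (insert a B))"
        using hV by (intro restr[symmetric, where c="h \<gamma>"]) blast
      also have "\<dots> = (\<Sum>a\<in>V \<gamma> - B. sg a B *
          (if Min (V \<gamma>) \<in> insert a B then tay_coord m u \<gamma> (insert a B - {Min (V \<gamma>)}) else 0))"
        using True B by (intro sum.cong) (auto simp: h_def V_def)
      also have "\<dots> = tay_coord m u \<gamma> B"
        using True finV cyc' by (intro simplex_cone) auto
      finally show ?thesis .
    next
      case False
      have "h \<gamma> (insert a B) = 0" for a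
        using False hV[of \<gamma> "insert a B"] by auto
      moreover have "tay_coord m u \<gamma> B = 0"
      proof (cases "B \<subseteq> V \<gamma>")
        case True
        with False have "B = {}" "V \<gamma> = {}"
          by auto
        then show ?thesis
          using aug[of \<gamma>] by (auto simp: tay_coord_def lcm_vec_empty V_def)
      qed (rule V_out)
      ultimately show ?thesis
        by simp
    qed
    finally show "tay_coord m (taylor m G w) \<gamma> B = tay_coord m u \<gamma> B" .
  qed
  have supp: "B \<subseteq> G" if "w B \<noteq> 0" for B
  proof (rule ccontr)
    assume "\<not> B \<subseteq> G"
    then have "w B = 0"
      by (intro poly_mapping_eqI) (simp add: w h_def)
    with that show False by simp
  qed
  show thesis
  proof (rule that[OF exact supp])
    fix B \<gamma> assume *: "tay_coord m w \<gamma> B \<noteq> 0"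
    then have "w B \<noteq> 0"
      unfolding tay_coord_def by (metis lookup_zero)
    then have "finite B"
      using supp G finite_subset by blast
    with * show "\<exists>i\<in>B. tay_coord m u \<gamma> (B - {i}) \<noteq> 0"
      by (auto simp: tw h_def split: if_splits)
  qed
qed

section \<open>The Taylor resolution of a monomial ideal\<close>

lemma homogeneous_iff:
  "homogeneous e f \<longleftrightarrow> (\<forall>\<beta>. Poly_Mapping.lookup f \<beta> \<noteq> 0 \<longrightarrow> int (mdeg \<beta>) = e)"
  by (auto simp: homogeneous_def in_keys_iff)

lemma homogeneous_zero: "homogeneous e 0"
  by (simp add: homogeneous_iff)

lemma homogeneous_sum:
  assumes "\<And>a. a \<in> A \<Longrightarrow> homogeneous e (f a)"
  shows "homogeneous e (\<Sum>a\<in>A. f a)"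
  using assms keys_sum[of f A] unfolding homogeneous_def by blast

lemma homogeneous_add: "homogeneous e f \<Longrightarrow> homogeneous e g \<Longrightarrow> homogeneous e (f + g)"
  using keys_add[of f g] unfolding homogeneous_def by blast

lemma homogeneous_single: "homogeneous (int (mdeg \<mu>)) (Poly_Mapping.single \<mu> c)"
  by (simp add: homogeneous_iff lookup_single when_def)

lemma homogeneous_mult:
  assumes "homogeneous a f" "homogeneous b g"
  shows "homogeneous (a + b) (f * g)"
  unfolding homogeneous_def
proof
  fix \<gamma> assume "\<gamma> \<in> Poly_Mapping.keys (f * g)"
  then obtain \<beta> \<delta> where "\<beta> \<in> Poly_Mapping.keys f" "\<delta> \<in> Poly_Mapping.keys g" "\<gamma> = \<beta> + \<delta>"
    using keys_mult[of f g] by auto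
  then show "int (mdeg \<gamma>) = a + b"
    using assms by (auto simp: homogeneous_def mdeg_add)
qed

lemma poly_eq_sum_monomials:
  "f = (\<Sum>\<beta>\<in>Poly_Mapping.keys f. Poly_Mapping.single \<beta> (Poly_Mapping.lookup f \<beta>))"
  (is "_ = ?s")
proof (rule poly_mapping_eqI)
  fix \<gamma>
  have "Poly_Mapping.lookup ?s \<gamma> =
      (\<Sum>\<beta>\<in>Poly_Mapping.keys f. if \<beta> = \<gamma> then Poly_Mapping.lookup f \<beta> else 0)"
    unfolding lookup_sum lookup_single when_def ..
  then show "Poly_Mapping.lookup f \<gamma> = Poly_Mapping.lookup ?s \<gamma>"
    by (simp add: in_keys_iff)
qed

lemma mem_monomial_ideal_iff:
  fixes f :: "('n, 'k::field) polyring"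
  shows "f \<in> ideal_of {Poly_Mapping.single \<beta> 1 | \<beta>. P \<beta>} \<longleftrightarrow>
    (\<forall>\<gamma>\<in>Poly_Mapping.keys f. \<exists>\<beta>. P \<beta> \<and> \<beta> pdvd \<gamma>)"
proof
  interpret module "(*) :: ('n, 'k) polyring \<Rightarrow> _"
    by (rule module_polyring)
  let ?S = "{Poly_Mapping.single \<beta> (1 :: 'k) | \<beta>. P \<beta>}"
  show "\<forall>\<gamma>\<in>Poly_Mapping.keys f. \<exists>\<beta>. P \<beta> \<and> \<beta> pdvd \<gamma>" if "f \<in> ideal_of ?S"
    using that unfolding ideal_of_def
    proof (induction rule: span_induct_alt)
      case base
      then show ?case by simp
    next
      case (step c x y)
      then obtain \<beta> where "P \<beta>" "x = Poly_Mapping.single \<beta> 1"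
        by auto
      then have "\<exists>\<beta>. P \<beta> \<and> \<beta> pdvd \<gamma>" if "\<gamma> \<in> Poly_Mapping.keys (c * x)" for \<gamma>
        using that by (auto simp: in_keys_iff mult.commute[of c] lookup_single_mult split: if_splits)
      then show ?case
        using step keys_add[of "c * x" y] by blast
    qed
  assume *: "\<forall>\<gamma>\<in>Poly_Mapping.keys f. \<exists>\<beta>. P \<beta> \<and> \<beta> pdvd \<gamma>"
  have "Poly_Mapping.single \<gamma> (Poly_Mapping.lookup f \<gamma>) \<in> span ?S" if \<gamma>: "\<gamma> \<in> Poly_Mapping.keys f" for \<gamma>
  proof -
    obtain \<beta> where \<beta>: "P \<beta>" "\<beta> pdvd \<gamma>"
      using * \<gamma> by blast
    then have "Poly_Mapping.single \<gamma> (Poly_Mapping.lookup f \<gamma>) =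
        Poly_Mapping.single (\<gamma> - \<beta>) (Poly_Mapping.lookup f \<gamma>) * Poly_Mapping.single \<beta> 1"
      by (simp only: mult_single pdvd_diff_add mult_1_right)
    moreover have "Poly_Mapping.single \<beta> 1 \<in> span ?S"
      using \<beta> by (intro span_base) blast
    ultimately show ?thesis
      by (simp only: span_scale)
  qed
  then have "(\<Sum>\<gamma>\<in>Poly_Mapping.keys f. Poly_Mapping.single \<gamma> (Poly_Mapping.lookup f \<gamma>)) \<in> span ?S"
    by (rule span_sum)
  then show "f \<in> ideal_of ?S"
    unfolding ideal_of_def by (simp only: poly_eq_sum_monomials[symmetric])
qed

section \<open>The Taylor complex with numbered bases\<close>

definition faces :: "nat \<Rightarrow> nat \<Rightarrow> nat set set" where
  "faces N i = {B. B \<subseteq> {..<N} \<and> card B = i}"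

text \<open>A \<open>free_complex\<close> indexes its bases by natural numbers, so the faces of each
  size are numbered; any enumeration will do.\<close>

definition face_nth :: "nat \<Rightarrow> nat \<Rightarrow> nat \<Rightarrow> nat set" where
  "face_nth N i = (SOME e. bij_betw e {..<card (faces N i)} (faces N i))"

definition face_index :: "nat \<Rightarrow> nat \<Rightarrow> nat set \<Rightarrow> nat" where
  "face_index N i = the_inv_into {..<card (faces N i)} (face_nth N i)"

lemma finite_faces: "finite (faces N i)"
  by (rule finite_subset[of _ "Pow {..<N}"]) (auto simp: faces_def)

lemma face_nth_bij: "bij_betw (face_nth N i) {..<card (faces N i)} (faces N i)"
  unfolding face_nth_def
  using someI_ex[OF ex_bij_betw_nat_finite[OF finite_faces[of N i]]] by (simp add: atLeast0LessThan)

lemma face_nth_mem: "p < card (faces N i) \<Longrightarrow> face_nth N i p \<in> faces N i"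
  using face_nth_bij bij_betwE by blast

lemma face_index:
  assumes "B \<in> faces N i"
  shows "face_index N i B < card (faces N i)" "face_nth N i (face_index N i B) = B"
  using the_inv_into_into[of "face_nth N i" "{..<card (faces N i)}" B]
    f_the_inv_into_f_bij_betw[OF face_nth_bij[of N i], of B] assms face_nth_bij[of N i]
  unfolding face_index_def by (auto simp: bij_betw_def)

lemma face_index_nth: "p < card (faces N i) \<Longrightarrow> face_index N i (face_nth N i p) = p"
  using the_inv_into_f_f[of "face_nth N i" "{..<card (faces N i)}" p] face_nth_bij[of N i]
  unfolding face_index_def by (auto simp: bij_betw_def)

text \<open>The sum in \<open>dmat\<close> has at most one nonzero term, for the vertex by which
  \<open>A\<close> exceeds \<open>B\<close>, and is 0 if \<open>B\<close> is not a facet of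
  \<open>A\<close>.\<close>

definition taylor_resolution :: "(nat \<Rightarrow> 'n::finite expvec) \<Rightarrow> nat \<Rightarrow> ('n, 'k::field) free_complex" where
  "taylor_resolution m N = \<lparr>
     frank = \<lambda>i. card (faces N i),
     shift = \<lambda>i p. int (mdeg (lcm_vec m (face_nth N i p))),
     aug = \<lambda>_. 1,
     dmat = \<lambda>i q p. let B = face_nth N i q; A = face_nth N (Suc i) p in
       \<Sum>a\<in>{..<N} - B. if A = insert a B then Poly_Mapping.single (lcm_vec m A - lcm_vec m B) (sg a B) else 0\<rparr>"

definition face_chain :: "nat \<Rightarrow> nat \<Rightarrow> (nat \<Rightarrow> ('n, 'k::field) polyring) \<Rightarrow> nat set \<Rightarrow> ('n, 'k) polyring" where
  "face_chain N i v B = (if B \<in> faces N i then v (face_index N i B) else 0)"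

lemma insert_faces:
  assumes "B \<in> faces N i" "a \<in> {..<N} - B"
  shows "insert a B \<in> faces N (Suc i)"
proof -
  have "finite B"
    using assms(1) finite_subset by (auto simp: faces_def)
  with assms show ?thesis
    by (auto simp: faces_def)
qed

lemma insert_faces_iff:
  assumes "a \<in> {..<N} - B"
  shows "insert a B \<in> faces N (Suc i) \<longleftrightarrow> B \<in> faces N i"
proof
  assume "insert a B \<in> faces N (Suc i)"
  then have *: "insert a B \<subseteq> {..<N}" "card (insert a B) = Suc i"
    by (auto simp: faces_def)
  then have "finite B"
    using finite_subset[of "insert a B" "{..<N}"] by simp
  with * assms show "B \<in> faces N i"
    by (auto simp: faces_def)
qed (rule insert_faces[OF _ assms])

lemma face_chain_diff_map:
  "face_chain N i (diff_map (taylor_resolution m N) i v) = taylor m {..<N} (face_chain N (Suc i) v)"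
proof
  fix B
  let ?R = "taylor_resolution m N"
  show "face_chain N i (diff_map ?R i v) B = taylor m {..<N} (face_chain N (Suc i) v) B"
  proof (cases "B \<in> faces N i")
    case True
    let ?e = "\<lambda>a. Poly_Mapping.single (lcm_vec m (insert a B) - lcm_vec m B) (sg a B)"
    have "face_chain N i (diff_map ?R i v) B =
        (\<Sum>p<card (faces N (Suc i)). (\<Sum>a\<in>{..<N} - B.
          if face_nth N (Suc i) p = insert a B then ?e a else 0) * v p)"
      using True face_index[OF True]
      by (simp add: face_chain_def diff_map_def taylor_resolution_def Let_def cong: if_cong)
    also have "\<dots> = (\<Sum>a\<in>{..<N} - B. \<Sum>p<card (faces N (Suc i)).
        if p = face_index N (Suc i) (insert a B) then ?e a * v p else 0)"
      unfolding sum_distrib_right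
    proof (subst sum.swap, intro sum.cong refl)
      fix a p assume a: "a \<in> {..<N} - B" and p: "p \<in> {..<card (faces N (Suc i))}"
      have "face_nth N (Suc i) p = insert a B \<longleftrightarrow> p = face_index N (Suc i) (insert a B)"
        using face_index(2)[OF insert_faces[OF True a]] face_index_nth[of p N "Suc i"] p by auto
      then show "(if face_nth N (Suc i) p = insert a B then ?e a else 0) * v p =
          (if p = face_index N (Suc i) (insert a B) then ?e a * v p else 0)"
        by simp
    qed
    also have "\<dots> = taylor m {..<N} (face_chain N (Suc i) v) B"
      unfolding taylor_def using True face_index(1)
      by (intro sum.cong) (auto simp: face_chain_def insert_faces)
    finally show ?thesis .
  next
    case False
    then show ?thesis
      unfolding taylor_def by (auto simp: face_chain_def insert_faces_iff intro!: sum.neutral[symmetric])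
  qed
qed

lemma face_chain_inject:
  assumes "v \<in> free_mod (taylor_resolution m N) i" "w \<in> free_mod (taylor_resolution m N) i"
    "face_chain N i v = face_chain N i w"
  shows "v = w"
proof
  fix p
  show "v p = w p"
  proof (cases "p < card (faces N i)")
    case True
    then show ?thesis
      using fun_cong[OF assms(3), of "face_nth N i p"] by (simp add: face_chain_def face_nth_mem face_index_nth)
  next
    case False
    then show ?thesis
      using assms(1,2) by (simp add: free_mod_def taylor_resolution_def)
  qed
qed

lemma face_chain_surj:
  assumes "\<And>B. u B \<noteq> 0 \<Longrightarrow> B \<in> faces N i"
  obtains v where "v \<in> free_mod (taylor_resolution m N) i" "face_chain N i v = u"
proof
  show "(\<lambda>p. if p < card (faces N i) then u (face_nth N i p) else 0) \<in> free_mod (taylor_resolution m N) i"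
    by (simp add: free_mod_def taylor_resolution_def)
  show "face_chain N i (\<lambda>p. if p < card (faces N i) then u (face_nth N i p) else 0) = u"
    using assms by (auto simp: face_chain_def face_index fun_eq_iff)
qed

lemma diff_map_free_mod: "diff_map C i v \<in> free_mod C i"
  by (simp add: diff_map_def free_mod_def)

text \<open>The cone of \<open>taylor_exact\<close> lives on faces of all sizes. Cutting it down to
  size \<open>Suc i\<close> changes nothing in the differential on faces of size \<open>i\<close>,
  and on other faces both sides vanish.\<close>

lemma taylor_exact_faces:
  fixes u :: "nat set \<Rightarrow> ('n::finite, 'k::field) polyring"
  assumes u: "\<And>B. u B \<noteq> 0 \<Longrightarrow> B \<in> faces N i" and cyc: "taylor m {..<N} u = 0"
    and aug: "\<And>\<gamma>. i = 0 \<Longrightarrow> Poly_Mapping.lookup (u {}) \<gamma> \<noteq> 0 \<Longrightarrow> \<exists>a<N. m a pdvd \<gamma>"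
  shows "u \<in> (\<lambda>v. taylor m {..<N} (face_chain N (Suc i) v)) ` free_mod (taylor_resolution m N) (Suc i)"
proof -
  have aug': "\<exists>a\<in>{..<N}. m a pdvd \<gamma>" if "Poly_Mapping.lookup (u {}) \<gamma> \<noteq> 0" for \<gamma>
  proof -
    have "{} \<in> faces N i"
      using u[of "{}"] that by (metis lookup_zero)
    then show ?thesis
      using aug[of \<gamma>] that by (auto simp: faces_def)
  qed
  have u': "B \<subseteq> {..<N}" if "u B \<noteq> 0" for B
    using u[OF that] by (simp add: faces_def)
  obtain w where w: "\<And>B. B \<subseteq> {..<N} \<Longrightarrow> taylor m {..<N} w B = u B"
    using taylor_exact[of "{..<N}" u m, OF finite_lessThan u' _ aug'] cyc by (metis zero_fun_apply)
  define w' where "w' B = (if B \<in> faces N (Suc i) then w B else 0)" for B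
  obtain v where v: "v \<in> free_mod (taylor_resolution m N) (Suc i)" "face_chain N (Suc i) v = w'"
    using face_chain_surj[of w' N "Suc i" m] unfolding w'_def by (metis (no_types, lifting))
  have "taylor m {..<N} w' B = u B" for B
  proof (cases "B \<in> faces N i")
    case True
    then have "taylor m {..<N} w' B = taylor m {..<N} w B"
      unfolding taylor_def by (intro sum.cong) (auto simp: w'_def insert_faces)
    then show ?thesis
      using w[of B] True by (simp add: faces_def)
  next
    case False
    then have "taylor m {..<N} w' B = 0"
      unfolding taylor_def by (intro sum.neutral) (auto simp: w'_def insert_faces_iff)
    with False u[of B] show ?thesis by auto
  qed
  then show ?thesis
    using v by (auto intro!: image_eqI[of _ _ v])
qed

lemma face_chain_zero_iff:
  assumes "v \<in> free_mod (taylor_resolution m N) i"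
  shows "face_chain N i v = 0 \<longleftrightarrow> v = 0"
proof -
  have "0 \<in> free_mod (taylor_resolution m N) i" "face_chain N i 0 = 0"
    by (auto simp: free_mod_def face_chain_def)
  then show ?thesis
    using face_chain_inject[OF assms] by metis
qed

lemma taylor_graded_free_resolution:
  fixes m :: "nat \<Rightarrow> 'n::finite expvec"
  shows "graded_free_resolution (taylor_resolution m N :: ('n, 'k::field) free_complex)
    (ideal_of {Poly_Mapping.single \<beta> 1 | \<beta>. \<beta> \<in> m ` {..<N}})"
proof -
  let ?R = "taylor_resolution m N :: ('n, 'k) free_complex"
  let ?I = "ideal_of {Poly_Mapping.single \<beta> (1 :: 'k) | \<beta>. \<beta> \<in> m ` {..<N}}"
  have f0: "faces N 0 = {{}}"
    by (auto simp: faces_def card_eq_0_iff dest: finite_subset)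
  have e0: "face_nth N 0 0 = {}"
    using face_nth_mem[of 0 N 0] by (simp add: f0)
  have i0: "face_index N 0 {} = 0"
    using face_index_nth[of 0 N 0] by (simp add: f0 e0)
  have aug: "aug_map ?R v = face_chain N 0 v {}" for v
    by (simp add: aug_map_def taylor_resolution_def face_chain_def f0 i0)
  have mem: "f \<in> ?I \<longleftrightarrow> (\<forall>\<gamma>. Poly_Mapping.lookup f \<gamma> \<noteq> 0 \<longrightarrow> (\<exists>a<N. m a pdvd \<gamma>))" for f
    by (subst mem_monomial_ideal_iff) (auto simp: in_keys_iff)
  have supp: "B \<in> faces N i" if "face_chain N i v B \<noteq> 0" for i v B
    using that by (auto simp: face_chain_def split: if_splits)
  have exact: "v \<in> diff_map ?R i ` free_mod ?R (Suc i)"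
    if v: "v \<in> free_mod ?R i" and cyc: "taylor m {..<N} (face_chain N i v) = 0"
      and bnd: "\<And>\<gamma>. i = 0 \<Longrightarrow> Poly_Mapping.lookup (face_chain N i v {}) \<gamma> \<noteq> 0 \<Longrightarrow> \<exists>a<N. m a pdvd \<gamma>" for i v
  proof -
    obtain w where w: "w \<in> free_mod ?R (Suc i)" "face_chain N i v = taylor m {..<N} (face_chain N (Suc i) w)"
      using taylor_exact_faces[of "face_chain N i v" N i m] supp cyc bnd by blast
    then have "v = diff_map ?R i w"
      by (intro face_chain_inject[OF v diff_map_free_mod]) (simp add: face_chain_diff_map)
    with w show ?thesis by blast
  qed
  show ?thesis
    unfolding graded_free_resolution_def
  proof (intro conjI allI impI)
    fix p assume "p < frank ?R 0"
    then show "homogeneous (shift ?R 0 p) (aug ?R p)"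
      using homogeneous_single[of 0 "1 :: 'k"] by (simp add: taylor_resolution_def f0 e0 lcm_vec_empty)
  next
    fix i q p assume q: "q < frank ?R i" and p: "p < frank ?R (Suc i)"
    let ?A = "face_nth N (Suc i) p" and ?B = "face_nth N i q"
    have "homogeneous (int (mdeg (lcm_vec m ?A)) - int (mdeg (lcm_vec m ?B)))
        (Poly_Mapping.single (lcm_vec m ?A - lcm_vec m ?B) (sg a ?B :: 'k))" if "?A = insert a ?B" for a
    proof -
      have "?A \<in> faces N (Suc i)"
        using face_nth_mem p by (simp add: taylor_resolution_def)
      then have "finite ?A"
        by (auto simp: faces_def finite_subset)
      then have "mdeg (lcm_vec m ?A - lcm_vec m ?B) + mdeg (lcm_vec m ?B) = mdeg (lcm_vec m ?A)"
        using that by (intro mdeg_diff lcm_vec_mono) auto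
      then have "int (mdeg (lcm_vec m ?A)) - int (mdeg (lcm_vec m ?B)) = int (mdeg (lcm_vec m ?A - lcm_vec m ?B))"
        by simp
      then show ?thesis
        using homogeneous_single by metis
    qed
    then show "homogeneous (shift ?R (Suc i) p - shift ?R i q) (dmat ?R i q p)"
      by (auto simp: taylor_resolution_def Let_def homogeneous_zero intro!: homogeneous_sum)
  next
    fix f :: "('n, 'k) polyring"
    obtain v where "v \<in> free_mod ?R 0" "face_chain N 0 v = (\<lambda>B. if B = {} then f else 0)"
      using face_chain_surj[of "\<lambda>B. if B = {} then f else 0" N 0 m] f0 by (metis (no_types, lifting) insertI1)
    then show "\<exists>v\<in>free_mod ?R 0. f - aug_map ?R v \<in> ?I"
      by (intro bexI[of _ v]) (auto simp: aug mem)
  next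
    show "{v \<in> free_mod ?R 0. aug_map ?R v \<in> ?I} = diff_map ?R 0 ` free_mod ?R 1"
    proof (intro equalityI subsetI)
      fix v assume v: "v \<in> {v \<in> free_mod ?R 0. aug_map ?R v \<in> ?I}"
      \<comment> \<open>In homological degree 0 the cycle condition is vacuous; membership in the
        ideal supplies instead the divisibility that \<open>exact\<close> asks for.\<close>
      have "insert a B \<notin> faces N 0" for a B
        by (simp add: f0)
      then have "taylor m {..<N} (face_chain N 0 v) = 0"
        by (simp add: fun_eq_iff taylor_def face_chain_def)
      then show "v \<in> diff_map ?R 0 ` free_mod ?R 1"
        using v exact[of v 0] by (auto simp: aug mem)
    next
      fix v assume "v \<in> diff_map ?R 0 ` free_mod ?R 1"
      then obtain w where w: "v = diff_map ?R 0 w"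
        by auto
      have "aug_map ?R v = taylor m {..<N} (face_chain N (Suc 0) w) {}"
        by (simp add: aug w face_chain_diff_map)
      moreover have "\<exists>a<N. m a pdvd \<gamma>" if nz: "Poly_Mapping.lookup (taylor m {..<N} u {}) \<gamma> \<noteq> 0" for \<gamma> and u :: "_ \<Rightarrow> ('n, 'k) polyring"
      proof -
        obtain a where "a < N" "Poly_Mapping.lookup (Poly_Mapping.single (lcm_vec m {a} - lcm_vec m {}) (sg a {}) * u {a}) \<gamma> \<noteq> 0"
          using nz unfolding taylor_def lookup_sum by (auto elim!: sum.not_neutral_contains_not_neutral)
        then show ?thesis
          using lcm_vec_pdvd_iff[of "{a}" m \<gamma>] by (auto simp: lookup_single_mult lcm_vec_empty split: if_splits)
      qed
      ultimately show "v \<in> {v \<in> free_mod ?R 0. aug_map ?R v \<in> ?I}"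
        using w diff_map_free_mod by (auto simp: mem)
    qed
  next
    fix i
    show "{v \<in> free_mod ?R (Suc i). diff_map ?R i v = (\<lambda>_. 0)} = diff_map ?R (Suc i) ` free_mod ?R (Suc (Suc i))"
    proof (intro equalityI subsetI)
      fix v assume v: "v \<in> {v \<in> free_mod ?R (Suc i). diff_map ?R i v = (\<lambda>_. 0)}"
      then have "face_chain N i (diff_map ?R i v) = 0"
        by (simp add: fun_eq_iff face_chain_def)
      then show "v \<in> diff_map ?R (Suc i) ` free_mod ?R (Suc (Suc i))"
        using v by (intro exact) (auto simp: face_chain_diff_map)
    next
      fix v assume "v \<in> diff_map ?R (Suc i) ` free_mod ?R (Suc (Suc i))"
      then obtain w where w: "v = diff_map ?R (Suc i) w"
        by auto
      have "face_chain N i (diff_map ?R i v) B = 0" for B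
      proof (cases "B \<in> faces N i")
        case True
        then have "finite B"
          by (auto simp: faces_def finite_subset)
        then show ?thesis
          by (simp add: w face_chain_diff_map taylor_taylor)
      qed (simp add: face_chain_def)
      then have "diff_map ?R i v = 0"
        using face_chain_zero_iff[OF diff_map_free_mod] by (metis ext zero_fun_apply)
      then show "v \<in> {v \<in> free_mod ?R (Suc i). diff_map ?R i v = (\<lambda>_. 0)}"
        by (simp add: w diff_map_free_mod zero_fun_def)
    qed
  qed
qed

lemma ex_graded_free_resolution:
  fixes P :: "'n::finite expvec \<Rightarrow> bool"
  assumes "finite {\<beta>. P \<beta>}"
  shows "\<exists>C. graded_free_resolution (C :: ('n, 'k::field) free_complex) (ideal_of {Poly_Mapping.single \<beta> 1 | \<beta>. P \<beta>})"
proof -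
  obtain m where "bij_betw m {..<card {\<beta>. P \<beta>}} {\<beta>. P \<beta>}"
    using ex_bij_betw_nat_finite[OF assms] by (auto simp: atLeast0LessThan)
  then have "{\<beta>. P \<beta>} = m ` {..<card {\<beta>. P \<beta>}}"
    by (simp add: bij_betw_def)
  then have "\<And>\<beta>. P \<beta> \<longleftrightarrow> \<beta> \<in> m ` {..<card {\<beta>. P \<beta>}}"
    by blast
  then have eq: "{Poly_Mapping.single \<beta> (1 :: 'k) | \<beta>. P \<beta>} =
      {Poly_Mapping.single \<beta> 1 | \<beta>. \<beta> \<in> m ` {..<card {\<beta>. P \<beta>}}}"
    by metis
  show ?thesis
    unfolding eq by (rule exI, rule taylor_graded_free_resolution)
qed

text \<open>The square is applied to the part of \<open>X\<close> cut out by \<open>P\<close> on one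
  side and by \<open>Q\<close> on the other. In the double complex they mostly say that the next
  differential vanishes, which turns the images into intersections of kernels and images. The
  kernels of \<open>f\<close> and \<open>g\<close> are unaffected because \<open>P\<close> and
  \<open>Q\<close> hold at 0.\<close>

lemma kernel_image_square_on:
  fixes f :: "'a::ab_group_add \<Rightarrow> 'b::ab_group_add" and g :: "'a \<Rightarrow> 'c::ab_group_add"
  assumes f: "Vector_Spaces.linear s s1 f" and g: "Vector_Spaces.linear s s2 g"
    and X: "module.subspace s X" "finite S" "X \<subseteq> module.span s S"
    and P: "module.subspace s1 {y. P y}" and PQ: "\<And>x. x \<in> X \<Longrightarrow> P (f x) \<longleftrightarrow> Q (g x)" and Q0: "Q 0"
  shows "vector_space.dim s1 {y \<in> f ` X. P y} + vector_space.dim s2 (g ` {x \<in> X. f x = 0}) =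
    vector_space.dim s2 {z \<in> g ` X. Q z} + vector_space.dim s1 (f ` {x \<in> X. g x = 0})"
proof -
  interpret F: Vector_Spaces.linear s s1 f by (fact f)
  let ?X = "{x \<in> X. P (f x)}"
  have P0: "P 0"
    using F.vs2.subspace_0[OF P] by simp
  have sub: "module.subspace s ?X"
    using X(1) P by (simp add: F.vs1.subspace_def F.vs2.subspace_def F.add F.scale P0)
  have "f ` ?X = {y \<in> f ` X. P y}" "g ` ?X = {z \<in> g ` X. Q z}"
    using PQ by auto
  moreover have "{x \<in> ?X. f x = 0} = {x \<in> X. f x = 0}" "{x \<in> ?X. g x = 0} = {x \<in> X. g x = 0}"
    using P0 Q0 PQ by (auto; metis)+
  moreover have "?X \<subseteq> module.span s S"
    using X(3) by blast
  ultimately show ?thesis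
    using kernel_image_square[OF f g sub X(2)] by simp
qed

section \<open>Graded pieces and constant terms of polynomials\<close>

abbreviation (input) pscale :: "'k::field \<Rightarrow> ('a \<Rightarrow> 'b \<Rightarrow> ('n, 'k) polyring) \<Rightarrow> 'a \<Rightarrow> 'b \<Rightarrow> ('n, 'k) polyring" where
  "pscale \<equiv> \<lambda>c u A i. Poly_Mapping.single 0 c * u A i"

interpretation poly_space: vector_space
  "pscale :: 'k::field \<Rightarrow> ('a \<Rightarrow> 'b \<Rightarrow> ('n, 'k) polyring) \<Rightarrow> 'a \<Rightarrow> 'b \<Rightarrow> ('n, 'k) polyring"
  by unfold_locales (auto simp: fun_eq_iff algebra_simps single_add mult_single simp flip: mult.assoc)

definition hcomp :: "int \<Rightarrow> ('n::finite, 'k::field) polyring \<Rightarrow> ('n, 'k) polyring" where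
  "hcomp e f = Abs_poly_mapping (\<lambda>\<beta>. if int (mdeg \<beta>) = e then Poly_Mapping.lookup f \<beta> else 0)"

lemma lookup_hcomp:
  "Poly_Mapping.lookup (hcomp e f) \<beta> = (if int (mdeg \<beta>) = e then Poly_Mapping.lookup f \<beta> else 0)"
proof -
  have "finite {\<beta>. (if int (mdeg \<beta>) = e then Poly_Mapping.lookup f \<beta> else 0) \<noteq> 0}"
    by (rule finite_subset[OF _ finite_keys[of f]]) (auto simp: in_keys_iff)
  then show ?thesis
    by (simp add: hcomp_def)
qed

lemma homogeneous_hcomp: "homogeneous e (hcomp e f)"
  by (simp add: homogeneous_iff lookup_hcomp)

lemma hcomp_homogeneous: "homogeneous e f \<Longrightarrow> hcomp e f = f"
  by (rule poly_mapping_eqI) (auto simp: homogeneous_iff lookup_hcomp)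

lemma hcomp_add: "hcomp e (f + g) = hcomp e f + hcomp e g"
  by (rule poly_mapping_eqI) (simp add: lookup_hcomp lookup_add)

lemma hcomp_sum: "hcomp e (\<Sum>a\<in>A. f a) = (\<Sum>a\<in>A. hcomp e (f a))"
  by (rule poly_mapping_eqI) (simp add: lookup_hcomp lookup_sum)

text \<open>Multiplication by \<open>h\<close> raises every degree by exactly \<open>a\<close>, so
  only the component of \<open>f\<close> in degree \<open>e - a\<close> contributes. Integer degrees
  allow \<open>e - a\<close> to be negative.\<close>

lemma hcomp_mult:
  assumes h: "homogeneous a h"
  shows "hcomp e (h * f) = h * hcomp (e - a) f"
proof -
  let ?r = "f - hcomp (e - a) f"
  have "hcomp e (h * ?r) = 0"
  proof (rule poly_mapping_eqI)
    fix \<gamma>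
    have "int (mdeg \<gamma>) \<noteq> e" if "\<gamma> \<in> Poly_Mapping.keys (h * ?r)"
    proof -
      obtain \<beta> \<delta> where *: "\<beta> \<in> Poly_Mapping.keys h" "\<delta> \<in> Poly_Mapping.keys ?r" "\<gamma> = \<beta> + \<delta>"
        using keys_mult[of h ?r] \<open>\<gamma> \<in> Poly_Mapping.keys (h * ?r)\<close> by auto
      then have "int (mdeg \<delta>) \<noteq> e - a"
        by (auto simp: in_keys_iff lookup_minus lookup_hcomp)
      with * h show ?thesis
        by (auto simp: homogeneous_def mdeg_add)
    qed
    then show "Poly_Mapping.lookup (hcomp e (h * ?r)) \<gamma> = Poly_Mapping.lookup 0 \<gamma>"
      by (auto simp: lookup_hcomp in_keys_iff)
  qed
  moreover have "hcomp e (h * hcomp (e - a) f) = h * hcomp (e - a) f"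
    using homogeneous_mult[OF h homogeneous_hcomp[of "e - a" f]] by (intro hcomp_homogeneous) simp
  moreover have "h * f = h * ?r + h * hcomp (e - a) f"
    by (simp add: algebra_simps)
  ultimately show ?thesis
    by (simp only: hcomp_add) simp
qed

lemma const_coeff_add: "const_coeff (f + g) = const_coeff f + const_coeff g"
  by (simp add: const_coeff_def lookup_add)

lemma const_coeff_sum: "const_coeff (\<Sum>a\<in>A. f a) = (\<Sum>a\<in>A. const_coeff (f a))"
  by (simp add: const_coeff_def lookup_sum)

lemma const_coeff_mult:
  fixes f g :: "('n, 'k::field) polyring"
  shows "const_coeff (f * g) = const_coeff f * const_coeff g"
proof -
  have *: "const_coeff (Poly_Mapping.single \<beta> c * g) = const_coeff (Poly_Mapping.single \<beta> c) * const_coeff g" for \<beta> c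
    by (auto simp: const_coeff_def lookup_single_mult pdvd_zero_iff lookup_single)
  have "const_coeff (f * g) =
      (\<Sum>\<beta>\<in>Poly_Mapping.keys f. const_coeff (Poly_Mapping.single \<beta> (Poly_Mapping.lookup f \<beta>) * g))"
    by (subst poly_eq_sum_monomials[of f]) (simp only: sum_distrib_right const_coeff_sum)
  also have "\<dots> = const_coeff f * const_coeff g"
    by (simp only: * poly_eq_sum_monomials[of f, symmetric] flip: sum_distrib_right const_coeff_sum)
  finally show ?thesis .
qed

text \<open>Otherwise the simplifier destroys the form \<open>single i 1\<close> of \<open>unit_vec i\<close>.\<close>

declare One_nat_def [simp del]

section \<open>The Koszul complex as the Taylor complex of the variables\<close>

lemma lcm_vec_unit_vec:
  fixes B :: "'n::finite set"
  shows "Poly_Mapping.lookup (lcm_vec unit_vec B) i = (if i \<in> B then 1 else 0)"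
proof -
  have "insert 0 ((\<lambda>a. Poly_Mapping.lookup (unit_vec a) i) ` B) = (if i \<in> B then {0, 1} \<union> {0} else {0::nat})"
    by (auto simp: lookup_single when_def)
  then show ?thesis
    by (simp only: lookup_lcm_vec) simp
qed

lemma mdeg_lcm_unit_vec: "mdeg (lcm_vec unit_vec B) = card B"
  unfolding mdeg_def lcm_vec_unit_vec by (simp add: sum.If_cases)

lemma lcm_vec_unit_vec_insert: "a \<notin> B \<Longrightarrow> lcm_vec unit_vec (insert a B) - lcm_vec unit_vec B = unit_vec a"
  by (rule poly_mapping_eqI) (auto simp: lookup_minus lcm_vec_unit_vec lookup_single when_def)

type_synonym ('n, 'k) bichain = "'n set \<Rightarrow> nat \<Rightarrow> ('n, 'k) polyring"
type_synonym ('n, 'k) kchain = "'n set \<times> 'n expvec \<Rightarrow> 'k"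

definition koszul_poly ::
  "('n::{finite,linorder} set \<Rightarrow> ('n, 'k::field) polyring) \<Rightarrow> 'n set \<Rightarrow> ('n, 'k) polyring" where
  "koszul_poly u B = (\<Sum>a\<in>UNIV - B. Poly_Mapping.single (unit_vec a) (sg a B) * u (insert a B))"

lemma koszul_poly_eq_taylor: "koszul_poly u = taylor unit_vec UNIV u"
  by (auto simp: fun_eq_iff koszul_poly_def taylor_def lcm_vec_unit_vec_insert intro!: sum.cong)

text \<open>The Koszul differential in the k-basis e_A \<otimes> x^\<beta>; the divisibility test
  stands for multiplication by a variable.\<close>

definition koszul ::
  "('n::{finite,linorder} set \<times> 'n expvec \<Rightarrow> 'k::field) \<Rightarrow> ('n, 'k) kchain" where
  "koszul u = (\<lambda>(B, \<gamma>). \<Sum>a\<in>UNIV - B.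
     if unit_vec a pdvd \<gamma> then sg a B * u (insert a B, \<gamma> - unit_vec a) else 0)"

lemma lookup_koszul_poly:
  "Poly_Mapping.lookup (koszul_poly u B) \<gamma> = koszul (\<lambda>(A, \<beta>). Poly_Mapping.lookup (u A) \<beta>) (B, \<gamma>)"
  by (simp add: koszul_poly_def koszul_def lookup_sum lookup_single_mult cong: if_cong)

lemma koszul_poly_koszul_poly: "koszul_poly (koszul_poly u) = 0"
  by (rule ext) (simp add: koszul_poly_eq_taylor taylor_taylor)

text \<open>The grading is by \<open>t = mdeg \<beta> + card A\<close>.\<close>

lemma koszul_poly_exact:
  fixes u :: "'n::{finite,linorder} set \<Rightarrow> ('n, 'k::field) polyring"
  assumes u: "\<And>A. u A \<noteq> 0 \<Longrightarrow> card A = q" "\<And>A. homogeneous (t - int q) (u A)"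
    and cyc: "koszul_poly u = 0" and aug: "q = 0 \<Longrightarrow> const_coeff (u {}) = 0"
  obtains w where "koszul_poly w = u" "\<And>A. w A \<noteq> 0 \<Longrightarrow> card A = Suc q"
    "\<And>A. homogeneous (t - int (Suc q)) (w A)"
proof -
  \<comment> \<open>A nonconstant monomial is divisible by a variable, so the condition on the empty
    face concerns only the constant term, which \<open>aug\<close> kills.\<close>
  have a: "\<exists>a\<in>UNIV. unit_vec a pdvd \<gamma>" if "Poly_Mapping.lookup (u {}) \<gamma> \<noteq> 0" for \<gamma>
  proof -
    have "q = 0"
      using u(1)[of "{}"] that by (metis card.empty lookup_zero)
    then have "\<gamma> \<noteq> 0"
      using aug that by (auto simp: const_coeff_def)
    then show ?thesis
      unfolding unit_vec_pdvd by (metis UNIV_I gr0I lookup_zero poly_mapping_eqI)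
  qed
  obtain w where w: "\<And>B. taylor unit_vec UNIV w B = u B"
    "\<And>B \<gamma>. tay_coord unit_vec w \<gamma> B \<noteq> 0 \<Longrightarrow> \<exists>i\<in>B. tay_coord unit_vec u \<gamma> (B - {i}) \<noteq> 0"
    using taylor_exact[of UNIV u unit_vec, OF finite _ _ a] cyc
    unfolding koszul_poly_eq_taylor by (metis subset_UNIV zero_fun_apply)
  \<comment> \<open>Coning keeps the multidegree and adds one vertex, so the exterior degree rises
    by one and the polynomial degree drops by one.\<close>
  have deg: "card B = Suc q \<and> int (mdeg \<delta>) = t - int (Suc q)" if nz: "Poly_Mapping.lookup (w B) \<delta> \<noteq> 0" for B \<delta>
  proof -
    let ?\<gamma> = "\<delta> + lcm_vec unit_vec B"
    obtain i where i: "i \<in> B" "tay_coord unit_vec u ?\<gamma> (B - {i}) \<noteq> 0"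
      using w(2)[of ?\<gamma> B] nz by (auto simp: lookup_eq_tay_coord[of w B \<delta> unit_vec])
    let ?A = "B - {i}"
    have A: "lcm_vec unit_vec ?A pdvd ?\<gamma>" "Poly_Mapping.lookup (u ?A) (?\<gamma> - lcm_vec unit_vec ?A) \<noteq> 0"
      using i(2) unfolding tay_coord_def by presburger+
    then have q: "card ?A = q"
      using u(1)[of ?A] by (metis lookup_zero)
    then have cB: "card B = Suc q"
      using i(1) by (metis card_Suc_Diff1 finite)
    have "int (mdeg (?\<gamma> - lcm_vec unit_vec ?A)) = t - int q"
      using u(2) A(2) by (auto simp: homogeneous_iff)
    moreover have "mdeg (?\<gamma> - lcm_vec unit_vec ?A) + q = mdeg ?\<gamma>"
      using mdeg_diff[OF A(1)] q by (simp add: mdeg_lcm_unit_vec)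
    moreover have "mdeg ?\<gamma> = mdeg \<delta> + Suc q"
      by (simp add: mdeg_add mdeg_lcm_unit_vec cB)
    ultimately show ?thesis
      using cB by simp
  qed
  show thesis
  proof (rule that[of w])
    show "koszul_poly w = u"
      using w(1) by (simp add: koszul_poly_eq_taylor fun_eq_iff)
    show "card A = Suc q" if nz: "w A \<noteq> 0" for A
    proof -
      obtain \<delta> where "Poly_Mapping.lookup (w A) \<delta> \<noteq> 0"
        using nz by (metis lookup_zero poly_mapping_eqI)
      then show ?thesis using deg by blast
    qed
    show "homogeneous (t - int (Suc q)) (w A)" for A
      using deg by (simp add: homogeneous_iff)
  qed
qed

section \<open>Betti numbers from the Koszul homology of the quotient\<close>

lemma koszul_poly_add: "koszul_poly (\<lambda>B. u B + v B) = (\<lambda>B. koszul_poly u B + koszul_poly v B)"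
  by (simp add: fun_eq_iff koszul_poly_def algebra_simps sum.distrib)

lemma koszul_poly_mult: "koszul_poly (\<lambda>B. f * u B) = (\<lambda>B. f * koszul_poly u B)"
  by (simp add: fun_eq_iff koszul_poly_def algebra_simps sum_distrib_left)

lemma koszul_poly_sum: "koszul_poly (\<lambda>B. \<Sum>p\<in>S. u p B) B = (\<Sum>p\<in>S. koszul_poly (u p) B)"
  unfolding koszul_poly_def sum_distrib_left by (rule sum.swap)

lemma koszul_add: "koszul (u + v) = koszul u + koszul v"
proof
  fix x
  show "koszul (u + v) x = (koszul u + koszul v) x"
    by (cases x) (auto simp: koszul_def algebra_simps simp flip: sum.distrib intro!: sum.cong)
qed

lemma koszul_scale: "koszul (\<lambda>x. c * u x) = (\<lambda>x. c * koszul u x)"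
proof
  fix x
  show "koszul (\<lambda>x. c * u x) x = c * koszul u x"
    by (cases x) (auto simp: koszul_def sum_distrib_left intro!: sum.cong)
qed

text \<open>The Koszul differential of \<open>R/I\<close> in the basis of the monomials outside \<open>I\<close>, described by \<open>std\<close>.\<close>

definition koszul_mod ::
  "('n expvec \<Rightarrow> bool) \<Rightarrow> ('n::{finite,linorder} set \<times> 'n expvec \<Rightarrow> 'k::field) \<Rightarrow> ('n, 'k) kchain" where
  "koszul_mod std u = (\<lambda>(B, \<gamma>). if std \<gamma> then koszul u (B, \<gamma>) else 0)"

definition koszul_basis :: "('n::finite expvec \<Rightarrow> bool) \<Rightarrow> nat \<Rightarrow> int \<Rightarrow> ('n set \<times> 'n expvec) set" where
  "koszul_basis std q e = {(A, \<beta>). card A = q \<and> int (mdeg \<beta>) = e \<and> std \<beta>}"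

lemma linear_koszul_mod: "Vector_Spaces.linear fscale fscale (koszul_mod std)"
  by (rule linear_funI) (auto simp: koszul_mod_def fun_eq_iff koszul_add koszul_scale)

lemma finite_int_mdeg: "finite {\<beta> :: 'n::finite expvec. int (mdeg \<beta>) = e}"
  by (rule finite_subset[OF _ finite_mdeg[of "nat e"]]) auto

lemma finite_koszul_basis: "finite (koszul_basis std q e)"
  by (rule finite_subset[of _ "UNIV \<times> {\<beta>. int (mdeg \<beta>) = e}"])
    (auto simp: koszul_basis_def finite_int_mdeg)

text \<open>By \<open>mem_I\<close> the monomials satisfying \<open>std\<close> form a k-basis of
  R/I; \<open>std_pdvd\<close> reflects that I is an ideal.\<close>

locale resolved_monomial_quotient =
  fixes C :: "('n::{finite,linorder}, 'k::field) free_complex" and I :: "('n, 'k) polyring set"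
    and std :: "'n expvec \<Rightarrow> bool"
  assumes res: "graded_free_resolution C I"
    and mem_I: "f \<in> I \<longleftrightarrow> (\<forall>\<gamma>. Poly_Mapping.lookup f \<gamma> \<noteq> 0 \<longrightarrow> \<not> std \<gamma>)"
    and std_pdvd: "std \<gamma> \<Longrightarrow> \<beta> pdvd \<gamma> \<Longrightarrow> std \<beta>"
begin

text \<open>
  The double complex \<open>C\<^sub>p \<otimes> \<And>\<^sup>q\<close> in total degree \<open>j\<close>. Its rows are augmented by \<open>haug\<close> to the
  Koszul complex of \<open>R/I\<close>, its columns by \<open>vaug\<close> to \<open>C \<otimes> k\<close>; all augmented rows and columns
  are exact.
\<close>

definition chains :: "nat \<Rightarrow> nat \<Rightarrow> int \<Rightarrow> ('n, 'k) bichain set" where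
  "chains p q j = {u. \<forall>A i. (u A i \<noteq> 0 \<longrightarrow> card A = q \<and> i < frank C p) \<and>
     homogeneous (j - int q - shift C p i) (u A i)}"

definition hdiff :: "nat \<Rightarrow> ('n, 'k) bichain \<Rightarrow> ('n, 'k) bichain" where
  "hdiff p u = (\<lambda>A. diff_map C p (u A))"

definition vdiff :: "('n, 'k) bichain \<Rightarrow> ('n, 'k) bichain" where
  "vdiff u = (\<lambda>A i. koszul_poly (\<lambda>B. u B i) A)"

definition haug :: "('n, 'k) bichain \<Rightarrow> ('n, 'k) kchain" where
  "haug u = (\<lambda>(A, \<beta>). if std \<beta> then Poly_Mapping.lookup (aug_map C (u A)) \<beta> else 0)"

definition vaug :: "nat \<Rightarrow> ('n, 'k) bichain \<Rightarrow> nat \<Rightarrow> 'k" where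
  "vaug p u = (\<lambda>i. if i < frank C p then const_coeff (u {} i) else 0)"

lemma homogeneous_aug: "p < frank C 0 \<Longrightarrow> homogeneous (shift C 0 p) (aug C p)"
  and homogeneous_dmat: "q < frank C i \<Longrightarrow> p < frank C (Suc i) \<Longrightarrow>
    homogeneous (shift C (Suc i) p - shift C i q) (dmat C i q p)"
  and aug_surj: "\<exists>v\<in>free_mod C 0. f - aug_map C v \<in> I"
  and aug_exact: "{v \<in> free_mod C 0. aug_map C v \<in> I} = diff_map C 0 ` free_mod C (Suc 0)"
  and diff_exact: "{v \<in> free_mod C (Suc i). diff_map C i v = (\<lambda>_. 0)} = diff_map C (Suc i) ` free_mod C (Suc (Suc i))"
  using res unfolding graded_free_resolution_def by (auto simp: One_nat_def)

lemma diff_map_add: "diff_map C p (\<lambda>i. v i + w i) = (\<lambda>i. diff_map C p v i + diff_map C p w i)"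
  by (auto simp: diff_map_def fun_eq_iff algebra_simps sum.distrib)

lemma diff_map_mult: "diff_map C p (\<lambda>i. f * v i) = (\<lambda>i. f * diff_map C p v i)"
  by (auto simp: diff_map_def fun_eq_iff algebra_simps sum_distrib_left)

lemma linear_hdiff: "Vector_Spaces.linear pscale pscale (hdiff p)"
  unfolding Vector_Spaces.linear_iff
  by (intro conjI allI poly_space.vector_space_axioms)
    (simp_all add: hdiff_def fun_eq_iff plus_fun_def diff_map_add diff_map_mult)

lemma linear_vdiff: "Vector_Spaces.linear pscale pscale vdiff"
  unfolding Vector_Spaces.linear_iff
  by (intro conjI allI poly_space.vector_space_axioms)
    (simp_all add: vdiff_def fun_eq_iff plus_fun_def koszul_poly_add koszul_poly_mult)

lemma linear_haug: "Vector_Spaces.linear pscale fscale haug"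
proof -
  have "aug_map C (\<lambda>i. v i + w i) = aug_map C v + aug_map C w" for v w
    by (simp add: aug_map_def algebra_simps sum.distrib)
  moreover have "aug_map C (\<lambda>i. f * v i) = f * aug_map C v" for f v
    by (simp add: aug_map_def algebra_simps sum_distrib_left)
  ultimately show ?thesis
    unfolding Vector_Spaces.linear_iff
    by (intro conjI allI poly_space.vector_space_axioms vector_space_fun)
      (simp_all add: haug_def fun_eq_iff plus_fun_def lookup_add lookup_const_mult)
qed

lemma linear_vaug: "Vector_Spaces.linear pscale fscale (vaug p)"
proof -
  have "const_coeff (Poly_Mapping.single 0 c * f) = c * const_coeff f" for c and f :: "('n, 'k) polyring"
    by (simp add: const_coeff_mult) (simp add: const_coeff_def)
  then show ?thesis
    unfolding Vector_Spaces.linear_iff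
    by (intro conjI allI poly_space.vector_space_axioms vector_space_fun)
      (simp_all add: vaug_def fun_eq_iff plus_fun_def const_coeff_add)
qed

lemma subspace_chains: "poly_space.subspace (chains p q j)"
  unfolding poly_space.subspace_def
proof (intro conjI ballI allI)
  show "0 \<in> chains p q j"
    by (simp add: chains_def homogeneous_zero)
next
  fix u v assume uv: "u \<in> chains p q j" "v \<in> chains p q j"
  have "card A = q \<and> i < frank C p" if nz: "u A i + v A i \<noteq> 0" for A i
  proof -
    have "u A i \<noteq> 0 \<or> v A i \<noteq> 0"
      using nz by auto
    with uv show ?thesis
      unfolding chains_def by blast
  qed
  with uv show "u + v \<in> chains p q j"
    by (simp add: chains_def homogeneous_add)
next
  fix c u assume u: "u \<in> chains p q j"
  have "homogeneous e (Poly_Mapping.single 0 c * f)" if "homogeneous e f" for e and f :: "('n, 'k) polyring"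
    using that by (simp add: homogeneous_iff lookup_const_mult)
  moreover have "u A i \<noteq> 0" if "Poly_Mapping.single 0 c * u A i \<noteq> 0" for A i
    using that by auto
  ultimately show "(\<lambda>A i. Poly_Mapping.single 0 c * u A i) \<in> chains p q j"
    using u unfolding chains_def by blast
qed

text \<open>Fixing the total degree leaves finitely many monomials for each of the finitely many
  basis elements. The dimension counts rest on this, so they are made one degree at a time.\<close>

lemma chains_finite_span: "\<exists>S. finite S \<and> chains p q j \<subseteq> poly_space.span S"
proof -
  define T where "T = (SIGMA A:(UNIV :: 'n set set). SIGMA i:{..<frank C p}. {\<beta> :: 'n expvec. int (mdeg \<beta>) = j - int q - shift C p i})"
  define b where "b = (\<lambda>(A :: 'n set, i :: nat, \<beta>) A' i'. if A' = A \<and> i' = i then Poly_Mapping.single \<beta> 1 else 0 :: ('n, 'k) polyring)"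
  have finT: "finite T"
    unfolding T_def by (intro finite_SigmaI finite_int_mdeg) auto
  have "u \<in> poly_space.span (b ` T)" if u: "u \<in> chains p q j" for u
  proof -
    have "u = (\<Sum>t\<in>T. (\<lambda>A' i'. Poly_Mapping.single 0 (case t of (A, i, \<beta>) \<Rightarrow> Poly_Mapping.lookup (u A i) \<beta>) * b t A' i'))"
      (is "u = ?s")
    proof (intro ext poly_mapping_eqI)
      fix A i \<beta>
      have "Poly_Mapping.lookup (?s A i) \<beta> = (\<Sum>t\<in>T. if t = (A, i, \<beta>) then Poly_Mapping.lookup (u A i) \<beta> else 0)"
        unfolding sum_fun_apply lookup_sum
        by (intro sum.cong)
          (auto simp: b_def lookup_const_mult lookup_single when_def if_distrib[of Poly_Mapping.lookup]
            if_distribR split: if_splits)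
      also have "\<dots> = (if (A, i, \<beta>) \<in> T then Poly_Mapping.lookup (u A i) \<beta> else 0)"
        using finT by simp
      also have "\<dots> = Poly_Mapping.lookup (u A i) \<beta>"
        using u by (auto simp: T_def chains_def homogeneous_iff) (metis lookup_zero)
      finally show "Poly_Mapping.lookup (u A i) \<beta> = Poly_Mapping.lookup (?s A i) \<beta>" ..
    qed
    also have "\<dots> \<in> poly_space.span (b ` T)"
      by (intro poly_space.span_sum poly_space.span_scale poly_space.span_base) auto
    finally show ?thesis .
  qed
  with finT show ?thesis by blast
qed

text \<open>The two differentials act on different tensor factors. The squares commute without the
  usual sign, since only kernels and images are compared and no total complex is formed.\<close>

lemma vdiff_hdiff: "vdiff (hdiff p u) = hdiff p (vdiff u)"
proof (intro ext)
  fix A i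
  show "vdiff (hdiff p u) A i = hdiff p (vdiff u) A i"
  proof (cases "i < frank C p")
    case True
    have "vdiff (hdiff p u) A i = koszul_poly (\<lambda>B. \<Sum>l<frank C (Suc p). dmat C p i l * u B l) A"
      using True by (simp add: vdiff_def hdiff_def diff_map_def)
    also have "\<dots> = (\<Sum>l<frank C (Suc p). dmat C p i l * koszul_poly (\<lambda>B. u B l) A)"
      unfolding koszul_poly_sum koszul_poly_mult ..
    finally show ?thesis
      using True by (simp add: vdiff_def hdiff_def diff_map_def)
  qed (simp add: vdiff_def hdiff_def diff_map_def koszul_poly_def)
qed

text \<open>All divisors of a monomial outside I lie outside I, so the terms discarded by
  \<open>haug\<close> never reach a coordinate that is kept.\<close>

lemma haug_vdiff: "haug (vdiff u) = koszul_mod std (haug u)"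
proof
  fix x :: "'n set \<times> 'n expvec"
  obtain A \<gamma> where x: "x = (A, \<gamma>)"
    by (cases x)
  have "aug_map C (vdiff u A) = koszul_poly (\<lambda>B. aug_map C (u B)) A"
    unfolding aug_map_def vdiff_def koszul_poly_sum koszul_poly_mult ..
  moreover have "koszul (\<lambda>(A, \<beta>). Poly_Mapping.lookup (aug_map C (u A)) \<beta>) (A, \<gamma>) = koszul (haug u) (A, \<gamma>)"
    if "std \<gamma>"
    unfolding koszul_def haug_def prod.case
  proof (intro sum.cong refl if_cong arg_cong2[where f = "(*)"])
    fix a assume "unit_vec a pdvd \<gamma>"
    then have "\<gamma> - unit_vec a pdvd \<gamma>"
      using pdvd_diff_add pdvd_add by metis
    with that have "std (\<gamma> - unit_vec a)"
      by (rule std_pdvd)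
    then show "Poly_Mapping.lookup (aug_map C (u (insert a A))) (\<gamma> - unit_vec a) =
        (if std (\<gamma> - unit_vec a) then Poly_Mapping.lookup (aug_map C (u (insert a A))) (\<gamma> - unit_vec a) else 0)"
      by simp
  qed
  ultimately show "haug (vdiff u) x = koszul_mod std (haug u) x"
    by (simp add: x haug_def[of "vdiff u"] koszul_mod_def lookup_koszul_poly)
qed

lemma vaug_hdiff: "vaug p (hdiff p u) = tens_diff C p (vaug (Suc p) u)"
  by (auto simp: fun_eq_iff vaug_def hdiff_def tens_diff_def diff_map_def const_coeff_sum const_coeff_mult)

lemma chains_free_mod: "u \<in> chains p q j \<Longrightarrow> u A \<in> free_mod C p"
  by (auto simp: chains_def free_mod_def not_less[symmetric])

text \<open>The exactness in \<open>graded_free_resolution\<close> is ungraded. A lift of a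
  homogeneous element is replaced by its part of degree \<open>e\<close>, which is still a lift
  because the matrix entries are homogeneous.\<close>

definition hpart :: "nat \<Rightarrow> int \<Rightarrow> (nat \<Rightarrow> ('n, 'k) polyring) \<Rightarrow> nat \<Rightarrow> ('n, 'k) polyring" where
  "hpart p e v = (\<lambda>i. hcomp (e - shift C p i) (v i))"

lemma diff_map_hpart: "diff_map C p (hpart (Suc p) e v) = hpart p e (diff_map C p v)"
proof
  fix i
  show "diff_map C p (hpart (Suc p) e v) i = hpart p e (diff_map C p v) i"
  proof (cases "i < frank C p")
    case True
    have "hcomp (e - shift C p i) (dmat C p i l * v l) = dmat C p i l * hcomp (e - shift C (Suc p) l) (v l)"
      if "l < frank C (Suc p)" for l
      by (subst hcomp_mult[OF homogeneous_dmat[OF True that]]) simp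
    with True show ?thesis
      by (simp add: diff_map_def hpart_def hcomp_sum)
  next
    case False
    have "hcomp e' 0 = (0 :: ('n, 'k) polyring)" for e'
      by (simp add: hcomp_homogeneous homogeneous_zero)
    with False show ?thesis
      by (simp add: diff_map_def hpart_def)
  qed
qed

lemma aug_map_hpart: "aug_map C (hpart 0 e v) = hcomp e (aug_map C v)"
proof -
  have "hcomp e (aug C p * v p) = aug C p * hcomp (e - shift C 0 p) (v p)" if "p < frank C 0" for p
    by (rule hcomp_mult[OF homogeneous_aug[OF that]])
  then show ?thesis
    by (simp add: aug_map_def hpart_def hcomp_sum)
qed

lemma hpart_chains:
  assumes "\<And>A. v A \<in> free_mod C p"
  shows "(\<lambda>A. if card A = q then hpart p (j - int q) (v A) else 0) \<in> chains p q j"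
proof -
  have "hcomp e 0 = (0 :: ('n, 'k) polyring)" for e
    by (simp add: hcomp_homogeneous homogeneous_zero)
  then have "hpart p (j - int q) (v A) i = 0" if "frank C p \<le> i" for A i
    using assms[of A] that by (simp add: free_mod_def hpart_def)
  then have "hpart p (j - int q) (v A) i \<noteq> 0 \<Longrightarrow> i < frank C p" for A i
    by (meson leI)
  then show ?thesis
    by (auto simp: chains_def homogeneous_zero) (auto simp: hpart_def homogeneous_hcomp)
qed

lemma hpart_chains_eq:
  assumes "u \<in> chains p q j"
  shows "(if card A = q then hpart p (j - int q) (u A) else 0) = u A"
  using assms by (auto simp: chains_def fun_eq_iff hpart_def hcomp_homogeneous)

lemma hdiff_chains: assumes "u \<in> chains (Suc p) q j" shows "hdiff p u \<in> chains p q j"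
proof -
  have "hdiff p u = (\<lambda>A. if card A = q then hpart p (j - int q) (diff_map C p (u A)) else 0)"
  proof
    fix A
    have "hdiff p u A = diff_map C p (if card A = q then hpart (Suc p) (j - int q) (u A) else 0)"
      by (simp only: hdiff_def hpart_chains_eq[OF assms])
    also have "\<dots> = (if card A = q then hpart p (j - int q) (diff_map C p (u A)) else 0)"
      by (simp add: diff_map_hpart) (simp add: diff_map_def fun_eq_iff)
    finally show "hdiff p u A = (if card A = q then hpart p (j - int q) (diff_map C p (u A)) else 0)" .
  qed
  moreover have "\<dots> \<in> chains p q j"
    by (rule hpart_chains) (rule diff_map_free_mod)
  ultimately show ?thesis by simp
qed

text \<open>A row is a direct sum of copies of the resolution, one for each e_A; lifts are chosen
  for each \<open>A\<close> separately and then made homogeneous.\<close>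

lemma hdiff_exact: "{u \<in> chains (Suc p) q j. hdiff p u = 0} = hdiff (Suc p) ` chains (Suc (Suc p)) q j"
proof (intro equalityI subsetI)
  fix u assume "u \<in> hdiff (Suc p) ` chains (Suc (Suc p)) q j"
  then obtain w where w: "u = hdiff (Suc p) w" "w \<in> chains (Suc (Suc p)) q j"
    by auto
  have "diff_map C p (u A) = (\<lambda>_. 0)" for A
    using diff_exact[of p] chains_free_mod[OF w(2), of A] by (auto simp: w(1) hdiff_def)
  then have "hdiff p u = 0"
    by (simp add: hdiff_def fun_eq_iff)
  then show "u \<in> {u \<in> chains (Suc p) q j. hdiff p u = 0}"
    using w hdiff_chains by simp
next
  fix u assume u: "u \<in> {u \<in> chains (Suc p) q j. hdiff p u = 0}"
  have "\<exists>w\<in>free_mod C (Suc (Suc p)). diff_map C (Suc p) w = u A" for A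
  proof -
    have "diff_map C p (u A) = (\<lambda>_. 0)"
      using u by (auto simp: hdiff_def fun_eq_iff)
    moreover have "u A \<in> free_mod C (Suc p)"
      using u chains_free_mod by blast
    ultimately have "u A \<in> diff_map C (Suc p) ` free_mod C (Suc (Suc p))"
      using diff_exact[of p] by blast
    then show ?thesis by auto
  qed
  then obtain w where w: "\<And>A. w A \<in> free_mod C (Suc (Suc p))" "\<And>A. diff_map C (Suc p) (w A) = u A"
    by metis
  let ?w = "\<lambda>A. if card A = q then hpart (Suc (Suc p)) (j - int q) (w A) else 0"
  have hw: "hdiff (Suc p) ?w = u"
  proof
    fix A
    have "hdiff (Suc p) ?w A = (if card A = q then hpart (Suc p) (j - int q) (u A) else 0)"
      by (simp add: hdiff_def diff_map_hpart w) (simp add: diff_map_def fun_eq_iff)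
    then show "hdiff (Suc p) ?w A = u A"
      using hpart_chains_eq u by simp
  qed
  show "u \<in> hdiff (Suc p) ` chains (Suc (Suc p)) q j"
    by (rule image_eqI[where x = ?w], rule hw[symmetric], rule hpart_chains, rule w(1))
qed

lemma haug_zero_iff: "haug u = 0 \<longleftrightarrow> (\<forall>A. aug_map C (u A) \<in> I)"
  by (auto simp: haug_def fun_eq_iff mem_I)

lemma haug_exact: "{u \<in> chains 0 q j. haug u = 0} = hdiff 0 ` chains (Suc 0) q j"
proof (intro equalityI subsetI)
  fix u assume "u \<in> hdiff 0 ` chains (Suc 0) q j"
  then obtain w where w: "u = hdiff 0 w" "w \<in> chains (Suc 0) q j"
    by auto
  have "aug_map C (u A) \<in> I" for A
    using aug_exact chains_free_mod[OF w(2), of A] by (auto simp: w(1) hdiff_def)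
  then show "u \<in> {u \<in> chains 0 q j. haug u = 0}"
    using w hdiff_chains haug_zero_iff by simp
next
  fix u assume u: "u \<in> {u \<in> chains 0 q j. haug u = 0}"
  have "\<exists>w\<in>free_mod C (Suc 0). diff_map C 0 w = u A" for A
  proof -
    have "aug_map C (u A) \<in> I"
      using u haug_zero_iff by blast
    moreover have "u A \<in> free_mod C 0"
      using u chains_free_mod by blast
    ultimately have "u A \<in> diff_map C 0 ` free_mod C (Suc 0)"
      using aug_exact by blast
    then show ?thesis by auto
  qed
  then obtain w where w: "\<And>A. w A \<in> free_mod C (Suc 0)" "\<And>A. diff_map C 0 (w A) = u A"
    by metis
  let ?w = "\<lambda>A. if card A = q then hpart (Suc 0) (j - int q) (w A) else 0"
  have hw: "hdiff 0 ?w = u"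
  proof
    fix A
    have "hdiff 0 ?w A = (if card A = q then hpart 0 (j - int q) (u A) else 0)"
      by (simp add: hdiff_def diff_map_hpart w) (simp add: diff_map_def fun_eq_iff)
    then show "hdiff 0 ?w A = u A"
      using hpart_chains_eq u by simp
  qed
  show "u \<in> hdiff 0 ` chains (Suc 0) q j"
    by (rule image_eqI[where x = ?w], rule hw[symmetric], rule hpart_chains, rule w(1))
qed

lemma haug_surj: "haug ` chains 0 q j = supported (koszul_basis std q (j - int q))"
proof (intro equalityI subsetI)
  fix e assume "e \<in> haug ` chains 0 q j"
  then obtain u where u: "u \<in> chains 0 q j" "e = haug u"
    by auto
  have "card A = q \<and> int (mdeg \<beta>) = j - int q" if nz: "Poly_Mapping.lookup (aug_map C (u A)) \<beta> \<noteq> 0" for A \<beta>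
  proof -
    have "aug_map C (u A) = aug_map C (if card A = q then hpart 0 (j - int q) (u A) else 0)"
      by (simp only: hpart_chains_eq[OF u(1)])
    also have "\<dots> = (if card A = q then hcomp (j - int q) (aug_map C (u A)) else 0)"
      by (simp add: aug_map_hpart) (simp add: aug_map_def)
    finally have "Poly_Mapping.lookup (aug_map C (u A)) \<beta> =
        Poly_Mapping.lookup (if card A = q then hcomp (j - int q) (aug_map C (u A)) else 0) \<beta>"
      by simp
    then show ?thesis
      using nz by (simp add: lookup_hcomp split: if_splits)
  qed
  then show "e \<in> supported (koszul_basis std q (j - int q))"
    by (auto simp: u(2) haug_def supported_def koszul_basis_def split: if_splits)
next
  fix e :: "('n, 'k) kchain" assume e: "e \<in> supported (koszul_basis std q (j - int q))"
  have "\<exists>f. \<forall>\<beta>. Poly_Mapping.lookup f \<beta> = e (A, \<beta>)" for A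
  proof -
    have "finite {\<beta>. e (A, \<beta>) \<noteq> 0}"
      by (rule finite_subset[OF _ finite_int_mdeg[of "j - int q"]])
        (use e in \<open>auto simp: supported_def koszul_basis_def\<close>)
    then show ?thesis
      by (intro exI[of _ "Abs_poly_mapping (\<lambda>\<beta>. e (A, \<beta>))"]) simp
  qed
  then obtain f where f: "\<And>A \<beta>. Poly_Mapping.lookup (f A) \<beta> = e (A, \<beta>)"
    by metis
  have "\<exists>v. v \<in> free_mod C 0 \<and> f A - aug_map C v \<in> I" for A
    using aug_surj[of "f A"] by blast
  then obtain v where v: "\<And>A. v A \<in> free_mod C 0" "\<And>A. f A - aug_map C (v A) \<in> I"
    by metis
  let ?u = "\<lambda>A. if card A = q then hpart 0 (j - int q) (v A) else 0"
  have av: "Poly_Mapping.lookup (aug_map C (v A)) \<beta> = e (A, \<beta>)" if "std \<beta>" for A \<beta>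
    using v(2)[of A] that unfolding mem_I f[symmetric] lookup_minus by (metis eq_iff_diff_eq_0)
  have "haug ?u x = e x" for x
  proof -
    obtain A \<beta> where x: "x = (A, \<beta>)"
      by (cases x)
    have au: "aug_map C (?u A) = (if card A = q then hcomp (j - int q) (aug_map C (v A)) else 0)"
      by (simp add: aug_map_hpart) (simp add: aug_map_def)
    have "e (A, \<beta>) = 0" if "\<not> (card A = q \<and> int (mdeg \<beta>) = j - int q \<and> std \<beta>)"
      using e that by (auto simp: supported_def koszul_basis_def)
    then show ?thesis
      unfolding x haug_def prod.case au by (auto simp: lookup_hcomp av)
  qed
  then have hw: "haug ?u = e" by blast
  show "e \<in> haug ` chains 0 q j"
    by (rule image_eqI[where x = ?u], rule hw[symmetric], rule hpart_chains, rule v(1))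
qed

lemma vdiff_chains:
  assumes "u \<in> chains p (Suc q) j"
  shows "vdiff u \<in> chains p q j"
proof -
  have "card A = q \<and> i < frank C p" if nz: "koszul_poly (\<lambda>B. u B i) A \<noteq> 0" for A i
  proof -
    obtain a where a: "a \<notin> A" "u (insert a A) i \<noteq> 0"
      using nz unfolding koszul_poly_def by (metis (no_types, lifting) DiffD2 mult_zero_right sum.neutral)
    then have "card (insert a A) = Suc q" "i < frank C p"
      using assms by (auto simp: chains_def)
    with a show ?thesis by simp
  qed
  moreover have "homogeneous (j - int q - shift C p i) (koszul_poly (\<lambda>B. u B i) A)" for A i
    unfolding koszul_poly_def
  proof (rule homogeneous_sum)
    fix a :: 'n
    have e: "int (mdeg (unit_vec a)) + (j - int (Suc q) - shift C p i) = j - int q - shift C p i"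
      by (simp add: mdeg_single)
    have "homogeneous (int (mdeg (unit_vec a)) + (j - int (Suc q) - shift C p i))
        (Poly_Mapping.single (unit_vec a) (sg a A) * u (insert a A) i)"
      using assms by (intro homogeneous_mult homogeneous_single) (simp add: chains_def)
    then show "homogeneous (j - int q - shift C p i) (Poly_Mapping.single (unit_vec a) (sg a A) * u (insert a A) i)"
      unfolding e .
  qed
  ultimately show ?thesis
    by (simp add: chains_def vdiff_def)
qed

lemma vdiff_vdiff: "vdiff (vdiff u) = 0"
  by (simp add: vdiff_def fun_eq_iff koszul_poly_koszul_poly)

text \<open>A column is a direct sum of shifted Koszul complexes, one for each basis element of C_p,
  and the lift is made in each of them by \<open>koszul_poly_exact\<close>.\<close>

lemma vdiff_lift:
  assumes u: "u \<in> chains p q j" and cyc: "vdiff u = 0" and aug: "q = 0 \<Longrightarrow> vaug p u = 0"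
  shows "u \<in> vdiff ` chains p (Suc q) j"
proof -
  have "\<exists>w. koszul_poly w = (\<lambda>B. u B i) \<and> (\<forall>A. w A \<noteq> 0 \<longrightarrow> card A = Suc q \<and> i < frank C p) \<and>
      (\<forall>A. homogeneous (j - int (Suc q) - shift C p i) (w A))" for i
  proof (cases "i < frank C p")
    case True
    have 1: "card A = q" if "u A i \<noteq> 0" for A
      using u that by (simp add: chains_def)
    have 2: "homogeneous (j - shift C p i - int q) (u A i)" for A
      using u by (simp add: chains_def algebra_simps)
    have 3: "koszul_poly (\<lambda>B. u B i) = 0"
      using cyc by (simp add: vdiff_def fun_eq_iff)
    have 4: "const_coeff (u {} i) = 0" if "q = 0"
      using fun_cong[OF aug[OF that], of i] True by (simp add: vaug_def)
    obtain w where "koszul_poly w = (\<lambda>B. u B i)" "\<And>A. w A \<noteq> 0 \<Longrightarrow> card A = Suc q"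
      "\<And>A. homogeneous (j - shift C p i - int (Suc q)) (w A)"
      using koszul_poly_exact[of "\<lambda>B. u B i" q "j - shift C p i"] 1 2 3 4 by metis
    with True show ?thesis
      by (intro exI[of _ w]) (simp add: algebra_simps)
  next
    case False
    then have "(\<lambda>B. u B i) = (\<lambda>_. 0)"
      using u by (auto simp: chains_def)
    then show ?thesis
      by (intro exI[of _ "\<lambda>_. 0"]) (simp add: koszul_poly_def fun_eq_iff homogeneous_zero)
  qed
  then obtain w where w: "\<And>i. koszul_poly (w i) = (\<lambda>B. u B i)"
    "\<And>i A. w i A \<noteq> 0 \<Longrightarrow> card A = Suc q \<and> i < frank C p"
    "\<And>i A. homogeneous (j - int (Suc q) - shift C p i) (w i A)"
    by metis
  have "(\<lambda>A i. w i A) \<in> chains p (Suc q) j"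
    using w(2,3) unfolding chains_def by blast
  moreover have "vdiff (\<lambda>A i. w i A) = u"
    using w(1) by (simp add: vdiff_def fun_eq_iff)
  ultimately show ?thesis by blast
qed

lemma vdiff_exact: "{u \<in> chains p (Suc q) j. vdiff u = 0} = vdiff ` chains p (Suc (Suc q)) j"
  using vdiff_lift[of _ p "Suc q" j] vdiff_chains vdiff_vdiff by auto

lemma vaug_exact: "{u \<in> chains p 0 j. vaug p u = 0} = vdiff ` chains p (Suc 0) j"
proof (intro equalityI subsetI)
  fix u assume u: "u \<in> {u \<in> chains p 0 j. vaug p u = 0}"
  have "u A i = 0" if "A \<noteq> {}" for A i
    using u that by (auto simp: chains_def)
  then have "vdiff u = 0"
    by (simp add: vdiff_def koszul_poly_def fun_eq_iff)
  then show "u \<in> vdiff ` chains p (Suc 0) j"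
    using vdiff_lift[of u p 0 j] u by simp
next
  fix u assume "u \<in> vdiff ` chains p (Suc 0) j"
  then obtain w where w: "w \<in> chains p (Suc 0) j" "u = vdiff w"
    by auto
  have "unit_vec a \<noteq> 0" for a :: 'n
    by (metis lookup_single_eq lookup_zero zero_neq_one)
  then have "const_coeff (koszul_poly v {}) = 0" for v :: "'n set \<Rightarrow> ('n, 'k) polyring"
    unfolding koszul_poly_def const_coeff_sum const_coeff_mult
    by (simp add: const_coeff_def lookup_single)
  then show "u \<in> {u \<in> chains p 0 j. vaug p u = 0}"
    using vdiff_chains[OF w(1)] by (simp add: w(2)) (simp add: vaug_def vdiff_def fun_eq_iff)
qed

lemma vaug_surj: "vaug p ` chains p 0 j = tens_mod C p j"
proof (intro equalityI subsetI)
  fix z assume "z \<in> vaug p ` chains p 0 j"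
  then obtain u where u: "u \<in> chains p 0 j" "z = vaug p u"
    by auto
  have "i < frank C p \<and> shift C p i = j" if "z i \<noteq> 0" for i
  proof -
    have "i < frank C p" "Poly_Mapping.lookup (u {} i) 0 \<noteq> 0"
      using that by (auto simp: u(2) vaug_def const_coeff_def split: if_splits)
    moreover have "homogeneous (j - shift C p i) (u {} i)"
      using u(1) by (simp add: chains_def)
    ultimately show ?thesis
      unfolding homogeneous_iff by (auto simp: mdeg_def dest!: spec[of _ 0])
  qed
  then show "z \<in> tens_mod C p j"
    by (simp add: tens_mod_def)
next
  fix z assume z: "z \<in> tens_mod C p j"
  let ?u = "\<lambda>A i. if A = {} then Poly_Mapping.single 0 (z i) else 0"
  have h: "homogeneous (j - shift C p i) (Poly_Mapping.single 0 (z i))" for i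
    using z homogeneous_single[of 0 "z i"] homogeneous_zero by (cases "z i = 0") (auto simp: tens_mod_def mdeg_def)
  have "z i \<noteq> 0" if "Poly_Mapping.single 0 (z i) \<noteq> 0" for i
    using that by auto
  then have "?u \<in> chains p 0 j"
    using z h unfolding chains_def tens_mod_def by (auto simp: homogeneous_zero)
  moreover have "vaug p ?u = z"
    using z by (auto simp: vaug_def fun_eq_iff const_coeff_def tens_mod_def)
  ultimately show "z \<in> vaug p ` chains p 0 j"
    using image_eqI[of z "vaug p" ?u] by simp
qed

end

definition koszul_cycles ::
  "('n::{finite,linorder} expvec \<Rightarrow> bool) \<Rightarrow> nat \<Rightarrow> int \<Rightarrow> ('n set \<times> 'n expvec \<Rightarrow> 'k::field) set" where
  "koszul_cycles std l e = {u \<in> supported (koszul_basis std l e). koszul_mod std u = 0}"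

definition koszul_boundaries ::
  "('n::{finite,linorder} expvec \<Rightarrow> bool) \<Rightarrow> nat \<Rightarrow> int \<Rightarrow> ('n set \<times> 'n expvec \<Rightarrow> 'k::field) set" where
  "koszul_boundaries std l e = koszul_mod std ` supported (koszul_basis std (Suc l) (e - 1))"

section \<open>Comparison along the antidiagonals of the double complex\<close>

context resolved_monomial_quotient
begin

definition hbd :: "nat \<Rightarrow> nat \<Rightarrow> int \<Rightarrow> ('n, 'k) bichain set" where
  "hbd p q j = hdiff p ` chains (Suc p) q j"

definition vbd :: "nat \<Rightarrow> nat \<Rightarrow> int \<Rightarrow> ('n, 'k) bichain set" where
  "vbd p q j = vdiff ` chains p (Suc q) j"

text \<open>
  The dimension of \<open>(ker d \<inter> ker d')/im (d d')\<close> at the place \<open>(p, q)\<close>. It is constant along the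
  antidiagonals and equals the homology of the two augmentations at their ends.
\<close>

definition defect :: "nat \<Rightarrow> nat \<Rightarrow> int \<Rightarrow> int" where
  "defect p q j = int (poly_space.dim (hbd p q j \<inter> vbd p q j)) -
    int (poly_space.dim (hdiff p ` vdiff ` chains (Suc p) (Suc q) j))"

lemma hbd_Suc: "hbd (Suc p) q j = {u \<in> chains (Suc p) q j. hdiff p u = 0}"
  and hbd_0: "hbd 0 q j = {u \<in> chains 0 q j. haug u = 0}"
  and vbd_Suc: "vbd p (Suc q) j = {u \<in> chains p (Suc q) j. vdiff u = 0}"
  and vbd_0: "vbd p 0 j = {u \<in> chains p 0 j. vaug p u = 0}"
  by (simp_all only: hbd_def vbd_def hdiff_exact haug_exact vdiff_exact vaug_exact)

lemma hbd_subset: "hbd p q j \<subseteq> chains p q j"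
  by (cases p) (auto simp: hbd_Suc hbd_0)

lemma vbd_subset: "vbd p q j \<subseteq> chains p q j"
  by (cases q) (auto simp: vbd_Suc vbd_0)

lemma vdiff_image_hdiff: "vdiff ` hdiff p ` X = hdiff p ` vdiff ` X"
  by (simp add: image_image vdiff_hdiff)

lemma hdiff_0: "hdiff p 0 = 0"
  and haug_0: "haug 0 = 0"
  by (auto simp: hdiff_def diff_map_def haug_def aug_map_def fun_eq_iff)

lemma subspace_ker:
  "Vector_Spaces.linear pscale pscale f \<Longrightarrow> poly_space.subspace {y. f y = 0}"
  by (rule vector_space_pair.linear_subspace_kernel[OF vector_space_pair.intro])
    (rule poly_space.vector_space_axioms)+

text \<open>The square starts at \<open>chains (Suc p) (Suc q) j\<close> with the maps
  \<open>hdiff p\<close> and \<open>vdiff\<close>. Its restricted images are the numerators at (p, q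
  + 1) and (p + 1, q). The images of the kernels are, by exactness and commutation, the two
  denominators.\<close>

lemma defect_shift: "defect p (Suc q) j = defect (Suc p) q j"
proof -
  obtain S where S: "finite S" "chains (Suc p) (Suc q) j \<subseteq> poly_space.span S"
    using chains_finite_span by blast
  have "poly_space.dim {y \<in> hbd p (Suc q) j. vdiff y = 0} +
      poly_space.dim (vdiff ` {x \<in> chains (Suc p) (Suc q) j. hdiff p x = 0}) =
    poly_space.dim {z \<in> vbd (Suc p) q j. hdiff p z = 0} +
      poly_space.dim (hdiff p ` {x \<in> chains (Suc p) (Suc q) j. vdiff x = 0})"
    unfolding hbd_def[of p] vbd_def[of "Suc p" q]
    by (rule kernel_image_square_on[OF linear_hdiff linear_vdiff subspace_chains S subspace_ker[OF linear_vdiff]])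
      (simp_all only: vdiff_hdiff hdiff_0)
  moreover have "{y \<in> hbd p (Suc q) j. vdiff y = 0} = hbd p (Suc q) j \<inter> vbd p (Suc q) j"
    using hbd_subset vbd_Suc by blast
  moreover have "{z \<in> vbd (Suc p) q j. hdiff p z = 0} = hbd (Suc p) q j \<inter> vbd (Suc p) q j"
    using vbd_subset hbd_Suc by blast
  ultimately show ?thesis
    unfolding defect_def hdiff_exact vdiff_exact vdiff_image_hdiff by simp
qed

lemma defect_sum: "defect p q j = defect 0 (p + q) j"
proof (induction p arbitrary: q)
  case (Suc p)
  then show ?case
    using defect_shift[of p q j] Suc.IH[of "Suc q"] by simp
qed simp

lemma haug_chains: "haug ` chains 0 q (int q + e) = supported (koszul_basis std q e)"
  using haug_surj[of q "int q + e"] by simp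

lemma haug_vbd: "haug ` vbd 0 l (int l + e) = koszul_boundaries std l e"
proof -
  have "haug ` vbd 0 l (int l + e) = koszul_mod std ` haug ` chains 0 (Suc l) (int (Suc l) + (e - 1))"
    by (simp add: vbd_def image_image haug_vdiff)
  then show ?thesis
    by (simp only: haug_chains koszul_boundaries_def)
qed

lemma vaug_hbd: "vaug p ` hbd p 0 j = tens_boundaries C p j"
  unfolding hbd_def tens_boundaries_def vaug_surj[symmetric] by (simp add: image_image vaug_hdiff)

lemma koszul_mod_ker: "fun_space.subspace {y. koszul_mod std y = 0}"
  by (rule vector_space_pair.linear_subspace_kernel[OF vector_space_pair.intro linear_koszul_mod])
    (rule vector_space_fun)+

text \<open>The same square at the edge p = 0, with \<open>haug\<close> in place of the horizontal
  differential; it links exterior degree l + 1 of R/I to the defect at (0, l).\<close>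

lemma koszul_side: "int (kdim (koszul_cycles std (Suc l) e :: ('n, 'k) kchain set)) -
    int (kdim (koszul_boundaries std (Suc l) e :: ('n, 'k) kchain set)) =
  defect 0 l (int (Suc l) + e)"
proof -
  define j where "j = int (Suc l) + e"
  have surj: "haug ` chains 0 (Suc l) j = supported (koszul_basis std (Suc l) e)"
    unfolding j_def by (rule haug_chains)
  have bd: "haug ` vbd 0 (Suc l) j = koszul_boundaries std (Suc l) e"
    unfolding j_def by (rule haug_vbd)
  obtain S where S: "finite S" "chains 0 (Suc l) j \<subseteq> poly_space.span S"
    using chains_finite_span by blast
  have "fun_space.dim {y \<in> haug ` chains 0 (Suc l) j. koszul_mod std y = 0} +
      poly_space.dim (vdiff ` {x \<in> chains 0 (Suc l) j. haug x = 0}) =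
    poly_space.dim {z \<in> vdiff ` chains 0 (Suc l) j. haug z = 0} +
      fun_space.dim (haug ` {x \<in> chains 0 (Suc l) j. vdiff x = 0})"
    by (rule kernel_image_square_on[OF linear_haug linear_vdiff subspace_chains S koszul_mod_ker])
      (simp_all only: haug_vdiff haug_0)
  moreover have "{z \<in> vdiff ` chains 0 (Suc l) j. haug z = 0} = hbd 0 l j \<inter> vbd 0 l j"
    unfolding vbd_def[symmetric] using vbd_subset hbd_0 by blast
  moreover have "{x \<in> chains 0 (Suc l) j. haug x = 0} = hdiff 0 ` chains (Suc 0) (Suc l) j"
    by (rule haug_exact)
  moreover have "{x \<in> chains 0 (Suc l) j. vdiff x = 0} = vbd 0 (Suc l) j"
    by (simp only: vbd_Suc)
  ultimately show ?thesis
    unfolding j_def[symmetric] defect_def kdim_def koszul_cycles_def bd[symmetric] surj[symmetric]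
    by (simp add: vdiff_image_hdiff)
qed

text \<open>The transposed edge q = 0: here \<open>vaug\<close> replaces the vertical
  differential.\<close>

lemma tens_side: "int (kdim (tens_cycles C (Suc l) j)) - int (kdim (tens_boundaries C (Suc l) j)) =
  defect l 0 j"
proof -
  obtain S where S: "finite S" "chains (Suc l) 0 j \<subseteq> poly_space.span S"
    using chains_finite_span by blast
  have sub: "poly_space.subspace {y. vaug l y = 0}"
    by (rule vector_space_pair.linear_subspace_kernel[OF vector_space_pair.intro linear_vaug])
      (rule poly_space.vector_space_axioms vector_space_fun)+
  have "poly_space.dim {y \<in> hdiff l ` chains (Suc l) 0 j. vaug l y = 0} +
      fun_space.dim (vaug (Suc l) ` {x \<in> chains (Suc l) 0 j. hdiff l x = 0}) =
    fun_space.dim {z \<in> vaug (Suc l) ` chains (Suc l) 0 j. tens_diff C l z = (\<lambda>_. 0)} +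
      poly_space.dim (hdiff l ` {x \<in> chains (Suc l) 0 j. vaug (Suc l) x = 0})"
    by (rule kernel_image_square_on[OF linear_hdiff linear_vaug subspace_chains S sub])
      (simp_all add: vaug_hdiff zero_fun_def, auto simp: tens_diff_def)
  moreover have "{y \<in> hdiff l ` chains (Suc l) 0 j. vaug l y = 0} = hbd l 0 j \<inter> vbd l 0 j"
    unfolding hbd_def[symmetric] using hbd_subset vbd_0 by blast
  moreover have "{x \<in> chains (Suc l) 0 j. hdiff l x = 0} = hbd (Suc l) 0 j"
    by (simp only: hbd_Suc)
  moreover have "{x \<in> chains (Suc l) 0 j. vaug (Suc l) x = 0} = vdiff ` chains (Suc l) (Suc 0) j"
    by (rule vaug_exact)
  moreover have "tens_cycles C (Suc l) j = {z \<in> tens_mod C (Suc l) j. tens_diff C l z = (\<lambda>_. 0)}"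
    by (simp add: tens_cycles_def)
  ultimately show ?thesis
    unfolding defect_def kdim_def by (simp add: vaug_surj vaug_hbd)
qed

text \<open>At the corner both augmentations start from the same space and there is no further
  differential to impose, hence the predicate \<open>True\<close> in the square.\<close>

lemma degree_zero_side: "int (kdim (koszul_cycles std 0 e :: ('n, 'k) kchain set)) -
    int (kdim (koszul_boundaries std 0 e :: ('n, 'k) kchain set)) =
  int (kdim (tens_cycles C 0 e)) - int (kdim (tens_boundaries C 0 e))"
proof -
  obtain S where S: "finite S" "chains 0 0 e \<subseteq> poly_space.span S"
    using chains_finite_span by blast
  have "fun_space.dim {y \<in> haug ` chains 0 0 e. True} + fun_space.dim (vaug 0 ` {x \<in> chains 0 0 e. haug x = 0}) =
    fun_space.dim {z \<in> vaug 0 ` chains 0 0 e. True} + fun_space.dim (haug ` {x \<in> chains 0 0 e. vaug 0 x = 0})"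
    by (rule kernel_image_square_on[OF linear_haug linear_vaug subspace_chains S]) auto
  moreover have "koszul_mod std u = 0" if "u \<in> supported (koszul_basis std 0 e)" for u :: "('n, 'k) kchain"
  proof -
    have "u (insert a B, \<gamma>) = 0" for a B \<gamma>
      using that by (auto simp: supported_def koszul_basis_def dest: spec[of _ "insert a B"])
    then show ?thesis
      by (auto simp: koszul_mod_def koszul_def fun_eq_iff intro!: sum.neutral)
  qed
  then have "koszul_cycles std 0 e = (supported (koszul_basis std 0 e) :: ('n, 'k) kchain set)"
    by (auto simp: koszul_cycles_def)
  moreover have "{x \<in> chains 0 0 e. haug x = 0} = hbd 0 0 e" "{x \<in> chains 0 0 e. vaug 0 x = 0} = vbd 0 0 e"
    by (simp_all only: hbd_0 vbd_0)
  moreover have "haug ` chains 0 0 e = supported (koszul_basis std 0 e)" "haug ` vbd 0 0 e = koszul_boundaries std 0 e"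
    using haug_chains[of 0 e] haug_vbd[of 0 e] by simp_all
  moreover have "tens_cycles C 0 e = tens_mod C 0 e"
    by (simp add: tens_cycles_def)
  ultimately show ?thesis
    by (simp add: kdim_def vaug_hbd vaug_surj)
qed

text \<open>For l >= 1 both edges lead to the antidiagonal p + q = l - 1, along which the defect is
  constant; l = 0 is the corner. The internal degree l + e of Tor makes e the row of the Betti
  table.\<close>

theorem homology_dim_eq_koszul:
  "homology_dim C l (int l + e) =
    kdim (koszul_cycles std l e :: ('n, 'k) kchain set) -
    kdim (koszul_boundaries std l e :: ('n, 'k) kchain set)"
proof (cases l)
  case 0
  then show ?thesis
    using degree_zero_side[of e] by (simp add: homology_dim_def)
next
  case (Suc l')
  then show ?thesis
    using koszul_side[of l' e] tens_side[of l' "int (Suc l') + e"] defect_sum[of l' 0 "int (Suc l') + e"]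
    by (simp add: homology_dim_def)
qed

end

section \<open>The Koszul complex over the field\<close>

abbreviation (input) full :: "'n expvec \<Rightarrow> bool" where
  "full \<equiv> \<lambda>_. True"

lemma supported_polys:
  fixes u :: "'n::{finite,linorder} set \<times> 'n expvec \<Rightarrow> 'k::field"
  assumes "u \<in> supported (koszul_basis std l e)"
  obtains U where "\<And>A \<beta>. Poly_Mapping.lookup (U A) \<beta> = u (A, \<beta>)"
proof -
  have "finite {\<beta>. u (A, \<beta>) \<noteq> 0}" for A
    by (rule finite_subset[OF _ finite_int_mdeg[of e]])
      (use assms in \<open>auto simp: supported_def koszul_basis_def\<close>)
  then show thesis
    by (intro that[of "\<lambda>A. Abs_poly_mapping (\<lambda>\<beta>. u (A, \<beta>))"]) simp
qed

lemma koszul_eq_lookup: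
  assumes "\<And>A \<beta>. Poly_Mapping.lookup (U A) \<beta> = u (A, \<beta>)"
  shows "koszul u (B, \<gamma>) = Poly_Mapping.lookup (koszul_poly U B) \<gamma>"
proof -
  have "u = (\<lambda>(A, \<beta>). Poly_Mapping.lookup (U A) \<beta>)"
    using assms by auto
  then show ?thesis
    by (simp add: lookup_koszul_poly)
qed

lemma koszul_zero: "koszul 0 = 0"
  using koszul_scale[of 0 0] by (simp add: zero_fun_def)

lemma koszul_koszul:
  assumes "u \<in> supported (koszul_basis std l e)"
  shows "koszul (koszul u) = 0"
proof -
  obtain U where U: "\<And>A \<beta>. Poly_Mapping.lookup (U A) \<beta> = u (A, \<beta>)"
    using supported_polys[OF assms] by blast
  have "Poly_Mapping.lookup (koszul_poly U A) \<beta> = koszul u (A, \<beta>)" for A \<beta>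
    by (rule koszul_eq_lookup[OF U, symmetric])
  then have "koszul (koszul u) (A, \<beta>) = Poly_Mapping.lookup (koszul_poly (koszul_poly U) A) \<beta>" for A \<beta>
    by (rule koszul_eq_lookup)
  then show ?thesis
    by (simp add: fun_eq_iff koszul_poly_koszul_poly)
qed

lemma koszul_nonzeroE:
  assumes "koszul u (B, \<gamma>) \<noteq> 0"
  obtains a where "a \<notin> B" "unit_vec a pdvd \<gamma>" "u (insert a B, \<gamma> - unit_vec a) \<noteq> 0"
proof -
  have "\<exists>a\<in>UNIV - B. (if unit_vec a pdvd \<gamma> then sg a B * u (insert a B, \<gamma> - unit_vec a) else 0) \<noteq> 0"
    using assms unfolding koszul_def prod.case by (rule contrapos_np) (simp add: sum.neutral)
  then show thesis
    using that by (auto split: if_splits)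
qed

lemma koszul_supported:
  assumes "u \<in> supported (koszul_basis full (Suc l) e)"
  shows "koszul u \<in> supported (koszul_basis full l (e + 1))"
  unfolding supported_def
proof safe
  fix B \<gamma> assume "koszul u (B, \<gamma>) \<noteq> 0"
  then obtain a where a: "a \<notin> B" "unit_vec a pdvd \<gamma>" "u (insert a B, \<gamma> - unit_vec a) \<noteq> 0"
    by (rule koszul_nonzeroE)
  then have "card (insert a B) = Suc l" "int (mdeg (\<gamma> - unit_vec a)) = e"
    using assms by (auto simp: supported_def koszul_basis_def)
  moreover have "mdeg (\<gamma> - unit_vec a) + 1 = mdeg \<gamma>"
    using mdeg_diff[OF a(2)] by (simp add: mdeg_single)
  ultimately show "(B, \<gamma>) \<in> koszul_basis full l (e + 1)"
    using a(1) by (simp add: koszul_basis_def)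
qed

lemma koszul_top:
  assumes "u \<in> supported (koszul_basis std 0 e)"
  shows "koszul u = 0"
proof -
  have "koszul u (B, \<gamma>) = 0" for B \<gamma>
  proof (rule ccontr)
    assume "koszul u (B, \<gamma>) \<noteq> 0"
    then obtain a where "u (insert a B, \<gamma> - unit_vec a) \<noteq> 0"
      by (rule koszul_nonzeroE)
    then show False
      using assms by (auto simp: supported_def koszul_basis_def dest: spec[of _ "insert a B"])
  qed
  then show ?thesis
    by (simp add: fun_eq_iff)
qed

text \<open>Coordinates are collected into polynomials, to which \<open>koszul_poly_exact\<close>
  applies. The excluded case l = 0, e = 0 is the class of 1, the only homology of the
  complex.\<close>

lemma koszul_exact:
  fixes u :: "'n::{finite,linorder} set \<times> 'n expvec \<Rightarrow> 'k::field"
  assumes u: "u \<in> supported (koszul_basis std l e)" and cyc: "koszul u = 0" and ne: "l \<noteq> 0 \<or> e \<noteq> 0"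
  obtains w where "w \<in> supported (koszul_basis full (Suc l) (e - 1))" "koszul w = u"
proof -
  obtain U where U: "\<And>A \<beta>. Poly_Mapping.lookup (U A) \<beta> = u (A, \<beta>)"
    using supported_polys[OF u] by blast
  have nz: "\<exists>\<beta>. u (A, \<beta>) \<noteq> 0" if "U A \<noteq> 0" for A
    using that by (metis U lookup_zero poly_mapping_eqI)
  have 1: "card A = l" if "U A \<noteq> 0" for A
    using nz[OF that] u by (auto simp: supported_def koszul_basis_def)
  have 2: "homogeneous (int l + e - int l) (U A)" for A
    using u by (auto simp: homogeneous_iff U supported_def koszul_basis_def)
  have 3: "koszul_poly U = 0"
  proof (intro ext poly_mapping_eqI)
    fix B \<gamma>
    show "Poly_Mapping.lookup (koszul_poly U B) \<gamma> = Poly_Mapping.lookup (0 B) \<gamma>"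
      using cyc koszul_eq_lookup[of U u B \<gamma>, OF U] by simp
  qed
  have 4: "const_coeff (U {}) = 0" if "l = 0"
  proof -
    have "({}, 0) \<notin> koszul_basis std l e"
      using ne that by (auto simp: koszul_basis_def mdeg_def)
    then show ?thesis
      using u by (auto simp: const_coeff_def U supported_def)
  qed
  obtain w where w: "koszul_poly w = U" "\<And>A. w A \<noteq> 0 \<Longrightarrow> card A = Suc l"
    "\<And>A. homogeneous (int l + e - int (Suc l)) (w A)"
    using koszul_poly_exact[of U l "int l + e"] 1 2 3 4 by metis
  let ?w = "\<lambda>(A, \<beta>). Poly_Mapping.lookup (w A) \<beta>"
  show thesis
  proof (rule that[of ?w])
    show "?w \<in> supported (koszul_basis full (Suc l) (e - 1))"
    proof -
      have "card A = Suc l \<and> int (mdeg \<beta>) = e - 1" if "Poly_Mapping.lookup (w A) \<beta> \<noteq> 0" for A \<beta>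
      proof
        show "card A = Suc l"
          using that by (intro w(2)) auto
        show "int (mdeg \<beta>) = e - 1"
          using that w(3)[of A] by (simp add: homogeneous_iff)
      qed
      then show ?thesis
        by (auto simp: supported_def koszul_basis_def)
    qed
    show "koszul ?w = u"
    proof
      fix x :: "'n set \<times> 'n expvec"
      show "koszul ?w x = u x"
        by (cases x) (simp add: w(1) U flip: lookup_koszul_poly)
    qed
  qed
qed

lemma koszul_kernel:
  assumes "l \<noteq> 0 \<or> e \<noteq> 0"
  shows "{u \<in> supported (koszul_basis full l e). koszul u = 0} =
    (koszul ` supported (koszul_basis full (Suc l) (e - 1)) :: ('n::{finite,linorder} set \<times> 'n expvec \<Rightarrow> 'k::field) set)"
proof (intro equalityI subsetI)
  fix u :: "('n, 'k) kchain"
  assume "u \<in> {u \<in> supported (koszul_basis full l e). koszul u = 0}"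
  then have u: "u \<in> supported (koszul_basis full l e)" "koszul u = 0"
    by auto
  obtain w where "w \<in> supported (koszul_basis full (Suc l) (e - 1))" "koszul w = u"
    by (rule koszul_exact[OF u assms])
  then show "u \<in> koszul ` supported (koszul_basis full (Suc l) (e - 1))"
    by blast
next
  fix u :: "('n, 'k) kchain"
  assume "u \<in> koszul ` supported (koszul_basis full (Suc l) (e - 1))"
  then obtain w where w: "w \<in> supported (koszul_basis full (Suc l) (e - 1))" "u = koszul w"
    by auto
  then show "u \<in> {u \<in> supported (koszul_basis full l e). koszul u = 0}"
    using koszul_supported[OF w(1)] koszul_koszul[OF w(1)] by simp
qed

lemma linear_koszul: "Vector_Spaces.linear fscale fscale koszul"
  by (rule linear_funI) (simp_all add: koszul_add koszul_scale)

section \<open>Ranks of the Koszul differential\<close>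

lemma card_mdeg:
  "card {\<beta> :: 'n::finite expvec. mdeg \<beta> = e} = (CARD('n) + e - 1) choose e"
proof -
  obtain xs :: "'n list" where xs: "set xs = UNIV" "distinct xs"
    using finite_distinct_list[OF finite[of "UNIV :: 'n set"]] by blast
  have len: "length xs = CARD('n)"
    using xs distinct_card by metis
  have "bij_betw (\<lambda>\<beta>. map (Poly_Mapping.lookup \<beta>) xs) {\<beta> :: 'n expvec. mdeg \<beta> = e}
    {l. length l = CARD('n) \<and> sum_list l = e}"
  proof (rule bij_betwI')
    fix \<beta> \<gamma> :: "'n expvec"
    show "map (Poly_Mapping.lookup \<beta>) xs = map (Poly_Mapping.lookup \<gamma>) xs \<longleftrightarrow> \<beta> = \<gamma>"
      using xs(1) by (auto intro: poly_mapping_eqI)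
  next
    fix \<beta> :: "'n expvec" assume "\<beta> \<in> {\<beta>. mdeg \<beta> = e}"
    then show "map (Poly_Mapping.lookup \<beta>) xs \<in> {l. length l = CARD('n) \<and> sum_list l = e}"
      using sum.distinct_set_conv_list[OF xs(2), of "Poly_Mapping.lookup \<beta>"] by (simp add: len mdeg_def xs(1))
  next
    fix l assume l: "l \<in> {l. length l = CARD('n) \<and> sum_list l = e}"
    define \<beta> :: "'n expvec" where "\<beta> = Abs_poly_mapping (\<lambda>i. the (map_of (zip xs l) i))"
    have "map (Poly_Mapping.lookup \<beta>) xs = l"
      using l len xs by (intro nth_equalityI) (simp_all add: \<beta>_def map_of_zip_nth)
    moreover from this have "mdeg \<beta> = e"
      using sum.distinct_set_conv_list[OF xs(2), of "Poly_Mapping.lookup \<beta>"] l by (simp add: mdeg_def xs(1))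
    ultimately show "\<exists>\<beta>\<in>{\<beta>. mdeg \<beta> = e}. l = map (Poly_Mapping.lookup \<beta>) xs"
      by (intro bexI[of _ \<beta>]) auto
  qed
  then have "card {\<beta> :: 'n expvec. mdeg \<beta> = e} = card {l :: nat list. length l = CARD('n) \<and> sum_list l = e}"
    by (rule bij_betw_same_card)
  then show ?thesis
    by (simp add: card_length_sum_list add.commute)
qed

lemma card_koszul_basis_full:
  "card (koszul_basis full l (int e) :: ('n::finite set \<times> 'n expvec) set) =
    (CARD('n) choose l) * ((CARD('n) + e - 1) choose e)"
proof -
  have "koszul_basis full l (int e) = {A :: 'n set. A \<subseteq> UNIV \<and> card A = l} \<times> {\<beta> :: 'n expvec. mdeg \<beta> = e}"
    by (auto simp: koszul_basis_def)
  then show ?thesis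
    using n_subsets[of "UNIV :: 'n set" l] by (simp add: card_cartesian_product card_mdeg)
qed

text \<open>Rank-nullity for \<open>\<kappa>\<close> on \<open>\<And>\<^sup>m\<^sup>+\<^sup>1 F \<otimes> S\<^sub>e\<^sub>+\<^sub>1 F\<close>.\<close>

lemma hook_binomial:
  assumes "n \<ge> 1"
  shows "(n choose Suc m) * ((n + e) choose Suc e) =
    ((n + e) choose (m + e + 2)) * ((m + e + 1) choose (m + 1)) + ((n + e + 1) choose (m + e + 2)) * ((m + e + 1) choose m)"
proof -
  consider "n < Suc m" | "n = Suc m" | "m + 2 \<le> n"
    by linarith
  then show ?thesis
  proof cases
    case 1
    then show ?thesis by (simp add: binomial_eq_0)
  next
    case 2
    have "(m + e + 1) choose Suc e = (m + e + 1) choose m"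
      using binomial_symmetric[of m "m + e + 1"] by (simp add: Suc_eq_plus1)
    moreover have e: "n + e = m + e + 1" "n + e + 1 = m + e + 2"
      using 2 by simp_all
    have "(n + e + 1) choose (m + e + 2) = 1" "(n + e) choose (m + e + 2) = 0" "n choose Suc m = 1"
      unfolding e(2) by (simp_all add: 2 binomial_eq_0)
    ultimately show ?thesis
      unfolding e(1)[symmetric] by (metis add_0 mult_0 mult_1)
  next
    case 3
    \<comment> \<open>With n = m + k + 2 every binomial becomes a quotient of factorials without
      truncated subtraction, and the identity becomes rational arithmetic.\<close>
    then obtain k where n: "n = m + k + 2"
      using le_Suc_ex[OF 3] by auto
    define F where "F k = (fact k :: real)" for k :: nat
    have F: "F k \<noteq> 0" "F (Suc k) = real (Suc k) * F k" for k
      by (simp_all add: F_def)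
    have b: "real (a choose c) = F a / (F c * F b)" if "a = b + c" for a b c
      using that by (simp add: F_def binomial_fact)
    have c1: "real (n choose Suc m) = real (m + k + 2) * F (m + k + 1) / (real (m + 1) * F m * (real (k + 1) * F k))"
      using b[of n "Suc k" "Suc m"] F(2)[of m] F(2)[of k] F(2)[of "m + k + 1"] n by (simp add: One_nat_def del: binomial_Suc_Suc)
    have c2: "real ((n + e) choose Suc e) = F (n + e) / (real (e + 1) * F e * F (m + k + 1))"
      using b[of "n + e" "m + k + 1" "Suc e"] F(2)[of e] n by (simp add: One_nat_def del: binomial_Suc_Suc)
    have c3: "real ((n + e) choose (m + e + 2)) = F (n + e) / (real (m + e + 2) * F (m + e + 1) * F k)"
      using b[of "n + e" k "m + e + 2"] F(2)[of "m + e + 1"] n by (simp add: One_nat_def del: binomial_Suc_Suc)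
    have c4: "real ((m + e + 1) choose (m + 1)) = F (m + e + 1) / (real (m + 1) * F m * F e)"
      using b[of "m + e + 1" e "m + 1"] F(2)[of m] by (simp add: One_nat_def del: binomial_Suc_Suc)
    have c5: "real ((n + e + 1) choose (m + e + 2)) =
        real (m + k + e + 3) * F (n + e) / (real (m + e + 2) * F (m + e + 1) * (real (k + 1) * F k))"
      using b[of "n + e + 1" "Suc k" "m + e + 2"] F(2)[of "m + e + 1"] F(2)[of k] F(2)[of "n + e"] n by (simp add: One_nat_def del: binomial_Suc_Suc)
    have c6: "real ((m + e + 1) choose m) = F (m + e + 1) / (F m * (real (e + 1) * F e))"
      using b[of "m + e + 1" "Suc e" m] F(2)[of e] by (simp add: One_nat_def del: binomial_Suc_Suc)
    have "real (m + 1) \<noteq> 0" "real (k + 1) \<noteq> 0" "real (e + 1) \<noteq> 0" "real (m + e + 2) \<noteq> 0"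
      by simp_all
    then have "real (m + k + 2) * F (m + k + 1) / (real (m + 1) * F m * (real (k + 1) * F k)) *
        (F (n + e) / (real (e + 1) * F e * F (m + k + 1))) =
      F (n + e) / (real (m + e + 2) * F (m + e + 1) * F k) * (F (m + e + 1) / (real (m + 1) * F m * F e)) +
      real (m + k + e + 3) * F (n + e) / (real (m + e + 2) * F (m + e + 1) * (real (k + 1) * F k)) *
        (F (m + e + 1) / (F m * (real (e + 1) * F e)))"
      using F(1) by (simp add: divide_simps) (simp add: algebra_simps)
    then have "real ((n choose Suc m) * ((n + e) choose Suc e)) =
      real (((n + e) choose (m + e + 2)) * ((m + e + 1) choose (m + 1)) + ((n + e + 1) choose (m + e + 2)) * ((m + e + 1) choose m))"
      unfolding of_nat_add of_nat_mult c1[unfolded of_nat_add] c2[unfolded of_nat_add] c3[unfolded of_nat_add]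
        c4[unfolded of_nat_add] c5[unfolded of_nat_add] c6[unfolded of_nat_add] .
    then show ?thesis
      by (simp only: of_nat_eq_iff)
  qed
qed

text \<open>Induction on the polynomial degree: for l >= 1 the kernel in degree e + 1 is the image
  from exterior degree l + 1 and degree e, so rank-nullity gives a recursion, solved by
  \<open>hook_binomial\<close>. In degree 0 the kernel is 0.\<close>

lemma kdim_koszul_image:
  assumes "l \<ge> 1"
  shows "kdim (koszul ` (supported (koszul_basis full l (int e)) :: ('n::{finite,linorder} set \<times> 'n expvec \<Rightarrow> 'k::field) set)) =
    ((CARD('n) + e) choose (l + e)) * ((l + e - 1) choose (l - 1))"
  using assms
proof (induction e arbitrary: l)
  case (0 l)
  have k: "kdim (supported (koszul_basis full l 0) :: ('n, 'k) kchain set) =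
    kdim {u \<in> supported (koszul_basis full l 0) :: ('n, 'k) kchain set. koszul u = 0} +
    kdim (koszul ` (supported (koszul_basis full l 0) :: ('n, 'k) kchain set))"
    by (rule kdim_rank_nullity[OF linear_koszul subspace_supported finite_koszul_basis order.refl])
  have "koszul_basis full (Suc l) (0 - 1) = ({} :: ('n set \<times> 'n expvec) set)"
    by (auto simp: koszul_basis_def)
  then have "{u \<in> supported (koszul_basis full l 0) :: ('n, 'k) kchain set. koszul u = 0} = koszul ` supported {}"
    using koszul_kernel[of l 0, where 'n='n and 'k='k] 0 by simp
  also have "\<dots> = {0}"
    by (simp add: supported_empty koszul_zero)
  finally show ?case
    using k card_koszul_basis_full[of l 0, where 'n='n] 0
    by (simp add: kdim_zero kdim_supported[OF finite_koszul_basis])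
next
  case (Suc e l)
  obtain m where m: "l = Suc m"
    using Suc.prems by (cases l) auto
  have "kdim (supported (koszul_basis full l (int (Suc e))) :: ('n, 'k) kchain set) =
    kdim {u \<in> supported (koszul_basis full l (int (Suc e))) :: ('n, 'k) kchain set. koszul u = 0} +
    kdim (koszul ` (supported (koszul_basis full l (int (Suc e))) :: ('n, 'k) kchain set))"
    by (rule kdim_rank_nullity[OF linear_koszul subspace_supported finite_koszul_basis order.refl])
  moreover have "{u \<in> supported (koszul_basis full l (int (Suc e))) :: ('n, 'k) kchain set. koszul u = 0} =
      koszul ` supported (koszul_basis full (Suc l) (int e))"
    using koszul_kernel[of l "int (Suc e)", where 'n='n and 'k='k] by simp
  ultimately have "(CARD('n) choose Suc m) * ((CARD('n) + e) choose Suc e) =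
      ((CARD('n) + e) choose (m + e + 2)) * ((m + e + 1) choose (m + 1)) +
      kdim (koszul ` (supported (koszul_basis full l (int (Suc e))) :: ('n, 'k) kchain set))"
    using Suc.IH[of "Suc l"] card_koszul_basis_full[of l "Suc e", where 'n='n]
    by (simp add: kdim_supported[OF finite_koszul_basis] m One_nat_def)
  moreover have "CARD('n) \<ge> 1"
    by (simp add: Suc_leI One_nat_def)
  ultimately have "kdim (koszul ` (supported (koszul_basis full l (int (Suc e))) :: ('n, 'k) kchain set)) =
      ((CARD('n) + e + 1) choose (m + e + 2)) * ((m + e + 1) choose m)"
    using hook_binomial[of "CARD('n)" m e] by linarith
  then show ?case
    by (simp add: m One_nat_def del: binomial_Suc_Suc)
qed

lemma kdim_mono:
  fixes V W :: "('b \<Rightarrow> 'k::field) set"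
  assumes "V \<subseteq> W" "W \<subseteq> supported B" "finite B"
  shows "kdim V \<le> kdim W"
proof -
  obtain X where X: "X \<subseteq> V" "fun_space.independent X" "V \<subseteq> fun_space.span X" "card X = fun_space.dim V"
    by (rule fun_space.basis_exists)
  obtain Y where Y: "Y \<subseteq> W" "fun_space.independent Y" "W \<subseteq> fun_space.span Y" "card Y = fun_space.dim W"
    by (rule fun_space.basis_exists)
  have "Y \<subseteq> fun_space.span (unit_fun ` B)"
    using Y(1) assms(2) supported_subset_span[OF assms(3)] by blast
  then have "finite Y"
    using fun_space.independent_span_bound[OF _ Y(2)] assms(3) by blast
  moreover have "X \<subseteq> fun_space.span Y"
    using X(1) Y(3) assms(1) by blast
  ultimately show ?thesis
    using fun_space.independent_span_bound[OF _ X(2), of Y] X(4) Y(4) by (simp add: kdim_def)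
qed

text \<open>The projection from Koszul chains over R to those over the quotient, in monomial
  coordinates.\<close>

definition restr :: "('n expvec \<Rightarrow> bool) \<Rightarrow> ('n set \<times> 'n expvec \<Rightarrow> 'k::zero) \<Rightarrow> ('n, 'k) kchain" where
  "restr std u = (\<lambda>(A, \<beta>). if std \<beta> then u (A, \<beta>) else 0)"

lemma koszul_mod_eq_restr: "koszul_mod std u = restr std (koszul u)"
  by (simp add: koszul_mod_def restr_def)

lemma restr_supported: "restr std ` supported (koszul_basis full l e) = supported (koszul_basis std l e)"
proof (intro equalityI subsetI)
  fix u assume "u \<in> restr std ` supported (koszul_basis full l e)"
  then show "u \<in> supported (koszul_basis std l e)"
    by (auto simp: restr_def supported_def koszul_basis_def split: if_splits)
next
  fix u :: "'a set \<times> 'a expvec \<Rightarrow> 'b" assume u: "u \<in> supported (koszul_basis std l e)"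
  then have "restr std u = u"
    by (auto simp: restr_def supported_def koszul_basis_def fun_eq_iff)
  moreover have "u \<in> supported (koszul_basis full l e)"
    using u by (auto simp: supported_def koszul_basis_def)
  ultimately show "u \<in> restr std ` supported (koszul_basis full l e)"
    by (metis imageI)
qed

lemma diff_pdvd: "\<gamma> - \<beta> pdvd \<gamma>"
  by (simp add: pdvd_def lookup_minus)

text \<open>The chains on monomials violating \<open>std\<close> form a subcomplex, because
  \<open>std\<close> is closed under divisors.\<close>

lemma koszul_mod_restr:
  assumes "\<And>\<beta> \<gamma>. std \<gamma> \<Longrightarrow> \<beta> pdvd \<gamma> \<Longrightarrow> std \<beta>"
  shows "koszul_mod std (restr std u) = koszul_mod std u"
proof -
  have "koszul (restr std u) (B, \<gamma>) = koszul u (B, \<gamma>)" if g: "std \<gamma>" for B \<gamma>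
    unfolding koszul_def restr_def prod.case
  proof (intro sum.cong refl if_cong arg_cong2[where f = "(*)"])
    fix a
    show "(if std (\<gamma> - unit_vec a) then u (insert a B, \<gamma> - unit_vec a) else 0) = u (insert a B, \<gamma> - unit_vec a)"
      using assms[OF g diff_pdvd] by simp
  qed
  then show ?thesis
    by (auto simp: koszul_mod_def fun_eq_iff)
qed

lemma pdvd_between:
  assumes "\<alpha> pdvd \<beta>" "mdeg \<alpha> \<le> m" "m \<le> mdeg \<beta>"
  shows "\<exists>\<gamma>. \<alpha> pdvd \<gamma> \<and> \<gamma> pdvd \<beta> \<and> mdeg \<gamma> = m"
  using assms(2,3)
proof (induction m rule: dec_induct)
  case base
  then show ?case
    using assms(1) pdvd_refl by blast
next
  case (step m)
  then obtain \<gamma> where \<gamma>: "\<alpha> pdvd \<gamma>" "\<gamma> pdvd \<beta>" "mdeg \<gamma> = m"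
    by auto
  then have "\<not> \<beta> pdvd \<gamma>"
    using step.prems pdvd_mdeg_le by fastforce
  then obtain i where i: "Poly_Mapping.lookup \<gamma> i < Poly_Mapping.lookup \<beta> i"
    unfolding pdvd_def by (auto simp: not_le)
  have "\<gamma> + unit_vec i pdvd \<beta>"
    using \<gamma>(2) i unfolding pdvd_def by (auto simp: lookup_add lookup_single when_def)
  moreover have "\<alpha> pdvd \<gamma> + unit_vec i"
    using \<gamma>(1) pdvd_add(2) pdvd_trans by blast
  moreover have "mdeg (\<gamma> + unit_vec i) = Suc m"
    by (simp add: mdeg_add mdeg_single \<gamma>(3))
  ultimately show ?case by blast
qed

lemma unit_vec_inject: "unit_vec a = unit_vec b \<longleftrightarrow> a = b"
  by (metis lookup_single_eq lookup_single_not_eq zero_neq_one)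

section \<open>Koszul homology of the quotient by a complementary ideal\<close>

locale separated_monomials =
  fixes S :: "'n::{finite,linorder} expvec set" and d :: nat
  assumes finite_S: "finite S" and d_pos: "d \<ge> 1"
    and deg_S: "\<alpha> \<in> S \<Longrightarrow> mdeg \<alpha> = d"
    and lcm_S: "\<alpha> \<in> S \<Longrightarrow> \<beta> \<in> S \<Longrightarrow> \<alpha> \<noteq> \<beta> \<Longrightarrow> lcm_deg \<alpha> \<beta> \<ge> d + 2"
begin

text \<open>The monomials outside K', whose generators are the monomials of degree d outside S.
  Below degree d the condition is vacuous.\<close>

definition std :: "'n expvec \<Rightarrow> bool" where
  "std \<beta> \<longleftrightarrow> (\<forall>\<delta>. mdeg \<delta> = d \<longrightarrow> \<delta> pdvd \<beta> \<longrightarrow> \<delta> \<in> S)"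

lemma std_pdvd: "std \<gamma> \<Longrightarrow> \<beta> pdvd \<gamma> \<Longrightarrow> std \<beta>"
  unfolding std_def using pdvd_trans by blast

lemma std_low: "mdeg \<beta> < d \<Longrightarrow> std \<beta>"
  unfolding std_def using pdvd_mdeg_le by fastforce

lemma std_eq: "mdeg \<beta> = d \<Longrightarrow> std \<beta> \<longleftrightarrow> \<beta> \<in> S"
  unfolding std_def using pdvd_mdeg_eq pdvd_refl by metis

text \<open>The lcm divides every common multiple, so the bound d + 2 forbids one of degree at most
  d + 1.\<close>

lemma common_multiple:
  assumes "\<alpha> \<in> S" "\<beta> \<in> S" "\<alpha> pdvd \<mu>" "\<beta> pdvd \<mu>" "mdeg \<mu> \<le> d + 1"
  shows "\<alpha> = \<beta>"
proof (rule ccontr)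
  assume "\<alpha> \<noteq> \<beta>"
  then have "d + 2 \<le> lcm_deg \<alpha> \<beta>"
    using assms lcm_S by blast
  also have "\<dots> \<le> mdeg \<mu>"
    using assms(3,4) unfolding lcm_deg_def mdeg_def pdvd_def by (intro sum_mono) auto
  finally show False
    using assms(5) by simp
qed

text \<open>The product x_a x_b x^\<gamma> is a common multiple of degree d + 1. Thus a monomial of
  degree d - 1 divides at most one member of S.\<close>

lemma common_lower:
  assumes "unit_vec a + \<gamma> \<in> S" "unit_vec b + \<gamma> \<in> S"
  shows "a = b"
proof -
  have "unit_vec a + \<gamma> = unit_vec b + \<gamma>"
  proof (rule common_multiple[OF assms])
    show "unit_vec a + \<gamma> pdvd unit_vec b + (unit_vec a + \<gamma>)"
      by (rule pdvd_add)
    show "unit_vec b + \<gamma> pdvd unit_vec b + (unit_vec a + \<gamma>)"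
      using pdvd_add(2)[of "unit_vec b + \<gamma>" "unit_vec a"] by (simp add: ac_simps)
    show "mdeg (unit_vec b + (unit_vec a + \<gamma>)) \<le> d + 1"
      using deg_S[OF assms(1)] by (simp add: mdeg_add mdeg_single)
  qed
  then show ?thesis
    by (simp add: unit_vec_inject)
qed

lemma single_of_support:
  assumes "\<And>j. j \<noteq> i \<Longrightarrow> Poly_Mapping.lookup \<beta> j = 0"
  shows "\<beta> = Poly_Mapping.single i (mdeg \<beta>)"
proof -
  have "\<beta> = Poly_Mapping.single i (Poly_Mapping.lookup \<beta> i)"
    using assms by (intro poly_mapping_eqI) (auto simp: lookup_single when_def)
  then show ?thesis
    by (metis mdeg_single)
qed

lemma std_high:
  assumes "d < mdeg \<beta>"
  shows "std \<beta> \<longleftrightarrow> (\<exists>i. \<beta> = Poly_Mapping.single i (mdeg \<beta>) \<and> Poly_Mapping.single i d \<in> S)"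
proof
  assume std: "std \<beta>"
  have "\<beta> \<noteq> 0"
    using assms by (auto simp: mdeg_def)
  then obtain i where i: "Poly_Mapping.lookup \<beta> i \<noteq> 0"
    by (metis lookup_zero poly_mapping_eqI)
  have "Poly_Mapping.lookup \<beta> j = 0" if j: "j \<noteq> i" for j
  proof (rule ccontr)
    assume nz: "Poly_Mapping.lookup \<beta> j \<noteq> 0"
    \<comment> \<open>If two variables divide x^\<beta>, take a divisor x^\<gamma> of degree d + 1
      containing both; d >= 1 leaves room for them. Dividing it by either variable gives two members
      of S with a common multiple of degree d + 1.\<close>
    have "unit_vec i + unit_vec j pdvd \<beta>"
      using i j nz unfolding pdvd_def by (auto simp: lookup_add lookup_single when_def)
    then obtain \<gamma> where \<gamma>: "unit_vec i + unit_vec j pdvd \<gamma>" "\<gamma> pdvd \<beta>" "mdeg \<gamma> = d + 1"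
      using pdvd_between[of "unit_vec i + unit_vec j" \<beta> "d + 1"] assms d_pos by (auto simp: mdeg_add mdeg_single)
    have *: "\<gamma> - unit_vec a \<in> S \<and> unit_vec a + (\<gamma> - unit_vec a) = \<gamma>" if "a = i \<or> a = j" for a
    proof -
      have a: "unit_vec a pdvd \<gamma>"
        using pdvd_trans[OF _ \<gamma>(1)] that pdvd_add[of "unit_vec i" "unit_vec j"] pdvd_add[of "unit_vec j" "unit_vec i"]
        by blast
      have "std (\<gamma> - unit_vec a)"
        by (rule std_pdvd[OF std pdvd_trans[OF diff_pdvd \<gamma>(2)]])
      moreover have "mdeg (\<gamma> - unit_vec a) = d"
        using mdeg_diff[OF a] \<gamma>(3) by (simp add: mdeg_single)
      ultimately show ?thesis
        using std_eq pdvd_diff_add[OF a] by (simp add: add.commute)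
    qed
    have "\<gamma> - unit_vec i = \<gamma> - unit_vec j"
      using *[of i] *[of j] \<gamma>(3) diff_pdvd by (intro common_multiple[of _ _ \<gamma>]) auto
    then have "unit_vec i = unit_vec j"
      using *[of i] *[of j] by (metis add_right_cancel)
    with j show False
      by (simp add: unit_vec_inject)
  qed
  then have b: "\<beta> = Poly_Mapping.single i (mdeg \<beta>)"
    by (rule single_of_support)
  moreover have "Poly_Mapping.single i d pdvd \<beta>"
    using assms by (subst b) (auto simp: pdvd_def lookup_single when_def)
  then have "Poly_Mapping.single i d \<in> S"
    using std by (simp add: std_def mdeg_single)
  ultimately show "\<exists>i. \<beta> = Poly_Mapping.single i (mdeg \<beta>) \<and> Poly_Mapping.single i d \<in> S"
    by blast
next
  assume "\<exists>i. \<beta> = Poly_Mapping.single i (mdeg \<beta>) \<and> Poly_Mapping.single i d \<in> S"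
  then obtain i where i: "\<beta> = Poly_Mapping.single i (mdeg \<beta>)" "Poly_Mapping.single i d \<in> S"
    by blast
  show "std \<beta>"
    unfolding std_def
  proof (intro allI impI)
    fix \<delta> assume \<delta>: "mdeg \<delta> = d" "\<delta> pdvd \<beta>"
    have "Poly_Mapping.lookup \<delta> j = 0" if "j \<noteq> i" for j
      using \<delta>(2) that unfolding pdvd_def by (metis i(1) le_zero_eq lookup_single_not_eq)
    then have "\<delta> = Poly_Mapping.single i d"
      using single_of_support[of i \<delta>] \<delta>(1) by simp
    with i show "\<delta> \<in> S" by simp
  qed
qed

lemma koszul_mod_restr_std: "koszul_mod std (restr std u) = koszul_mod std u"
  by (rule koszul_mod_restr) (rule std_pdvd)

text \<open>Projection and differential are compatible, so the boundaries of the quotient are the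
  projections of boundaries over R, where exactness is available.\<close>

lemma koszul_boundaries_eq:
  "koszul_boundaries std l e = restr std ` koszul ` supported (koszul_basis full (Suc l) (e - 1))"
proof -
  have "koszul_boundaries std l e = koszul_mod std ` restr std ` supported (koszul_basis full (Suc l) (e - 1))"
    by (simp only: koszul_boundaries_def restr_supported)
  also have "\<dots> = koszul_mod std ` supported (koszul_basis full (Suc l) (e - 1))"
    unfolding image_image koszul_mod_restr_std ..
  finally show ?thesis
    by (simp add: koszul_mod_eq_restr image_image)
qed

lemma boundaries_subset_cycles: "koszul_boundaries std l e \<subseteq> koszul_cycles std l e"
proof
  fix u assume "u \<in> koszul_boundaries std l e"
  then obtain w where w: "w \<in> supported (koszul_basis full (Suc l) (e - 1))" "u = restr std (koszul w)"
    unfolding koszul_boundaries_eq by auto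
  have "koszul w \<in> supported (koszul_basis full l e)"
    using koszul_supported[OF w(1)] by simp
  then have "u \<in> supported (koszul_basis std l e)"
    using w(2) restr_supported by blast
  moreover have "koszul_mod std u = koszul_mod std (koszul w)"
    unfolding w(2) by (rule koszul_mod_restr_std)
  then have "koszul_mod std u = 0"
    by (simp add: koszul_mod_eq_restr koszul_koszul[OF w(1)]) (simp add: restr_def fun_eq_iff)
  ultimately show "u \<in> koszul_cycles std l e"
    by (simp add: koszul_cycles_def)
qed

lemma cycles_subset: "koszul_cycles std l e \<subseteq> supported (koszul_basis std l e)"
  by (auto simp: koszul_cycles_def)

lemma kdim_boundaries_le:
  "kdim (koszul_boundaries std l e :: ('n set \<times> 'n expvec \<Rightarrow> 'k::field) set) \<le> kdim (koszul_cycles std l e :: ('n, 'k) kchain set)"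
  by (rule kdim_mono[OF boundaries_subset_cycles cycles_subset finite_koszul_basis])

lemma koszul_homology_zeroI:
  assumes "koszul_cycles std l e \<subseteq> (koszul_boundaries std l e :: ('n set \<times> 'n expvec \<Rightarrow> 'k::field) set)"
  shows "kdim (koszul_cycles std l e :: ('n, 'k) kchain set) - kdim (koszul_boundaries std l e :: ('n, 'k) kchain set) = 0"
  using kdim_mono[OF assms order.trans[OF boundaries_subset_cycles cycles_subset] finite_koszul_basis] by simp

text \<open>Such a chain bounds over R and is fixed by the projection. The vanishing in column 0 and
  in the rows of index below d - 1 is reduced to this.\<close>

lemma full_cycle_is_boundary:
  fixes u :: "'n set \<times> 'n expvec \<Rightarrow> 'k::field"
  assumes u: "u \<in> supported (koszul_basis std l e)" and "koszul u = 0" "l \<noteq> 0 \<or> e \<noteq> 0"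
  shows "u \<in> koszul_boundaries std l e"
proof -
  obtain w where w: "w \<in> supported (koszul_basis full (Suc l) (e - 1))" "koszul w = u"
    by (rule koszul_exact[OF assms])
  have "restr std u = u"
    using u by (auto simp: restr_def supported_def koszul_basis_def fun_eq_iff)
  with w show ?thesis
    unfolding koszul_boundaries_eq by (metis imageI)
qed

lemma koszul_homology_empty:
  assumes "e < 0 \<or> l > CARD('n)"
  shows "koszul_cycles std l e \<subseteq> (koszul_boundaries std l e :: ('n set \<times> 'n expvec \<Rightarrow> 'k::field) set)"
proof -
  have "card A \<le> CARD('n)" for A :: "'n set"
    by (rule card_mono) auto
  then have "koszul_basis std l e = {}"
    using assms by (auto simp: koszul_basis_def not_le[symmetric])
  moreover have "0 \<in> (koszul_boundaries std l e :: ('n, 'k) kchain set)"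
    unfolding koszul_boundaries_def
    by (intro image_eqI[of _ _ 0]) (auto simp: koszul_mod_eq_restr koszul_zero restr_def supported_def fun_eq_iff)
  ultimately show ?thesis
    using cycles_subset[of l e] by (auto simp: supported_empty)
qed

lemma koszul_homology_row0:
  assumes "l = 0" "e \<noteq> 0"
  shows "koszul_cycles std l e \<subseteq> (koszul_boundaries std l e :: ('n set \<times> 'n expvec \<Rightarrow> 'k::field) set)"
proof
  fix u :: "('n, 'k) kchain" assume "u \<in> koszul_cycles std l e"
  then have u: "u \<in> supported (koszul_basis std l e)"
    using cycles_subset by blast
  have "koszul u = 0"
    using u unfolding assms(1) by (rule koszul_top)
  with u show "u \<in> koszul_boundaries std l e"
    using assms(2) by (intro full_cycle_is_boundary) simp_all
qed

text \<open>Nothing is truncated in degree e + 1 < d, so a cycle of the quotient is already a cycle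
  over R.\<close>

lemma koszul_homology_low:
  assumes "l \<ge> 1" "e + 1 < int d"
  shows "koszul_cycles std l e \<subseteq> (koszul_boundaries std l e :: ('n set \<times> 'n expvec \<Rightarrow> 'k::field) set)"
proof
  fix u :: "('n, 'k) kchain" assume "u \<in> koszul_cycles std l e"
  then have u: "u \<in> supported (koszul_basis std l e)" and cyc: "koszul_mod std u = 0"
    by (auto simp: koszul_cycles_def)
  obtain m where m: "l = Suc m"
    using assms(1) by (cases l) auto
  have "u \<in> supported (koszul_basis full (Suc m) e)"
    using u m by (auto simp: supported_def koszul_basis_def)
  then have s: "koszul u \<in> supported (koszul_basis full m (e + 1))"
    by (rule koszul_supported)
  have "koszul u (B, \<gamma>) = 0" for B \<gamma>
  proof (rule ccontr)
    assume nz: "koszul u (B, \<gamma>) \<noteq> 0"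
    then have "int (mdeg \<gamma>) = e + 1"
      using s by (auto simp: supported_def koszul_basis_def)
    then have "std \<gamma>"
      using assms(2) by (intro std_low) simp
    then show False
      using nz fun_cong[OF cyc, of "(B, \<gamma>)"] by (simp add: koszul_mod_def)
  qed
  then have "koszul u = 0"
    by (simp add: fun_eq_iff)
  then show "u \<in> koszul_boundaries std l e"
    using full_cycle_is_boundary[OF u] assms(1) by auto
qed

text \<open>Above degree \<open>d\<close> the quotient is spanned by the pure powers \<open>x_i\<^sup>e\<close> with \<open>d \<epsilon>\<^sub>i \<in> S\<close>.\<close>

lemma koszul_pure_power:
  assumes "e \<ge> 1" "i \<notin> B"
  shows "koszul u (B, Poly_Mapping.single i e) = sg i B * u (insert i B, Poly_Mapping.single i (e - 1))"
proof -
  have p: "unit_vec a pdvd Poly_Mapping.single i e \<longleftrightarrow> a = i" for a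
    using assms(1) by (auto simp: unit_vec_pdvd lookup_single when_def)
  have "Poly_Mapping.single i e - unit_vec i = Poly_Mapping.single i (e - 1)"
    by (simp add: single_diff)
  then have "koszul u (B, Poly_Mapping.single i e) = (\<Sum>a\<in>UNIV - B. if a = i then sg i B * u (insert i B, Poly_Mapping.single i (e - 1)) else 0)"
    unfolding koszul_def prod.case p by (intro sum.cong) auto
  then show ?thesis
    using assms(2) by simp
qed

lemma koszul_pure_power_mem:
  assumes "i \<in> B"
  shows "koszul u (B, Poly_Mapping.single i e) = 0"
proof -
  have "\<not> unit_vec a pdvd Poly_Mapping.single i e" if "a \<notin> B" for a
    using assms that by (auto simp: unit_vec_pdvd lookup_single when_def)
  then show ?thesis
    unfolding koszul_def prod.case by (intro sum.neutral) auto
qed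

text \<open>Only x_i divides x_i^(e+1), so the coefficient of the boundary at x_i^(e+1) and
  \<open>A - {i}\<close> consists, up to sign, of this one coordinate of \<open>u\<close>; and
  x_i^(e+1) survives in the quotient.\<close>

lemma cycle_pure_power:
  assumes "u \<in> koszul_cycles std l (int e)" "e \<ge> d" "Poly_Mapping.single i d \<in> S" "i \<in> A"
  shows "u (A, Poly_Mapping.single i e) = 0"
proof -
  have "std (Poly_Mapping.single i (e + 1))"
    using assms(2,3) by (subst std_high) (auto simp: mdeg_single)
  then have "koszul u (A - {i}, Poly_Mapping.single i (e + 1)) = 0"
    using assms(1) by (auto simp: koszul_cycles_def koszul_mod_def fun_eq_iff split: if_splits)
  moreover have "koszul u (A - {i}, Poly_Mapping.single i (e + 1)) = sg i (A - {i}) * u (insert i (A - {i}), Poly_Mapping.single i (e + 1 - 1))"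
    by (rule koszul_pure_power) auto
  ultimately have "sg i (A - {i}) * u (A, Poly_Mapping.single i e) = 0"
    using assms(4) by (simp add: insert_absorb)
  then have "sg i (A - {i}) * (sg i (A - {i}) * u (A, Poly_Mapping.single i e)) = 0"
    by simp
  then show ?thesis
    by (simp only: mult.assoc[symmetric] sg_square) simp
qed

lemma koszul_homology_high:
  assumes "e > int d"
  shows "koszul_cycles std l e \<subseteq> (koszul_boundaries std l e :: ('n set \<times> 'n expvec \<Rightarrow> 'k::field) set)"
proof
  fix u :: "('n, 'k) kchain" assume u: "u \<in> koszul_cycles std l e"
  obtain f where f: "e = int f" "f > d"
    using assms by (metis nat_0_le of_nat_0_le_iff of_nat_less_iff order.strict_trans1 order_less_imp_le)
  \<comment> \<open>A contracting homotopy: wedge with e_i and lower x_i^f to x_i^(f-1). As f > d >=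
    1, the lowered power still has a positive exponent and determines i.\<close>
  define w where "w = (\<lambda>(A, \<beta>). \<Sum>i\<in>A. if \<beta> = Poly_Mapping.single i (f - 1) \<and> Poly_Mapping.single i d \<in> S
      then sg i (A - {i}) * u (A - {i}, Poly_Mapping.single i f) else 0)"
  have inj: "Poly_Mapping.single a m = Poly_Mapping.single b m \<longleftrightarrow> a = b" if "m \<ge> 1" for a b :: 'n and m :: nat
    using that by (metis lookup_single_eq lookup_single_not_eq not_one_le_zero)
  have us: "u \<in> supported (koszul_basis std l e)"
    using u cycles_subset by blast
  have "w \<in> supported (koszul_basis std (Suc l) (e - 1))"
    unfolding supported_def
  proof safe
    fix A \<beta> assume "w (A, \<beta>) \<noteq> 0"
    then obtain i where "i \<in> A" "(if \<beta> = Poly_Mapping.single i (f - 1) \<and> Poly_Mapping.single i d \<in> S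
      then sg i (A - {i}) * u (A - {i}, Poly_Mapping.single i f) else 0) \<noteq> 0"
      unfolding w_def prod.case by (rule sum.not_neutral_contains_not_neutral)
    then have i: "i \<in> A" "\<beta> = Poly_Mapping.single i (f - 1)" "Poly_Mapping.single i d \<in> S"
        "u (A - {i}, Poly_Mapping.single i f) \<noteq> 0"
      by (auto split: if_splits)
    then have *: "card (A - {i}) = l" "std (Poly_Mapping.single i f)"
      using us by (auto simp: supported_def koszul_basis_def)
    have "Poly_Mapping.single i (f - 1) pdvd Poly_Mapping.single i f"
      by (auto simp: pdvd_def lookup_single when_def)
    with * i f show "(A, \<beta>) \<in> koszul_basis std (Suc l) (e - 1)"
      using std_pdvd card_Suc_Diff1[of A i] by (auto simp: koszul_basis_def mdeg_single)
  qed
  moreover have "koszul_mod std w (B, \<gamma>) = u (B, \<gamma>)" for B \<gamma>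
  proof (cases "std \<gamma> \<and> mdeg \<gamma> = f")
    case False
    have "u (B, \<gamma>) = 0"
      using us False f by (auto simp: supported_def koszul_basis_def)
    moreover have "koszul w (B, \<gamma>) = 0" if "mdeg \<gamma> \<noteq> f"
    proof (rule ccontr)
      assume "koszul w (B, \<gamma>) \<noteq> 0"
      moreover have "w \<in> supported (koszul_basis full (Suc l) (e - 1))"
        using \<open>w \<in> supported (koszul_basis std (Suc l) (e - 1))\<close> by (auto simp: supported_def koszul_basis_def)
      ultimately have "(B, \<gamma>) \<in> koszul_basis full l e"
        using koszul_supported[of w l "e - 1"] by (auto simp: supported_def)
      then show False
        using that f by (simp add: koszul_basis_def)
    qed
    ultimately show ?thesis
      using False by (auto simp: koszul_mod_def)
  next
    case True
    then obtain i where i: "\<gamma> = Poly_Mapping.single i f" "Poly_Mapping.single i d \<in> S"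
      using std_high[of \<gamma>] f by auto
    show ?thesis
    proof (cases "i \<in> B")
      case True
      then show ?thesis
        using cycle_pure_power[of u l f i B] u i f koszul_pure_power_mem[OF True, of w f] by (simp add: koszul_mod_def)
    next
      case False
      have "w (insert i B, Poly_Mapping.single i (f - 1)) =
        (\<Sum>a\<in>insert i B. if a = i then sg i B * u (B, Poly_Mapping.single i f) else 0)"
        unfolding w_def prod.case using False f d_pos i(2) by (intro sum.cong) (auto simp: inj)
      also have "\<dots> = sg i B * u (B, Poly_Mapping.single i f)"
        by simp
      finally have "koszul w (B, \<gamma>) = sg i B * (sg i B * u (B, \<gamma>))"
        using koszul_pure_power[OF _ False, of f w] f d_pos i(1) by simp
      then have "koszul w (B, \<gamma>) = u (B, \<gamma>)"
        by (simp only: mult.assoc[symmetric] sg_square) simp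
      then show ?thesis
        using \<open>std \<gamma> \<and> mdeg \<gamma> = f\<close> by (simp add: koszul_mod_def)
    qed
  qed
  then have "u = koszul_mod std w"
    by (simp add: fun_eq_iff)
  ultimately show "u \<in> koszul_boundaries std l e"
    unfolding koszul_boundaries_def by blast
qed

text \<open>A product of x^\<alpha> with a variable survives in the quotient only if it is x_i^d
  times x_i. So e_A \<otimes> x^\<alpha> is a cycle except when x^\<alpha> = x_i^d and i lies in A;
  this is the origin of U_s.\<close>

lemma cycles_degree_d:
  "koszul_cycles std l (int d) = (supported {(A, \<alpha>). \<alpha> \<in> S \<and> A \<in> ext_basis (I_set d \<alpha>) l} :: ('n set \<times> 'n expvec \<Rightarrow> 'k::field) set)"
proof (intro equalityI subsetI)
  fix u :: "('n, 'k) kchain" assume u: "u \<in> koszul_cycles std l (int d)"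
  show "u \<in> supported {(A, \<alpha>). \<alpha> \<in> S \<and> A \<in> ext_basis (I_set d \<alpha>) l}"
    unfolding supported_def
  proof safe
    fix A \<alpha> assume nz: "u (A, \<alpha>) \<noteq> 0"
    then have A: "card A = l" "mdeg \<alpha> = d" "std \<alpha>"
      using u cycles_subset[of l "int d"] by (auto simp: supported_def koszul_basis_def)
    then show "\<alpha> \<in> S"
      using std_eq by simp
    then have "i \<notin> A" if "\<alpha> = Poly_Mapping.single i d" for i
      using cycle_pure_power[OF u, of i A] nz that by auto
    then show "A \<in> ext_basis (I_set d \<alpha>) l"
      using A by (auto simp: ext_basis_def I_set_def)
  qed
next
  fix u :: "('n, 'k) kchain"
  assume u: "u \<in> supported {(A, \<alpha>). \<alpha> \<in> S \<and> A \<in> ext_basis (I_set d \<alpha>) l}"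
  have us: "u \<in> supported (koszul_basis std l (int d))"
    using u deg_S std_eq by (auto simp: supported_def koszul_basis_def ext_basis_def)
  have "koszul_mod std u (B, \<gamma>) = 0" for B \<gamma>
  proof (rule ccontr)
    assume nz: "koszul_mod std u (B, \<gamma>) \<noteq> 0"
    then have g: "std \<gamma>" "koszul u (B, \<gamma>) \<noteq> 0"
      by (auto simp: koszul_mod_def split: if_splits)
    obtain a where a: "a \<notin> B" "unit_vec a pdvd \<gamma>" "u (insert a B, \<gamma> - unit_vec a) \<noteq> 0"
      using g(2) by (rule koszul_nonzeroE)
    then have "\<gamma> - unit_vec a \<in> S" and I: "insert a B \<in> ext_basis (I_set d (\<gamma> - unit_vec a)) l"
      using u by (auto simp: supported_def)
    then have "mdeg \<gamma> = d + 1"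
      using deg_S mdeg_diff[OF a(2)] by (simp add: mdeg_single)
    then obtain i where i: "\<gamma> = Poly_Mapping.single i (d + 1)"
      using g(1) std_high[of \<gamma>] by auto
    with a(2) have "a = i"
      by (auto simp: unit_vec_pdvd lookup_single when_def split: if_splits)
    then have "\<gamma> - unit_vec a = Poly_Mapping.single a d"
      unfolding i by (simp add: single_diff[symmetric])
    with I show False
      by (simp add: ext_basis_def I_set_def)
  qed
  then have "koszul_mod std u = 0"
    by (simp add: fun_eq_iff)
  with us show "u \<in> koszul_cycles std l (int d)"
    by (simp add: koszul_cycles_def)
qed

lemma kdim_cycles_degree_d:
  "kdim (koszul_cycles std l (int d) :: ('n set \<times> 'n expvec \<Rightarrow> 'k::field) set) = (\<Sum>\<alpha>\<in>S. ext_rank (I_set d \<alpha>) l)"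
proof -
  let ?B = "\<lambda>\<alpha>. ext_basis (I_set d \<alpha>) l"
  have fin: "finite (SIGMA \<alpha>:S. ?B \<alpha>)"
    using finite_S by (intro finite_SigmaI) auto
  have eq: "{(A, \<alpha>). \<alpha> \<in> S \<and> A \<in> ?B \<alpha>} = prod.swap ` (SIGMA \<alpha>:S. ?B \<alpha>)"
    by (auto simp: image_iff)
  have "card (prod.swap ` (SIGMA \<alpha>:S. ?B \<alpha>)) = card (SIGMA \<alpha>:S. ?B \<alpha>)"
    by (rule card_image) (auto simp: inj_on_def)
  also have "\<dots> = (\<Sum>\<alpha>\<in>S. card (?B \<alpha>))"
    using finite_S by (intro card_SigmaI) auto
  finally show ?thesis
    unfolding cycles_degree_d eq using fin by (simp add: kdim_supported ext_rank_def)
qed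

text \<open>In degree d - 1 the chains are those over R. The cycles are the kernel of the truncated
  differential, whose image is the boundaries in row d and exterior degree l - 1; the boundaries are
  the kernel of the full differential. Both kernels lie in the same space, so the homology is the
  difference of the two ranks.\<close>

lemma int_homology_low_row:
  assumes "l \<ge> 1"
  shows "int (kdim (koszul_cycles std l (int d - 1) :: ('n set \<times> 'n expvec \<Rightarrow> 'k::field) set) -
      kdim (koszul_boundaries std l (int d - 1) :: ('n, 'k) kchain set)) =
    int (((CARD('n) + d - 1) choose (l + d - 1)) * ((d + l - 2) choose (l - 1))) -
    int (kdim (koszul_boundaries std (l - 1) (int d) :: ('n, 'k) kchain set))"
proof -
  let ?W = "supported (koszul_basis full l (int d - 1)) :: ('n, 'k) kchain set"
  obtain c where c: "d = Suc c"
    using d_pos by (cases d) auto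
  have b: "koszul_basis std l (int d - 1) = koszul_basis full l (int d - 1)"
    using std_low c by (auto simp: koszul_basis_def)
  have "kdim ?W = kdim (koszul_cycles std l (int d - 1) :: ('n, 'k) kchain set) + kdim (koszul_mod std ` ?W)"
    unfolding koszul_cycles_def b
    by (rule kdim_rank_nullity[OF linear_koszul_mod subspace_supported finite_koszul_basis order.refl])
  moreover have "koszul_mod std ` ?W = koszul_boundaries std (l - 1) (int d)"
    using assms by (simp add: koszul_boundaries_def b)
  moreover have "kdim ?W = kdim {u \<in> ?W. koszul u = 0} + kdim (koszul ` ?W)"
    by (rule kdim_rank_nullity[OF linear_koszul subspace_supported finite_koszul_basis order.refl])
  moreover have "koszul_boundaries std l (int d - 1) = {u \<in> ?W. koszul u = 0}"
  proof -
    have "restr std u = u" if "u \<in> ?W" for u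
      using that unfolding b[symmetric] by (auto simp: restr_def supported_def koszul_basis_def fun_eq_iff)
    then have "restr std ` {u \<in> ?W. koszul u = 0} = {u \<in> ?W. koszul u = 0}"
      by (auto simp: image_iff)
    moreover have "{u \<in> ?W. koszul u = 0} = koszul ` supported (koszul_basis full (Suc l) (int d - 1 - 1))"
      using assms by (intro koszul_kernel) auto
    ultimately show ?thesis
      unfolding koszul_boundaries_eq by simp
  qed
  moreover have "kdim (koszul ` ?W) = ((CARD('n) + d - 1) choose (l + d - 1)) * ((d + l - 2) choose (l - 1))"
    using kdim_koszul_image[OF assms, of c, where 'n='n and 'k='k] c assms
    by (simp add: One_nat_def add.commute)
  ultimately have "kdim (koszul_boundaries std l (int d - 1) :: ('n, 'k) kchain set) +
      ((CARD('n) + d - 1) choose (l + d - 1)) * ((d + l - 2) choose (l - 1)) =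
    kdim (koszul_cycles std l (int d - 1) :: ('n, 'k) kchain set) +
      kdim (koszul_boundaries std (l - 1) (int d) :: ('n, 'k) kchain set)"
    by simp
  then show ?thesis
    unfolding of_nat_diff[OF kdim_boundaries_le] by linarith
qed

end

section \<open>The maps \<kappa> and \<phi> in Koszul coordinates\<close>

lemma kappa_eq_sum:
  fixes v :: "'n::{finite,linorder} set \<times> 'n expvec \<Rightarrow> ('n, 'k::field) polyring"
  assumes v: "v \<in> ext_sym l d"
  shows "kappa l d v (B, \<gamma>) = (\<Sum>a\<in>UNIV - B.
    if unit_vec a pdvd \<gamma> then sg a B * v (insert a B, \<gamma> - unit_vec a) else 0)"
proof -
  \<comment> \<open>\<open>kappa\<close> is given by images of basis elements, \<open>koszul\<close>
    by coefficients; the equivalence inverts the relation between the source (A, \<beta>) and the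
    target (B, \<gamma>). S_d(F) plays the part of the polynomials of degree d.\<close>
  have eq: "a \<in> A \<and> (B, \<gamma>) = (A - {a}, unit_vec a + \<beta>) \<longleftrightarrow>
      a \<notin> B \<and> unit_vec a pdvd \<gamma> \<and> (A, \<beta>) = (insert a B, \<gamma> - unit_vec a)" for a A \<beta>
  proof
    assume "a \<in> A \<and> (B, \<gamma>) = (A - {a}, unit_vec a + \<beta>)"
    then show "a \<notin> B \<and> unit_vec a pdvd \<gamma> \<and> (A, \<beta>) = (insert a B, \<gamma> - unit_vec a)"
      using pdvd_add(2)[of "unit_vec a" \<beta>] by auto
  next
    assume "a \<notin> B \<and> unit_vec a pdvd \<gamma> \<and> (A, \<beta>) = (insert a B, \<gamma> - unit_vec a)"
    then show "a \<in> A \<and> (B, \<gamma>) = (A - {a}, unit_vec a + \<beta>)"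
      using pdvd_diff_add[of "unit_vec a" \<gamma>] by (auto simp: add.commute)
  qed
  have "v (A, \<beta>) * kappa_basis A \<beta> (B, \<gamma>) = (\<Sum>a\<in>UNIV - B.
      if (A, \<beta>) = (insert a B, \<gamma> - unit_vec a)
      then (if unit_vec a pdvd \<gamma> then sg a B * v (insert a B, \<gamma> - unit_vec a) else 0) else 0)" for A \<beta>
  proof -
    have "v (A, \<beta>) * kappa_basis A \<beta> (B, \<gamma>) = (\<Sum>a\<in>UNIV. if a \<in> A \<and> (B, \<gamma>) = (A - {a}, unit_vec a + \<beta>)
        then v (A, \<beta>) * (-1) ^ card {b \<in> A. b < a} else 0)"
      unfolding kappa_basis_def sum_distrib_left by (intro sum.mono_neutral_cong_left) auto
    also have "\<dots> = (\<Sum>a\<in>UNIV. if a \<notin> B \<and> unit_vec a pdvd \<gamma> \<and> (A, \<beta>) = (insert a B, \<gamma> - unit_vec a)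
        then sg a B * v (insert a B, \<gamma> - unit_vec a) else 0)"
      unfolding eq
    proof (intro sum.cong refl if_cong)
      fix a assume a: "a \<notin> B \<and> unit_vec a pdvd \<gamma> \<and> (A, \<beta>) = (insert a B, \<gamma> - unit_vec a)"
      then have "{b \<in> A. b < a} = {b \<in> B. b < a}"
        by auto
      with a show "v (A, \<beta>) * (-1) ^ card {b \<in> A. b < a} = sg a B * v (insert a B, \<gamma> - unit_vec a)"
        by (simp add: sg_def mult.commute)
    qed
    also have "\<dots> = (\<Sum>a\<in>UNIV - B. if (A, \<beta>) = (insert a B, \<gamma> - unit_vec a)
        then (if unit_vec a pdvd \<gamma> then sg a B * v (insert a B, \<gamma> - unit_vec a) else 0) else 0)"
      by (intro sum.mono_neutral_cong_right) auto
    finally show ?thesis .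
  qed
  then have "kappa l d v (B, \<gamma>) = (\<Sum>x\<in>ext_sym_basis l d. \<Sum>a\<in>UNIV - B.
      if x = (insert a B, \<gamma> - unit_vec a)
      then (if unit_vec a pdvd \<gamma> then sg a B * v (insert a B, \<gamma> - unit_vec a) else 0) else 0)"
    unfolding kappa_def by (intro sum.cong) auto
  also have "\<dots> = (\<Sum>a\<in>UNIV - B. \<Sum>x\<in>ext_sym_basis l d.
      if x = (insert a B, \<gamma> - unit_vec a)
      then (if unit_vec a pdvd \<gamma> then sg a B * v (insert a B, \<gamma> - unit_vec a) else 0) else 0)"
    by (rule sum.swap)
  also have "\<dots> = (\<Sum>a\<in>UNIV - B. if unit_vec a pdvd \<gamma> then sg a B * v (insert a B, \<gamma> - unit_vec a) else 0)"
  proof (intro sum.cong refl)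
    fix a
    have "v (insert a B, \<gamma> - unit_vec a) = 0" if "(insert a B, \<gamma> - unit_vec a) \<notin> ext_sym_basis l d"
      using v that by (simp add: ext_sym_def)
    then show "(\<Sum>x\<in>ext_sym_basis l d. if x = (insert a B, \<gamma> - unit_vec a)
        then (if unit_vec a pdvd \<gamma> then sg a B * v (insert a B, \<gamma> - unit_vec a) else 0) else 0) =
      (if unit_vec a pdvd \<gamma> then sg a B * v (insert a B, \<gamma> - unit_vec a) else 0)"
      by (simp add: finite_ext_sym_basis)
  qed
  finally show ?thesis .
qed

lemma koszul_basis_full_eq: "koszul_basis full l (int d) = ext_sym_basis l d"
  by (auto simp: koszul_basis_def ext_sym_basis_def ext_basis_def)

lemma const_coeff_sg: "const_coeff (sg a B * f) = sg a B * const_coeff (f :: ('n, 'k::field) polyring)"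
proof -
  have "const_coeff (1 :: ('n, 'k) polyring) = 1"
    by (simp add: const_coeff_def)
  then have "const_coeff ((-1) ^ m :: ('n, 'k) polyring) = (-1) ^ m" for m
    by (induction m) (simp_all add: const_coeff_mult, simp add: const_coeff_def)
  then show ?thesis
    by (simp add: const_coeff_mult sg_def)
qed

text \<open>\<open>L \<otimes> k\<close> is the kernel of \<open>\<kappa>\<close> over \<open>k\<close>, because \<open>\<kappa>\<close> has integer entries.\<close>

lemma const_coeff_L_mod:
  "(\<lambda>v b. const_coeff (v b)) ` (L_mod l d :: ('n::{finite,linorder} set \<times> 'n expvec \<Rightarrow> ('n, 'k::field) polyring) set) =
    {u \<in> supported (koszul_basis full l (int d)). koszul u = 0}"
proof (intro equalityI subsetI)
  fix u :: "('n, 'k) kchain"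
  assume "u \<in> (\<lambda>v b. const_coeff (v b)) ` L_mod l d"
  then obtain v where v: "v \<in> ext_sym l d" "kappa l d v = (\<lambda>_. 0)" "u = (\<lambda>b. const_coeff (v b))"
    by (auto simp: L_mod_def)
  have "koszul u (B, \<gamma>) = const_coeff (kappa l d v (B, \<gamma>))" for B \<gamma>
    unfolding kappa_eq_sum[OF v(1)] const_coeff_sum
    by (auto simp: koszul_def v(3) const_coeff_sg intro!: sum.cong) (simp add: const_coeff_def)
  then have "koszul u = 0"
    using v(2) by (simp add: fun_eq_iff const_coeff_def)
  moreover have "u \<in> supported (koszul_basis full l (int d))"
    unfolding koszul_basis_full_eq using v(1) by (auto simp: v(3) supported_def ext_sym_def const_coeff_def) (metis lookup_zero)
  ultimately show "u \<in> {u \<in> supported (koszul_basis full l (int d)). koszul u = 0}"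
    by simp
next
  fix u :: "('n, 'k) kchain"
  assume u: "u \<in> {u \<in> supported (koszul_basis full l (int d)). koszul u = 0}"
  \<comment> \<open>A kernel element over k is lifted by constant polynomials, which
    \<open>kappa\<close> sends to constants.\<close>
  define v :: "'n set \<times> 'n expvec \<Rightarrow> ('n, 'k) polyring" where "v b = Poly_Mapping.single 0 (u b)" for b
  have v: "v \<in> ext_sym l d"
    using u unfolding koszul_basis_full_eq by (auto simp: supported_def ext_sym_def v_def) (metis single_zero)
  have s: "sg a B * Poly_Mapping.single 0 c = (Poly_Mapping.single 0 (sg a B * c) :: ('n, 'k) polyring)" for a :: 'n and B c
  proof -
    have "(-1) ^ m * Poly_Mapping.single 0 c = (Poly_Mapping.single 0 ((-1) ^ m * c) :: ('n, 'k) polyring)" for m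
      by (induction m) (simp_all add: single_uminus)
    then show ?thesis
      by (simp add: sg_def)
  qed
  have "Poly_Mapping.single 0 (\<Sum>a\<in>A. f a) = (\<Sum>a\<in>A. Poly_Mapping.single 0 (f a) :: ('n, 'k) polyring)" for A :: "'n set" and f
    by (induction A rule: infinite_finite_induct) (simp_all add: single_add)
  then have "kappa l d v (B, \<gamma>) = Poly_Mapping.single 0 (koszul u (B, \<gamma>))" for B \<gamma>
    unfolding kappa_eq_sum[OF v] by (auto simp: koszul_def v_def s intro!: sum.cong)
  then have "kappa l d v = (\<lambda>_. 0)"
    using u by (simp add: fun_eq_iff)
  then have "v \<in> L_mod l d"
    using v by (simp add: L_mod_def)
  moreover have "u = (\<lambda>b. const_coeff (v b))"
    by (simp add: v_def const_coeff_def fun_eq_iff)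
  ultimately show "u \<in> (\<lambda>v b. const_coeff (v b)) ` L_mod l d"
    by blast
qed

lemma phi_rank_eq:
  "phi_rank TYPE('k::field) l d \<alpha> = kdim ((\<lambda>u A. if A \<subseteq> I_set d \<alpha> then u (A, \<alpha>) else 0) `
    {u \<in> supported (koszul_basis full l (int d)) :: ('n::{finite,linorder} set \<times> 'n expvec \<Rightarrow> 'k) set. koszul u = 0})"
proof -
  have "const_coeff (phi (I_set d \<alpha>) \<alpha> v A) = (if A \<subseteq> I_set d \<alpha> then const_coeff (v (A, \<alpha>)) else 0)"
    for v :: "'n set \<times> 'n expvec \<Rightarrow> ('n, 'k) polyring" and A
    by (simp add: phi_def const_coeff_def)
  then show ?thesis
    unfolding phi_rank_def const_coeff_L_mod[symmetric] by (simp add: image_image)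
qed

section \<open>Boundaries in row d\<close>

context separated_monomials
begin

lemma subspace_boundaries:
  "fun_space.subspace (koszul_boundaries std l e :: ('n set \<times> 'n expvec \<Rightarrow> 'k::field) set)"
  unfolding koszul_boundaries_def
  by (rule vector_space_pair.linear_subspace_image[OF vector_space_pair.intro linear_koszul_mod subspace_supported])
    (rule vector_space_fun)+

lemma boundaries_project:
  fixes v :: "'n set \<times> 'n expvec \<Rightarrow> 'k::field"
  assumes "v \<in> koszul_boundaries std l (int d)" "\<alpha> \<in> S"
  shows "(\<lambda>b. if snd b = \<alpha> then v b else 0) \<in> koszul_boundaries std l (int d)"
proof -
  obtain w where w: "w \<in> supported (koszul_basis full (Suc l) (int d - 1))" "v = restr std (koszul w)"
    using assms(1) unfolding koszul_boundaries_eq by auto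
  \<comment> \<open>Only the terms whose monomial divides x^\<alpha> are kept. They include all that
    reach x^\<alpha>, and none reaches another member of S, as that member would share with
    x^\<alpha> the common multiple x^\<alpha> x_a of degree d + 1.\<close>
  define w' where "w' = (\<lambda>(A, \<beta>). if \<beta> pdvd \<alpha> then w (A, \<beta>) else 0)"
  have w': "w' \<in> supported (koszul_basis full (Suc l) (int d - 1))"
    using w(1) by (auto simp: w'_def supported_def)
  have "restr std (koszul w') (B, \<gamma>) = (if \<gamma> = \<alpha> then v (B, \<gamma>) else 0)" for B \<gamma>
  proof (cases "std \<gamma> \<and> mdeg \<gamma> = d")
    case True
    then have g: "\<gamma> \<in> S"
      using std_eq by blast
    show ?thesis
    proof (cases "\<gamma> = \<alpha>")
      case True
      have "koszul w' (B, \<alpha>) = koszul w (B, \<alpha>)"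
        unfolding koszul_def w'_def by (auto simp: diff_pdvd intro!: sum.cong)
      with True show ?thesis
        by (simp add: restr_def w(2))
    next
      case False
      have "koszul w' (B, \<gamma>) = 0"
      proof (rule ccontr)
        assume "koszul w' (B, \<gamma>) \<noteq> 0"
        then obtain a where a: "unit_vec a pdvd \<gamma>" "w' (insert a B, \<gamma> - unit_vec a) \<noteq> 0"
          by (rule koszul_nonzeroE)
        then have "\<gamma> - unit_vec a pdvd \<alpha>"
          by (auto simp: w'_def split: if_splits)
        then have "\<gamma> pdvd \<alpha> + unit_vec a"
          unfolding pdvd_def lookup_minus lookup_add by (simp add: le_diff_conv)
        then have "\<gamma> = \<alpha>"
          using deg_S[OF assms(2)] by (intro common_multiple[OF g assms(2), of "\<alpha> + unit_vec a"])
            (simp_all add: pdvd_add mdeg_add mdeg_single)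
        with False show False ..
      qed
      with False show ?thesis
        by (simp add: restr_def)
    qed
  next
    case False
    have "koszul x (B, \<gamma>) = 0" if "x \<in> supported (koszul_basis full (Suc l) (int d - 1))" "mdeg \<gamma> \<noteq> d"
      for x :: "('n, 'k) kchain"
      using koszul_supported[OF that(1)] that(2) by (auto simp: supported_def koszul_basis_def)
    then show ?thesis
      using False w(1) w' by (auto simp: restr_def w(2))
  qed
  then have "(\<lambda>b. if snd b = \<alpha> then v b else 0) = restr std (koszul w')"
    by (simp add: fun_eq_iff)
  then show ?thesis
    unfolding koszul_boundaries_eq using w' by blast
qed

lemma kdim_boundaries_phi_rank:
  assumes "l \<ge> 1"
  shows "kdim (koszul_boundaries std l (int d) :: ('n set \<times> 'n expvec \<Rightarrow> 'k::field) set) =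
    (\<Sum>\<alpha>\<in>S. phi_rank TYPE('k) l d \<alpha>)"
proof -
  let ?V = "koszul_boundaries std l (int d) :: ('n, 'k) kchain set"
  let ?p = "\<lambda>\<alpha> v b. if snd b = \<alpha> then v b else (0 :: 'k)"
  let ?K = "{u \<in> supported (koszul_basis full l (int d)) :: ('n, 'k) kchain set. koszul u = 0}"
  have supp: "?V \<subseteq> supported (koszul_basis std l (int d))"
    using boundaries_subset_cycles cycles_subset by blast
  have VK: "?V = restr std ` ?K"
    using koszul_kernel[of l "int d", where 'n='n and 'k='k] assms by (simp add: koszul_boundaries_eq)
  have "kdim ?V = (\<Sum>\<alpha>\<in>S. kdim (?p \<alpha> ` ?V))"
  proof (rule kdim_fibre_sum[OF finite_S subspace_boundaries finite_koszul_basis supp])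
    fix v b assume v: "v \<in> ?V" "v b \<noteq> 0"
    have "v \<in> koszul_cycles std l (int d)"
      using v(1) boundaries_subset_cycles by blast
    then show "snd b \<in> S"
      using v(2) unfolding cycles_degree_d by (cases b) (auto simp: supported_def)
  qed (rule boundaries_project)
  also have "\<dots> = (\<Sum>\<alpha>\<in>S. phi_rank TYPE('k) l d \<alpha>)"
  proof (rule sum.cong[OF refl])
    fix \<alpha> assume \<alpha>: "\<alpha> \<in> S"
    let ?J = "\<lambda>(v :: ('n, 'k) kchain) A. v (A, \<alpha>)"
    have sub: "?p \<alpha> ` ?V \<subseteq> ?V"
      using boundaries_project[OF _ \<alpha>] by blast
    have lin: "Vector_Spaces.linear fscale fscale (?p \<alpha>)"
      by (rule linear_funI) (auto simp: fun_eq_iff)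
    have "kdim (?J ` ?p \<alpha> ` ?V) = kdim (?p \<alpha> ` ?V)"
    proof (rule kdim_inj_image[OF _ _ finite_koszul_basis order.trans[OF sub supp]])
      show "Vector_Spaces.linear fscale fscale ?J"
        by (rule linear_funI) auto
      show "fun_space.subspace (?p \<alpha> ` ?V)"
        by (rule vector_space_pair.linear_subspace_image[OF vector_space_pair.intro lin subspace_boundaries])
          (rule vector_space_fun)+
      show "w = 0" if w: "w \<in> ?p \<alpha> ` ?V" "?J w = 0" for w
      proof -
        have "w (A, \<alpha>) = 0" for A
          using fun_cong[OF w(2), of A] by simp
        moreover have "w b = 0" if "snd b \<noteq> \<alpha>" for b
          using w(1) that by auto
        ultimately have "w b = 0" for b
          by (metis prod.collapse)
        then show ?thesis
          by (simp add: fun_eq_iff)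
      qed
    qed
    \<comment> \<open>\<open>phi\<close> also discards the e_A with \<open>A\<close> outside
      \<open>I_set\<close>, the fibre projection does not. On boundaries this makes no difference:
      they are cycles and vanish there.\<close>
    moreover have "?J ` ?p \<alpha> ` ?V = (\<lambda>u A. if A \<subseteq> I_set d \<alpha> then u (A, \<alpha>) else 0) ` ?K"
      unfolding VK image_image
    proof (rule image_cong[OF refl])
      fix u assume "u \<in> ?K"
      then have "restr std u \<in> koszul_cycles std l (int d)"
        using VK boundaries_subset_cycles by blast
      then have *: "restr std u (A, \<alpha>) = 0" if "\<not> A \<subseteq> I_set d \<alpha>" for A
        using that unfolding cycles_degree_d supported_def ext_basis_def by blast
      have "restr std u (A, \<alpha>) = u (A, \<alpha>)" for A
        using \<alpha> deg_S std_eq by (simp add: restr_def)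
      with * show "?J (?p \<alpha> (restr std u)) = (\<lambda>A. if A \<subseteq> I_set d \<alpha> then u (A, \<alpha>) else 0)"
        by (auto simp: fun_eq_iff)
    qed
    ultimately show "kdim (?p \<alpha> ` ?V) = phi_rank TYPE('k) l d \<alpha>"
      by (simp only: phi_rank_eq)
  qed
  finally show ?thesis .
qed

text \<open>As d >= 1, every x^\<alpha> is a multiple of a variable, so in exterior degree 0 all
  chains of row d bound. This value takes the place of rk_0 in column 1.\<close>

lemma kdim_boundaries_0:
  "kdim (koszul_boundaries std 0 (int d) :: ('n set \<times> 'n expvec \<Rightarrow> 'k::field) set) = card S"
proof -
  have "koszul_boundaries std 0 (int d) = (koszul_cycles std 0 (int d) :: ('n, 'k) kchain set)"
    by (rule antisym[OF boundaries_subset_cycles koszul_homology_row0]) (use d_pos in simp_all)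
  moreover have "ext_basis I 0 = {{}}" for I :: "'n set"
    by (auto simp: ext_basis_def)
  ultimately show ?thesis
    by (simp add: kdim_cycles_degree_d ext_rank_def)
qed

lemma kdim_boundaries_top:
  "kdim (koszul_boundaries std (CARD('n)) e :: ('n set \<times> 'n expvec \<Rightarrow> 'k::field) set) = 0"
proof -
  have "card A \<noteq> Suc (CARD('n))" for A :: "'n set"
    using card_mono[of UNIV A] by auto
  then have "koszul_basis full (Suc (CARD('n))) (e - 1) = ({} :: ('n set \<times> 'n expvec) set)"
    by (auto simp: koszul_basis_def)
  moreover have "restr std (0 :: ('n, 'k) kchain) = 0"
    by (simp add: restr_def fun_eq_iff)
  ultimately show ?thesis
    by (simp add: koszul_boundaries_eq supported_empty koszul_zero kdim_zero)
qed

lemma boundaries_subtop_subset: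
  "koszul_boundaries std (CARD('n) - 1) (int d) \<subseteq>
    (supported {(UNIV - {a}, \<alpha>) | a \<alpha>. \<alpha> \<in> S \<and> unit_vec a pdvd \<alpha>} :: ('n set \<times> 'n expvec \<Rightarrow> 'k::field) set)"
proof
  fix v :: "('n, 'k) kchain" assume v: "v \<in> koszul_boundaries std (CARD('n) - 1) (int d)"
  then obtain w where w: "w \<in> supported (koszul_basis full (Suc (CARD('n) - 1)) (int d - 1))" "v = restr std (koszul w)"
    unfolding koszul_boundaries_eq by auto
  show "v \<in> supported {(UNIV - {a}, \<alpha>) | a \<alpha>. \<alpha> \<in> S \<and> unit_vec a pdvd \<alpha>}"
    unfolding supported_def
  proof safe
    fix B \<alpha> assume nz: "v (B, \<alpha>) \<noteq> 0"
    then have "mdeg \<alpha> = d" "std \<alpha>"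
      using v boundaries_subset_cycles cycles_subset by (fastforce simp: supported_def koszul_basis_def)+
    then have "\<alpha> \<in> S"
      using std_eq by simp
    moreover have "koszul w (B, \<alpha>) \<noteq> 0"
      using nz by (auto simp: w(2) restr_def split: if_splits)
    then obtain a where a: "a \<notin> B" "unit_vec a pdvd \<alpha>" "w (insert a B, \<alpha> - unit_vec a) \<noteq> 0"
      by (rule koszul_nonzeroE)
    then have "card (insert a B) = CARD('n)"
      using w(1) by (auto simp: supported_def koszul_basis_def)
    then have "insert a B = UNIV"
      by (intro card_subset_eq) auto
    then have "B = UNIV - {a}"
      using a(1) by auto
    ultimately show "\<exists>a \<alpha>'. (B, \<alpha>) = (UNIV - {a}, \<alpha>') \<and> \<alpha>' \<in> S \<and> unit_vec a pdvd \<alpha>'"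
      using a(2) by blast
  qed
qed

text \<open>By \<open>common_lower\<close> the boundary of e_[n] \<otimes> x^(\<alpha> -
  \<epsilon>_a) has a single surviving term, up to sign e_([n] - a) \<otimes> x^\<alpha>, so each
  basis element of this form is reached.\<close>

lemma boundaries_subtop:
  "koszul_boundaries std (CARD('n) - 1) (int d) =
    (supported {(UNIV - {a}, \<alpha>) | a \<alpha>. \<alpha> \<in> S \<and> unit_vec a pdvd \<alpha>} :: ('n set \<times> 'n expvec \<Rightarrow> 'k::field) set)"
proof (intro equalityI boundaries_subtop_subset subsetI)
  fix v :: "('n, 'k) kchain"
  assume v: "v \<in> supported {(UNIV - {a}, \<alpha>) | a \<alpha>. \<alpha> \<in> S \<and> unit_vec a pdvd \<alpha>}"
  \<comment> \<open>At most one summand is nonzero for each \<beta>; the sum avoids choosing the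
    variable \<open>a\<close>.\<close>
  define w where "w = (\<lambda>(A, \<beta>). if A = (UNIV :: 'n set) then \<Sum>a\<in>UNIV. if unit_vec a + \<beta> \<in> S
    then sg a (UNIV - {a}) * v (UNIV - {a}, unit_vec a + \<beta>) else 0 else 0)"
  have w: "w \<in> supported (koszul_basis full (Suc (CARD('n) - 1)) (int d - 1))"
    unfolding supported_def
  proof safe
    fix A \<beta> assume nz: "w (A, \<beta>) \<noteq> 0"
    then have A: "A = UNIV"
      by (auto simp: w_def split: if_splits)
    with nz have "(\<Sum>a\<in>UNIV. if unit_vec a + \<beta> \<in> S
      then sg a (UNIV - {a}) * v (UNIV - {a}, unit_vec a + \<beta>) else 0) \<noteq> 0"
      by (simp add: w_def)
    then obtain a where "(if unit_vec a + \<beta> \<in> S then sg a (UNIV - {a}) * v (UNIV - {a}, unit_vec a + \<beta>) else 0) \<noteq> 0"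
      by (rule sum.not_neutral_contains_not_neutral)
    then have "mdeg (unit_vec a + \<beta>) = d"
      using deg_S by (auto split: if_splits)
    then show "(A, \<beta>) \<in> koszul_basis full (Suc (CARD('n) - 1)) (int d - 1)"
      by (auto simp: A koszul_basis_def mdeg_add mdeg_single)
  qed
  have "restr std (koszul w) (B, \<gamma>) = v (B, \<gamma>)" for B \<gamma>
  proof (cases "\<gamma> \<in> S \<and> (\<exists>a. B = UNIV - {a} \<and> unit_vec a pdvd \<gamma>)")
    case True
    then obtain b where b: "B = UNIV - {b}" "unit_vec b pdvd \<gamma>" and g: "\<gamma> \<in> S"
      by auto
    have UB: "UNIV - B = {b}" "insert b B = UNIV"
      using b(1) by auto
    have gb: "unit_vec b + (\<gamma> - unit_vec b) = \<gamma>"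
      using pdvd_diff_add[OF b(2)] by (simp add: add.commute)
    have mem: "unit_vec a + (\<gamma> - unit_vec b) \<in> S \<longleftrightarrow> a = b" for a
      using common_lower[of a "\<gamma> - unit_vec b" b] gb g by auto
    have "w (UNIV, \<gamma> - unit_vec b) = sg b B * v (B, \<gamma>)"
      by (simp add: w_def mem gb b(1))
    then have "koszul w (B, \<gamma>) = sg b B * (sg b B * v (B, \<gamma>))"
      by (simp add: koszul_def UB b(2))
    then have "koszul w (B, \<gamma>) = v (B, \<gamma>)"
      by (simp only: mult.assoc[symmetric] sg_square) simp
    moreover have "std \<gamma>"
      using g deg_S std_eq by simp
    ultimately show ?thesis
      by (simp add: restr_def)
  next
    case False
    then have notin: "(B, \<gamma>) \<notin> {(UNIV - {a}, \<alpha>) | a \<alpha>. \<alpha> \<in> S \<and> unit_vec a pdvd \<alpha>}"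
      by auto
    have "restr std (koszul w) \<in> koszul_boundaries std (CARD('n) - 1) (int d)"
      unfolding koszul_boundaries_eq using w by blast
    then have "restr std (koszul w) \<in> supported {(UNIV - {a}, \<alpha>) | a \<alpha>. \<alpha> \<in> S \<and> unit_vec a pdvd \<alpha>}"
      using boundaries_subtop_subset by blast
    with v notin have "restr std (koszul w) (B, \<gamma>) = 0" "v (B, \<gamma>) = 0"
      unfolding supported_def by blast+
    then show ?thesis by simp
  qed
  then have "v = restr std (koszul w)"
    by (simp add: fun_eq_iff)
  then show "v \<in> koszul_boundaries std (CARD('n) - 1) (int d)"
    unfolding koszul_boundaries_eq using w by blast
qed

lemma kdim_boundaries_subtop:
  "kdim (koszul_boundaries std (CARD('n) - 1) (int d) :: ('n set \<times> 'n expvec \<Rightarrow> 'k::field) set) =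
    (\<Sum>\<alpha>\<in>S. supp_card \<alpha>)"
proof -
  let ?T = "SIGMA \<alpha>:S. {a. 0 < Poly_Mapping.lookup \<alpha> a}"
  let ?f = "\<lambda>(\<alpha>, a). (UNIV - {a}, \<alpha>) :: 'n set \<times> 'n expvec"
  have eq: "{(UNIV - {a}, \<alpha>) | a \<alpha>. \<alpha> \<in> S \<and> unit_vec a pdvd \<alpha>} = ?f ` ?T"
    by (auto simp: unit_vec_pdvd image_iff)
  have fin: "finite ?T"
    using finite_S by (intro finite_SigmaI) auto
  have "inj_on ?f ?T"
    by (auto simp: inj_on_def)
  then have "card (?f ` ?T) = card ?T"
    by (rule card_image)
  also have "\<dots> = (\<Sum>\<alpha>\<in>S. supp_card \<alpha>)"
    unfolding supp_card_def using finite_S by (intro card_SigmaI) auto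
  finally show ?thesis
    unfolding boundaries_subtop eq using fin by (simp add: kdim_supported)
qed

text \<open>If x^\<alpha> is not a power of x_j, another variable x_i divides it. Up to sign the
  boundary of e_{i,j} \<otimes> x^(\<alpha> - \<epsilon>_i) has the terms e_j \<otimes> x^\<alpha>
  and e_i \<otimes> x^(\<alpha> - \<epsilon>_i + \<epsilon>_j), and the second vanishes in the
  quotient by \<open>common_lower\<close>. This reflects that K' is generated in degree d.\<close>

lemma koszul_homology_generators:
  "koszul_cycles std 1 (int d) \<subseteq> (koszul_boundaries std 1 (int d) :: ('n set \<times> 'n expvec \<Rightarrow> 'k::field) set)"
proof
  fix u :: "('n, 'k) kchain" assume u: "u \<in> koszul_cycles std 1 (int d)"
  let ?T = "{(A, \<alpha>). \<alpha> \<in> S \<and> A \<in> ext_basis (I_set d \<alpha>) 1}"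
  have mem: "unit_fun (A, \<alpha>) \<in> (koszul_boundaries std 1 (int d) :: ('n, 'k) kchain set)"
    if al: "\<alpha> \<in> S" and A: "A \<in> ext_basis (I_set d \<alpha>) 1" for A \<alpha>
  proof -
    obtain j where j: "A = {j}" "\<alpha> \<noteq> Poly_Mapping.single j d"
      using A by (auto simp: ext_basis_def I_set_def card_1_singleton_iff One_nat_def)
    obtain i where i: "i \<noteq> j" "unit_vec i pdvd \<alpha>"
      using single_of_support[of j \<alpha>] j(2) deg_S[OF al] unfolding unit_vec_pdvd by auto
    have deg: "mdeg (\<alpha> - unit_vec i) + 1 = d"
      using mdeg_diff[OF i(2)] deg_S[OF al] by (simp add: mdeg_single)
    have ai: "unit_vec i + (\<alpha> - unit_vec i) = \<alpha>"
      using pdvd_diff_add[OF i(2)] by (simp add: add.commute)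
    let ?w = "unit_fun ({i, j}, \<alpha> - unit_vec i) :: ('n, 'k) kchain"
    have w: "?w \<in> supported (koszul_basis full (Suc 1) (int d - 1))"
      using i(1) deg by (auto simp: supported_def koszul_basis_def unit_fun_def split: if_splits)
    have eq: "restr std (koszul ?w) = (\<lambda>b. sg i {j} * unit_fun (A, \<alpha>) b)"
    proof
      fix b :: "'n set \<times> 'n expvec"
      obtain B \<gamma> where b: "b = (B, \<gamma>)"
        by (cases b)
      show "restr std (koszul ?w) b = sg i {j} * unit_fun (A, \<alpha>) b"
      proof (cases "b = (A, \<alpha>)")
        case True
        have "koszul ?w (A, \<alpha>) = (\<Sum>a\<in>UNIV - {j}. if a = i then sg i {j} else 0)"
          unfolding koszul_def prod.case j(1) unit_fun_def using i by (intro sum.cong) (auto simp: doubleton_eq_iff)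
        also have "\<dots> = sg i {j}"
          using i(1) by simp
        finally show ?thesis
          using True std_eq[OF deg_S[OF al]] al by (simp add: restr_def unit_fun_def)
      next
        case False
        have "koszul ?w (B, \<gamma>) = 0" if std: "std \<gamma>"
        proof (rule ccontr)
          assume "koszul ?w (B, \<gamma>) \<noteq> 0"
          then obtain a where a: "a \<notin> B" "unit_vec a pdvd \<gamma>" "?w (insert a B, \<gamma> - unit_vec a) \<noteq> 0"
            by (rule koszul_nonzeroE)
          then have *: "insert a B = {i, j}" "\<gamma> - unit_vec a = \<alpha> - unit_vec i"
            by (auto simp: unit_fun_def split: if_splits)
          have ga: "unit_vec a + (\<alpha> - unit_vec i) = \<gamma>"
            using pdvd_diff_add[OF a(2)] *(2) by (simp add: add.commute)
          then have "mdeg \<gamma> = d"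
            using deg by (auto simp: mdeg_add mdeg_single)
          then have "\<gamma> \<in> S"
            using std std_eq by blast
          then have "a = i"
            using common_lower[of a "\<alpha> - unit_vec i" i] ga ai al by simp
          then have "\<gamma> = \<alpha>" "B = A"
            using ga ai *(1) a(1) j(1) i(1) by auto
          with False b show False by simp
        qed
        with False show ?thesis
          by (auto simp: b restr_def unit_fun_def)
      qed
    qed
    have "restr std (koszul ?w) \<in> koszul_boundaries std 1 (int d)"
      unfolding koszul_boundaries_eq using w by blast
    then have "(\<lambda>b. sg i {j} * restr std (koszul ?w) b) \<in> koszul_boundaries std 1 (int d)"
      by (rule fun_space.subspace_scale[OF subspace_boundaries])
    moreover have "(\<lambda>b. sg i {j} * restr std (koszul ?w) b) = unit_fun (A, \<alpha>)"
      unfolding eq by (simp only: mult.assoc[symmetric] sg_square) simp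
    ultimately show ?thesis by simp
  qed
  have finT: "finite ?T"
    by (rule finite_subset[of _ "UNIV \<times> S"]) (auto simp: finite_S)
  have uT: "u \<in> supported ?T"
    using u unfolding cycles_degree_d .
  have "u = (\<Sum>b\<in>?T. (\<lambda>x. u b * unit_fun b x))"
    by (rule supported_eq_sum[OF finT uT])
  also have "\<dots> \<in> koszul_boundaries std 1 (int d)"
  proof (rule fun_space.subspace_sum[OF subspace_boundaries], rule fun_space.subspace_scale[OF subspace_boundaries])
    fix b assume "b \<in> ?T"
    then show "unit_fun b \<in> (koszul_boundaries std 1 (int d) :: ('n, 'k) kchain set)"
      using mem by auto
  qed
  finally show "u \<in> koszul_boundaries std 1 (int d)" .
qed

lemma koszul_homology_origin:
  "kdim (koszul_cycles std 0 0 :: ('n set \<times> 'n expvec \<Rightarrow> 'k::field) set) -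
    kdim (koszul_boundaries std 0 0 :: ('n, 'k) kchain set) = 1"
proof -
  have "std 0"
    using d_pos by (intro std_low) (simp add: mdeg_def)
  then have b: "koszul_basis std 0 0 = {({} :: 'n set, 0 :: 'n expvec)}"
    by (auto simp: koszul_basis_def mdeg_zero_iff)
  have "koszul_mod std u = 0" if "u \<in> supported (koszul_basis std 0 0)" for u :: "('n, 'k) kchain"
    using koszul_top[OF that] by (simp add: koszul_mod_eq_restr restr_def fun_eq_iff)
  then have "koszul_cycles std 0 0 = (supported (koszul_basis std 0 0) :: ('n, 'k) kchain set)"
    by (auto simp: koszul_cycles_def)
  moreover have "koszul_basis full (Suc 0) (0 - 1) = ({} :: ('n set \<times> 'n expvec) set)"
    by (auto simp: koszul_basis_def)
  moreover have "restr std (0 :: ('n, 'k) kchain) = 0"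
    by (simp add: restr_def fun_eq_iff)
  ultimately show ?thesis
    by (simp add: koszul_boundaries_eq supported_empty koszul_zero kdim_zero b kdim_supported One_nat_def)
qed

text \<open>The chosen complex is a resolution because one exists, and
  \<open>homology_dim_eq_koszul\<close> applies to it whichever it is.\<close>

lemma betti_eq_koszul:
  "betti (complement_ideal d S :: ('n, 'k::field) polyring set) l e =
    kdim (koszul_cycles std l e :: ('n, 'k) kchain set) -
    kdim (koszul_boundaries std l e :: ('n, 'k) kchain set)"
proof -
  let ?I = "complement_ideal d S :: ('n, 'k) polyring set"
  let ?C = "SOME C. graded_free_resolution C ?I"
  have "finite {\<beta>. mdeg \<beta> = d \<and> \<beta> \<notin> S}"
    by (rule finite_subset[OF _ finite_mdeg[of d]]) auto
  then have res: "graded_free_resolution ?C ?I"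
    unfolding complement_ideal_def by (rule someI_ex[OF ex_graded_free_resolution])
  interpret resolved_monomial_quotient ?C ?I std
  proof unfold_locales
    show "graded_free_resolution ?C ?I"
      by (rule res)
    fix f :: "('n, 'k) polyring"
    show "f \<in> ?I \<longleftrightarrow> (\<forall>\<gamma>. Poly_Mapping.lookup f \<gamma> \<noteq> 0 \<longrightarrow> \<not> std \<gamma>)"
      unfolding complement_ideal_def mem_monomial_ideal_iff std_def by (auto simp: in_keys_iff)
  qed (blast intro: std_pdvd)
  show ?thesis
    unfolding betti_def tor_dim_def by (rule homology_dim_eq_koszul)
qed

end

section \<open>The Betti table\<close>

theorem corollary5p6:
  fixes \<alpha> :: "nat \<Rightarrow> 'n::{finite,linorder} expvec"
    and d r n :: nat
    and K :: "('n, 'k::field) polyring set"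
    and rk :: "nat \<Rightarrow> nat"
  assumes n: "n = CARD('n)"
    and d: "d \<ge> 1"
    and deg: "\<And>s. s \<in> {1..r} \<Longrightarrow> mdeg (\<alpha> s) = d"
    and lcm: "\<And>s t. s \<in> {1..r} \<Longrightarrow> t \<in> {1..r} \<Longrightarrow> s \<noteq> t \<Longrightarrow> lcm_deg (\<alpha> s) (\<alpha> t) \<ge> d + 2"
    and rk: "\<And>l. rk l = rk_sum TYPE('k) d r \<alpha> l"
    and K: "K = complement_ideal d (\<alpha> ` {1..r})"
  shows
    \<comment> \<open>column 0\<close>
    "betti K 0 0 = 1 \<and> (\<forall>j. j \<noteq> 0 \<longrightarrow> betti K 0 j = 0) \<and>
    \<comment> \<open>column 1\<close>
     int (betti K 1 (int d - 1)) = int ((n + d - 1) choose d) - int r \<and>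
     betti K 1 (int d) = 0 \<and>
    \<comment> \<open>column l\<close>
     (\<forall>l. 2 \<le> l \<and> l \<le> n \<longrightarrow>
        int (betti K l (int d - 1)) =
          int (((n + d - 1) choose (l + d - 1)) * ((d + l - 2) choose (l - 1))) - int (rk (l - 1)) \<and>
        int (betti K l (int d)) =
          (\<Sum>s=1..r. int (ext_rank (I_set d (\<alpha> s)) l)) - int (rk l)) \<and>
    \<comment> \<open>column n; pure powers do not contribute to the entry in row d\<close>
     int (betti K n (int d - 1)) =
       int ((n + d - 2) choose (n - 1)) - (\<Sum>s=1..r. int (supp_card (\<alpha> s))) \<and>
     int (betti K n (int d)) =
       int r - int (card {s \<in> {1..r}. \<exists>i. \<alpha> s = Poly_Mapping.single i d}) \<and>
    \<comment> \<open>all other entries\<close>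
     (\<forall>l j. l \<ge> 1 \<and> j \<noteq> int d - 1 \<and> j \<noteq> int d \<longrightarrow> betti K l j = 0) \<and>
     (\<forall>l j. l > n \<longrightarrow> betti K l j = 0)"
proof -
  define S where "S = \<alpha> ` {1..r}"
  \<comment> \<open>A monomial has an lcm of degree d with itself, so the lcm hypothesis makes the
    family injective and turns sums over \<open>S\<close> into sums over s.\<close>
  have distinct: "\<alpha> s \<noteq> \<alpha> t" if "s \<in> {1..r}" "t \<in> {1..r}" "s \<noteq> t" for s t
  proof
    assume "\<alpha> s = \<alpha> t"
    then have "lcm_deg (\<alpha> s) (\<alpha> t) = d"
      using deg[OF that(1)] by (simp add: lcm_deg_def mdeg_def)
    then show False
      using lcm[OF that] by simp
  qed
  then have inj: "inj_on \<alpha> {1..r}"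
    by (meson inj_onI)
  interpret separated_monomials S d
  proof
    show "finite S"
      by (simp add: S_def)
    show "1 \<le> d"
      by (rule d)
    show "mdeg \<beta> = d" if "\<beta> \<in> S" for \<beta>
      using that deg by (auto simp: S_def)
    show "d + 2 \<le> lcm_deg \<beta> \<gamma>" if "\<beta> \<in> S" "\<gamma> \<in> S" "\<beta> \<noteq> \<gamma>" for \<beta> \<gamma>
      using that lcm unfolding S_def by blast
  qed
  have sumS: "(\<Sum>\<beta>\<in>S. f \<beta>) = (\<Sum>s=1..r. f (\<alpha> s))" for f :: "'n expvec \<Rightarrow> nat"
    by (simp add: S_def sum.reindex[OF inj])
  have cardS: "card S = r"
    by (simp add: S_def card_image[OF inj])
  have betti: "betti K l e = kdim (koszul_cycles std l e :: ('n, 'k) kchain set) -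
      kdim (koszul_boundaries std l e :: ('n, 'k) kchain set)" for l e
    unfolding K S_def[symmetric] by (rule betti_eq_koszul)
  have n_pos: "n \<ge> 1"
    unfolding n by (simp add: Suc_leI One_nat_def)
  have rk_eq: "kdim (koszul_boundaries std l (int d) :: ('n, 'k) kchain set) = rk l" if "l \<ge> 1" for l
    unfolding kdim_boundaries_phi_rank[OF that] sumS rk rk_sum_def ..
  have low_row: "int (betti K l (int d - 1)) =
      int (((n + d - 1) choose (l + d - 1)) * ((d + l - 2) choose (l - 1))) -
      int (kdim (koszul_boundaries std (l - 1) (int d) :: ('n, 'k) kchain set))" if "l \<ge> 1" for l
    unfolding betti n using that by (rule int_homology_low_row)
  have high_row: "int (betti K l (int d)) = (\<Sum>s=1..r. int (ext_rank (I_set d (\<alpha> s)) l)) -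
      int (kdim (koszul_boundaries std l (int d) :: ('n, 'k) kchain set))" for l
    unfolding betti of_nat_diff[OF kdim_boundaries_le]
    unfolding kdim_cycles_degree_d sumS by (simp add: of_nat_sum)
  have zero: "betti K l e = 0"
    if "koszul_cycles std l e \<subseteq> (koszul_boundaries std l e :: ('n, 'k) kchain set)" for l e
    unfolding betti using that by (rule koszul_homology_zeroI)
  have origin: "betti K 0 0 = 1"
    unfolding betti by (rule koszul_homology_origin)
  have column0: "betti K 0 j = 0" if "j \<noteq> 0" for j
    by (rule zero[OF koszul_homology_row0[OF refl that]])
  \<comment> \<open>For l = 1 the second binomial factor is 1, and the boundaries subtracted are
    those in exterior degree 0.\<close>
  have column1: "int (betti K 1 (int d - 1)) = int ((n + d - 1) choose d) - int r"
    using low_row[of 1] by (simp add: kdim_boundaries_0 cardS)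
  have column1': "betti K 1 (int d) = 0"
    by (rule zero[OF koszul_homology_generators])
  have column_l: "int (betti K l (int d - 1)) =
        int (((n + d - 1) choose (l + d - 1)) * ((d + l - 2) choose (l - 1))) - int (rk (l - 1)) \<and>
      int (betti K l (int d)) = (\<Sum>s=1..r. int (ext_rank (I_set d (\<alpha> s)) l)) - int (rk l)"
    if "2 \<le> l" for l
    using low_row[of l] high_row[of l] rk_eq[of l] rk_eq[of "l - 1"] that by simp
  \<comment> \<open>For l = n the first binomial factor is 1.\<close>
  have column_n: "int (betti K n (int d - 1)) =
      int ((n + d - 2) choose (n - 1)) - (\<Sum>s=1..r. int (supp_card (\<alpha> s)))"
    using low_row[OF n_pos] kdim_boundaries_subtop[where 'k='k] unfolding n[symmetric] sumS
    by (simp add: add.commute of_nat_sum)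
  \<comment> \<open>The n-th exterior power of U_s has rank 1 if U_s = F and rank 0 if U_s has rank
    n - 1. There are no boundaries in exterior degree n, so row d of column n counts the s of the
    first kind.\<close>
  have pure: "ext_rank (I_set d (\<alpha> s)) n = (if \<exists>i. \<alpha> s = Poly_Mapping.single i d then 0 else 1)" for s
  proof -
    have "A = UNIV" if "card A = n" for A :: "'n set"
      using that unfolding n by (intro card_subset_eq) auto
    then have "ext_basis (I_set d (\<alpha> s)) n = (if I_set d (\<alpha> s) = UNIV then {UNIV} else {})"
      using n by (auto simp: ext_basis_def)
    moreover have "I_set d (\<alpha> s) = UNIV \<longleftrightarrow> \<not> (\<exists>i. \<alpha> s = Poly_Mapping.single i d)"
      by (auto simp: I_set_def)
    ultimately show ?thesis
      by (simp add: ext_rank_def One_nat_def)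
  qed
  have column_n': "int (betti K n (int d)) = int r - int (card {s \<in> {1..r}. \<exists>i. \<alpha> s = Poly_Mapping.single i d})"
  proof -
    let ?P = "{s \<in> {1..r}. \<exists>i. \<alpha> s = Poly_Mapping.single i d}"
    have "(\<Sum>s=1..r. ext_rank (I_set d (\<alpha> s)) n) = card ({1..r} - ?P)"
      unfolding pure card_eq_sum by (intro sum.mono_neutral_cong_right) auto
    moreover have "card ({1..r} - ?P) + card ?P = r"
    proof -
      have sub: "?P \<subseteq> {1..r}"
        by blast
      then have "card ?P \<le> r"
        using card_mono[OF _ sub] by simp
      then show ?thesis
        using card_Diff_subset[OF finite_subset[OF sub] sub] by simp
    qed
    moreover have "int (betti K n (int d)) = int (\<Sum>s=1..r. ext_rank (I_set d (\<alpha> s)) n)"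
      using high_row[of n] kdim_boundaries_top[of "int d", where 'k='k] unfolding n by (simp add: of_nat_sum)
    ultimately show ?thesis
      by linarith
  qed
  have rest: "betti K l j = 0" if "l \<ge> 1" "j \<noteq> int d - 1" "j \<noteq> int d" for l j
  proof (cases "j + 1 < int d")
    case True
    show ?thesis
      by (rule zero[OF koszul_homology_low[OF that(1) True]])
  next
    case False
    show ?thesis
      by (rule zero, rule koszul_homology_high) (use False that in linarith)
  qed
  have beyond: "betti K l j = 0" if "l > n" for l j
    by (rule zero, rule koszul_homology_empty) (use that n in simp)
  show ?thesis
    using origin column0 column1 column1' column_l column_n column_n' rest beyond by blast
qed

end
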